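(* Let $n\ge1$, $N\ge0$ be integers. Consider the discrete Hamiltonian eigenvalue problem $$\Delta x_k=A_k(\lambda)x_{k+1}+B_k(\lambda)u_k,\quad \Delta u_k=C_k(\lambda)x_{k+1}-A_k^T(\lambda)u_k,\quad k\in[0,N]_{\mathbb Z},\qquad x_0(\lambda)=x_{N+1}(\lambda)=0,$$ with real $n\times n$ matrices $A_k(\lambda),B_k(\lambda),C_k(\lambda)$ such that $\det(I-A_k(\lambda))\neq0$ for all $\lambda\in\mathbb R$, and such that the Hamiltonian $$\mathcal H_k(\lambda)=\begin{pmatrix}-C_k(\lambda)&A_k^T(\lambda)\\ A_k(\lambda)&B_k(\lambda)\end{pmatrix}=\mathcal H_k^T(\lambda)$$ is continuous with piecewise continuous derivative in $\lambda$ and satisfies $\dot{\mathcal H}_k(\lambda)\ge0$, $\lambda\in\mathbb R$, $k\in[0,N]_{\mathbb Z}$. Let $$\mathcal S_k(\lambda)=\begin{pmatrix}(I-A_k)^{-1}&(I-A_k)^{-1}B_k\\ C_k(I-A_k)^{-1}&C_k(I-A_k)^{-1}B_k+I-A_k^T\end{pmatrix}(\lambda)$$ be the coefficient matrix of this system written as the symplectic system $y_{k+1}=\mathcal S_k(\lambda)y_k$, $y_k=\binom{x_k}{u_k}$, and let $\sigma$ be the set of finite eigenvalues of the problem. Then for any $a<b$ $$\operatorname{rank}(\mathcal S_k(a)-\mathcal S_k(\lambda^-))-\operatorname{rank}(\mathcal S_k(a)-\mathcal S_k(\lambda))=0,\quad\lambda\in(a,b],\ k\in[0,N]_{\mathbb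 Z},$$ and $$L_d^*\big((Z^{[0]}(a))^{-1}Y^{[N+1]}(b),0,N+1\big)=L_d\big((Z^{[N+1]}(a))^{-1}Y^{[0]}(b),0,N+1\big)=\#\{\nu\in\sigma\mid a<\nu\le b\}.$$
   Context: Notation: $[M,N]_{\mathbb Z}=[M,N]\cap\mathbb Z$; $\Delta x_k=x_{k+1}-x_k$; $\mathcal J=\begin{pmatrix}0&I\\ -I&0\end{pmatrix}$ (of the appropriate size); $S\in\mathbb R^{2n\times2n}$ is symplectic if $S^T\mathcal JS=\mathcal J$; $A^\dagger$ is the Moore-Penrose inverse; $\operatorname{ind}A$ is the number of negative eigenvalues of a symmetric matrix $A$; $A\ge0$ means symmetric nonnegative definite; $\operatorname{rank}A(\lambda^-)$ is the left-hand limit of $\operatorname{rank}A(\cdot)$ at $\lambda$ (all such limits used here exist under the hypotheses); $\dot{}=d/d\lambda$. For $l\in\{0,N+1\}$, $Z_k^{[l]}(\lambda)$ is the symplectic fundamental matrix of $y_{k+1}=\mathcal S_k(\lambda)y_k$ with $Z_l^{[l]}(\lambda)=I$, and $Y_k^{[l]}(\lambda)=Z_k^{[l]}(\lambda)\binom0I=\binom{X_k^{[l]}(\lambda)}{U_k^{[l]}(\lambda)}$ is the principal solution at $l$. A number $\lambda_0$ is a finite eigenvalue of the Dirichlet problem if $\theta(\lambda_0):=\operatorname{rank}X^{[0]}_{N+1}(\lambda_0^-)-\operatorname{rank}X^{[0]}_{N+1}(\lambda_0)\ge1$; $\#\{\nu\in\sigma\mid\dots\}$ counts finite eigenvalues with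 multiplicity $\theta$. Comparative index. For real $2m\times m$ matrices $Y=\binom XU$, $\hat Y=\binom{\hat X}{\hat U}$ of rank $m$ with $X^TU$, $\hat X^T\hat U$ symmetric, $\mu(Y,\hat Y)=\operatorname{rank}\mathcal M+\operatorname{ind}\mathcal D$, where $\mathcal M=(I-XX^\dagger)\hat X$, $\mathcal T=I-\mathcal M^\dagger\mathcal M$, $\mathcal D=\mathcal T\,w^T(Y,\hat Y)X^\dagger\hat X\,\mathcal T$, $w(Y,\hat Y)=Y^T\mathcal J\hat Y$. For a symplectic $S=\begin{pmatrix}A&B\\ C&D\end{pmatrix}\in\mathbb R^{2n\times2n}$ let $\langle S\rangle=\binom{\mathcal X}{\mathcal U}\in\mathbb R^{4n\times2n}$ with $\mathcal X=\begin{pmatrix}I&0\\ A&B\end{pmatrix}$, $\mathcal U=\begin{pmatrix}0&-I\\ C&D\end{pmatrix}$; then $\mu(\langle S\rangle,\langle\hat S\rangle)$ is defined with $m=2n$. For sequences of symplectic matrices $Z_k,\hat Z_k$, $k\in[0,N+1]_{\mathbb Z}$, with $Y_k=Z_k\binom0I$, $\hat Y_k=\hat Z_k\binom0I$, put $$L_d(\hat Z^{-1}Y,0,N+1)=\sum_{k=0}^N\mu(\langle\hat Z_{k+1}^{-1}Z_{k+1}\rangle,\langle\hat Z_k^{-1}Z_k\rangle),\qquad L_d^*(Z^{-1}\hat Y,0,N+1)=\sum_{k=0}^N\mu(\langle\hat Z_{k}^{-1}Z_{k}\rangle,\langle\hat Z_{k+1}^{-1}Z_{k+1}\rangle).$$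 Thus in $L_d((Z^{[N+1]}(a))^{-1}Y^{[0]}(b),0,N+1)$ one takes $\hat Z_k=Z_k^{[N+1]}(a)$, $Z_k=Z_k^{[0]}(b)$, and in $L_d^*((Z^{[0]}(a))^{-1}Y^{[N+1]}(b),0,N+1)$ one takes $Z_k=Z_k^{[0]}(a)$, $\hat Z_k=Z_k^{[N+1]}(b)$. *)

theory Defs
  imports "HOL-Analysis.Analysis"
begin

section \<open>Block matrices\<close>

text \<open>A \<open>2n\<close>-dimensional index set is the sum type \<open>'n + 'n\<close>: \<open>Inl\<close> is the upper (left) block,
  \<open>Inr\<close> the lower (right) one.\<close>

definition block_mat ::
  "real^'q^'p \<Rightarrow> real^'s^'p \<Rightarrow> real^'q^'r \<Rightarrow> real^'s^'r
    \<Rightarrow> real^('q::finite + 's::finite)^('p::finite + 'r::finite)" where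
  "block_mat A B C D = (\<chi> i j. case i of
      Inl i' \<Rightarrow> (case j of Inl j' \<Rightarrow> A $ i' $ j' | Inr j' \<Rightarrow> B $ i' $ j')
    | Inr i' \<Rightarrow> (case j of Inl j' \<Rightarrow> C $ i' $ j' | Inr j' \<Rightarrow> D $ i' $ j'))"

definition stack :: "real^'q^'p \<Rightarrow> real^'q^'r \<Rightarrow> real^'q^('p::finite + 'r::finite)" where
  "stack X U = (\<chi> i. case i of Inl i' \<Rightarrow> X $ i' | Inr i' \<Rightarrow> U $ i')"

definition upper :: "real^'q^('p::finite + 'r::finite) \<Rightarrow> real^'q^'p" where
  "upper Y = (\<chi> i. Y $ Inl i)"

definition upper_left :: "real^('q::finite + 's::finite)^('p::finite + 'r::finite) \<Rightarrow> real^'q^'p" where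
  "upper_left S = (\<chi> i j. S $ Inl i $ Inl j)"

definition upper_right :: "real^('q::finite + 's::finite)^('p::finite + 'r::finite) \<Rightarrow> real^'s^'p" where
  "upper_right S = (\<chi> i j. S $ Inl i $ Inr j)"

definition lower_left :: "real^('q::finite + 's::finite)^('p::finite + 'r::finite) \<Rightarrow> real^'q^'r" where
  "lower_left S = (\<chi> i j. S $ Inr i $ Inl j)"

definition lower_right :: "real^('q::finite + 's::finite)^('p::finite + 'r::finite) \<Rightarrow> real^'s^'r" where
  "lower_right S = (\<chi> i j. S $ Inr i $ Inr j)"

definition sympl_J :: "real^('m::finite + 'm)^('m + 'm)" where
  "sympl_J = block_mat 0 (mat 1) (- mat 1) 0"


section \<open>Matrix analysis\<close>

definition is_moore_penrose :: "real^'q^'p \<Rightarrow> real^'p^'q \<Rightarrow> bool" where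
  "is_moore_penrose A G \<longleftrightarrow>
     A ** G ** A = A \<and> G ** A ** G = G \<and>
     transpose (A ** G) = A ** G \<and> transpose (G ** A) = G ** A"

definition moore_penrose :: "real^'q^'p \<Rightarrow> real^'p^'q" where
  "moore_penrose A = (THE G. is_moore_penrose A G)"

text \<open>Number of negative eigenvalues, counted with multiplicity. The matrix is meant to be symmetric,
  so that the multiplicity of an eigenvalue is the dimension of its eigenspace.\<close>

definition neg_ind :: "real^'m^'m \<Rightarrow> nat" where
  "neg_ind A = (\<Sum>c \<in> {c. c < 0 \<and> (\<exists>v. v \<noteq> 0 \<and> A *v v = c *s v)}. dim {v. A *v v = c *s v})"

definition nonneg_definite :: "real^'m^'m \<Rightarrow> bool" where
  "nonneg_definite A \<longleftrightarrow> transpose A = A \<and> (\<forall>v. 0 \<le> v \<bullet> (A *v v))"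

text \<open>Continuous with piecewise continuous derivative on the whole line: up to a locally finite
  exceptional set the function is continuously differentiable, and at the exceptional points the
  derivative has finite one-sided limits.\<close>

definition piecewise_C1 :: "(real \<Rightarrow> 'a::real_normed_vector) \<Rightarrow> bool" where
  "piecewise_C1 f \<longleftrightarrow>
     continuous_on UNIV f \<and>
     (\<exists>E. (\<forall>c d. finite (E \<inter> {c..d})) \<and>
          f C1_differentiable_on (- E) \<and>
          (\<forall>x\<in>E. (\<exists>l. ((\<lambda>t. vector_derivative f (at t)) \<longlongrightarrow> l) (at_left x)) \<and>
                 (\<exists>r. ((\<lambda>t. vector_derivative f (at t)) \<longlongrightarrow> r) (at_right x))))"

text \<open>Left-hand limits of the (integer-valued) rank. \<^const>\<open>Lim\<close> is unspecified when the limit does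
  not exist; existence is expressed separately by \<open>has_rank_left\<close>.\<close>

definition has_rank_left :: "(real \<Rightarrow> real^'q^'p) \<Rightarrow> real \<Rightarrow> bool" where
  "has_rank_left M t0 \<longleftrightarrow> (\<exists>r. ((\<lambda>t. rank (M t)) \<longlongrightarrow> r) (at_left t0))"

definition rank_left :: "(real \<Rightarrow> real^'q^'p) \<Rightarrow> real \<Rightarrow> nat" where
  "rank_left M t0 = Lim (at_left t0) (\<lambda>t. rank (M t))"


section \<open>Comparative index\<close>

definition wronskian :: "real^'m^('m::finite + 'm) \<Rightarrow> real^'m^('m + 'm) \<Rightarrow> real^'m^'m" where
  "wronskian Y Y' = transpose Y ** sympl_J ** Y'"

definition comp_index :: "real^'m^('m::finite + 'm) \<Rightarrow> real^'m^('m + 'm) \<Rightarrow> nat" where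
  "comp_index Y Y' =
    (let X = upper Y;
         X' = upper Y';
         M = (mat 1 - X ** moore_penrose X) ** X';
         T = mat 1 - moore_penrose M ** M;
         D = T ** transpose (wronskian Y Y') ** moore_penrose X ** X' ** T
     in rank M + neg_ind D)"

text \<open>The \<open>4n \<times> 2n\<close> matrix \<open>\<langle>S\<rangle>\<close> attached to a symplectic \<open>S\<close>.\<close>

definition graph_mat ::
  "real^('n::finite + 'n)^('n + 'n) \<Rightarrow> real^('n + 'n)^(('n + 'n) + ('n + 'n))" where
  "graph_mat S =
     stack (block_mat (mat 1) 0 (upper_left S) (upper_right S))
           (block_mat 0 (- mat 1) (lower_left S) (lower_right S))"

text \<open>In the following two definitions the arguments \<open>Zh\<close> and \<open>Z\<close> are the matrices
  \<open>Z\<close>-hat and \<open>Z\<close>, and \<open>Yh\<close> is \<open>Y\<close>-hat; \<open>L_d Zh Z N\<close> is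
  \<open>L\<^sub>d(Zh\<^sup>-\<^sup>1 Y, 0, N+1)\<close> and \<open>L_d_star Z Zh N\<close> is \<open>L\<^sub>d\<^sup>*(Z\<^sup>-\<^sup>1 Yh, 0, N+1)\<close>. Both are built from \<open>Zh\<^sup>-\<^sup>1 Z\<close>.\<close>

definition L_d ::
  "(nat \<Rightarrow> real^('n::finite + 'n)^('n + 'n)) \<Rightarrow> (nat \<Rightarrow> real^('n + 'n)^('n + 'n)) \<Rightarrow> nat \<Rightarrow> nat" where
  "L_d Zh Z N = (\<Sum>k=0..N.
     comp_index (graph_mat (matrix_inv (Zh (k + 1)) ** Z (k + 1)))
                (graph_mat (matrix_inv (Zh k) ** Z k)))"

definition L_d_star ::
  "(nat \<Rightarrow> real^('n::finite + 'n)^('n + 'n)) \<Rightarrow> (nat \<Rightarrow> real^('n + 'n)^('n + 'n)) \<Rightarrow> nat \<Rightarrow> nat" where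
  "L_d_star Z Zh N = (\<Sum>k=0..N.
     comp_index (graph_mat (matrix_inv (Zh k) ** Z k))
                (graph_mat (matrix_inv (Zh (k + 1)) ** Z (k + 1))))"


section \<open>Discrete Hamiltonian systems\<close>

definition hamiltonian ::
  "real^'n^'n \<Rightarrow> real^'n^'n \<Rightarrow> real^'n^'n \<Rightarrow> real^('n::finite + 'n)^('n + 'n)" where
  "hamiltonian A B C = block_mat (- C) (transpose A) A B"

definition coeff_mat ::
  "real^'n^'n \<Rightarrow> real^'n^'n \<Rightarrow> real^'n^'n \<Rightarrow> real^('n::finite + 'n)^('n + 'n)" where
  "coeff_mat A B C =
    (let R = matrix_inv (mat 1 - A)
     in block_mat R (R ** B) (C ** R) (C ** R ** B + mat 1 - transpose A))"

text \<open>\<open>x, u\<close> are the values at \<open>k\<close> and \<open>x', u'\<close> those at \<open>k + 1\<close>.\<close>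

definition hamiltonian_step ::
  "real^'n^'n \<Rightarrow> real^'n^'n \<Rightarrow> real^'n^'n \<Rightarrow> real^'n \<Rightarrow> real^'n \<Rightarrow> real^'n \<Rightarrow> real^'n \<Rightarrow> bool" where
  "hamiltonian_step A B C x u x' u' \<longleftrightarrow>
     x' - x = A *v x' + B *v u \<and> u' - u = C *v x' - transpose A *v u"

definition vstack :: "real^'p \<Rightarrow> real^'r \<Rightarrow> real^('p::finite + 'r::finite)" where
  "vstack x u = (\<chi> i. case i of Inl i' \<Rightarrow> x $ i' | Inr i' \<Rightarrow> u $ i')"

lemma sum_UNIV_sum:
  fixes f :: "'p::finite + 'r::finite \<Rightarrow> real"
  shows "(\<Sum>j\<in>UNIV. f j) = (\<Sum>j\<in>UNIV. f (Inl j)) + (\<Sum>j\<in>UNIV. f (Inr j))"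
  using sum.Plus[of "UNIV :: 'p set" "UNIV :: 'r set" f] by simp

lemma block_mat_mult_vstack:
  "block_mat A B C D *v vstack x u = vstack (A *v x + B *v u) (C *v x + D *v u)"
  by (simp add: vec_eq_iff block_mat_def vstack_def matrix_vector_mult_def sum_UNIV_sum
      split: sum.split)

lemma vstack_eq_iff: "vstack x u = vstack x' u' \<longleftrightarrow> x = x' \<and> u = u'"
proof
  assume eq: "vstack x u = vstack x' u'"
  have "vstack x u $ Inl i = vstack x' u' $ Inl i" "vstack x u $ Inr j = vstack x' u' $ Inr j" for i j
    by (simp_all only: eq)
  then show "x = x' \<and> u = u'"
    by (simp add: vec_eq_iff vstack_def)
qed simp

lemma hamiltonian_step_iff_coeff_mat:
  assumes "det (mat 1 - A) \<noteq> 0"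
  shows "hamiltonian_step A B C x u x' u' \<longleftrightarrow> vstack x' u' = coeff_mat A B C *v vstack x u"
proof -
  let ?R = "matrix_inv (mat 1 - A)"
  have inv: "invertible (mat 1 - A)"
    using assms by (simp add: invertible_det_nz)
  have R: "(mat 1 - A) ** ?R = mat 1" "?R ** (mat 1 - A) = mat 1"
    using inv unfolding invertible_def matrix_inv_def
    by (metis (mono_tags, lifting) someI_ex)+
  have "x' - x = A *v x' + B *v u \<longleftrightarrow> (mat 1 - A) *v x' = x + B *v u"
    by (simp only: matrix_vector_mult_diff_rdistrib matrix_vector_mul_lid diff_eq_eq eq_diff_eq)
       (simp add: ac_simps)
  also have "\<dots> \<longleftrightarrow> x' = ?R *v (x + B *v u)"
    by (metis R matrix_vector_mul_assoc matrix_vector_mul_lid)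
  finally have "x' - x = A *v x' + B *v u \<longleftrightarrow> x' = ?R *v x + (?R ** B) *v u"
    by (simp add: matrix_vector_right_distrib matrix_vector_mul_assoc)
  moreover have "u' - u = C *v x' - transpose A *v u \<longleftrightarrow>
      u' = (C ** ?R) *v x + (C ** ?R ** B + mat 1 - transpose A) *v u"
    if x': "x' = ?R *v x + (?R ** B) *v u"
  proof -
    have "(C ** ?R) *v x + (C ** ?R ** B + mat 1 - transpose A) *v u
        = C *v x' + u - transpose A *v u"
      by (simp only: x' matrix_vector_right_distrib matrix_vector_mult_diff_rdistrib
          matrix_vector_mult_add_rdistrib matrix_vector_mul_assoc matrix_mul_assoc
          matrix_vector_mul_lid) (simp add: ac_simps)
    then show ?thesis
      by (simp only: diff_eq_eq) (simp add: algebra_simps)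
  qed
  ultimately show ?thesis
    unfolding hamiltonian_step_def coeff_mat_def Let_def block_mat_mult_vstack vstack_eq_iff by blast
qed

text \<open>The matrix solution of \<open>Z\<^bsub>k+1\<^esub> = S\<^bsub>k\<^esub> Z\<^bsub>k\<^esub>\<close>, \<open>k = 0, \<dots>, N\<close>, with \<open>Z\<^bsub>l\<^esub> = I\<close>. For symplectic \<open>S\<^bsub>k\<^esub>\<close> and
  \<open>l \<le> N + 1\<close> it is uniquely determined on \<open>{0..N+1}\<close>, and it is symplectic.\<close>

definition fundamental_solution ::
  "nat \<Rightarrow> (nat \<Rightarrow> real^('n::finite + 'n)^('n + 'n)) \<Rightarrow> nat \<Rightarrow> (nat \<Rightarrow> real^('n + 'n)^('n + 'n)) \<Rightarrow> bool"
where
  "fundamental_solution N S l Z \<longleftrightarrow> Z l = mat 1 \<and> (\<forall>k\<le>N. Z (k + 1) = S k ** Z k)"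

definition principal_X :: "real^('n::finite + 'n)^('n + 'n) \<Rightarrow> real^'n^'n" where
  "principal_X Z = upper (Z ** stack 0 (mat 1))"

text \<open>Here \<open>X\<close> stands for \<open>\<lambda> \<mapsto> X\<^sup>[\<^sup>0\<^sup>]\<^bsub>N+1\<^esub>(\<lambda>)\<close>, the \<open>X\<close>-block of the principal solution at \<open>0\<close>.\<close>

definition finite_eigenvalue_mult :: "(real \<Rightarrow> real^'n^'n) \<Rightarrow> real \<Rightarrow> int" where
  "finite_eigenvalue_mult X t = int (rank_left X t) - int (rank (X t))"

definition finite_eigenvalues :: "(real \<Rightarrow> real^'n^'n) \<Rightarrow> real set" where
  "finite_eigenvalues X = {t. 1 \<le> finite_eigenvalue_mult X t}"

end

theory Submission
  imports Defs "HOL-Library.Function_Algebras"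
begin

text \<open>
  The Dirichlet problem is the Euler--Lagrange problem of a quadratic action. For a trajectory
  \<open>w = (x\<^sub>0, \<dots>, x\<^bsub>N+1\<^esub>; u\<^sub>0, \<dots>, u\<^sub>N)\<close> put
  \<open>F\<^sub>\<lambda>(w) = \<Sum>\<^sub>k 2 \<langle>u\<^sub>k, x\<^bsub>k+1\<^esub> - x\<^sub>k\<rangle> - \<langle>z\<^sub>k, H\<^sub>k(\<lambda>) z\<^sub>k\<rangle>\<close> with \<open>z\<^sub>k = (x\<^bsub>k+1\<^esub>, u\<^sub>k)\<close>. The trajectories that are critical
  with respect to variations with zero boundary values are exactly the solutions of the system,
  and \<open>F\<^sub>\<lambda>\<close> decreases when the Hamiltonians increase. Everything is expressed through one number, the
  positive index \<open>g(\<lambda>)\<close> of \<open>F\<^sub>\<lambda>\<close> on the space of trajectories with \<open>x\<^sub>0 = x\<^bsub>N+1\<^esub> = 0\<close>.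

  The kernel of this Dirichlet form has the dimension of the kernel of \<open>X(\<lambda>)\<close>, so
  \<open>rank X(\<lambda>)\<close> is \<open>n\<close> plus the positive index minus the nonnegative index. Both indices are nonincreasing
  in \<open>\<lambda>\<close>; by lower semicontinuity of the number of positive and of negative squares the first is
  right-continuous and the second is left-continuous. Hence the multiplicity of \<open>\<lambda>\<close> is the jump
  \<open>g(\<lambda>\<^sup>-) - g(\<lambda>)\<close>, and the jumps in \<open>(a, b]\<close> add up to \<open>g(a) - g(b)\<close> (\<open>sum_of_jumps\<close>).

  On the other side, the matrix \<open>Z\<^sub>k\<^sup>[\<^sup>N\<^sup>+\<^sup>1\<^sup>](q)\<^sup>-\<^sup>1 Z\<^sub>k\<^sup>[\<^sup>0\<^sup>](p)\<close> is the transition matrix from \<open>0\<close> to \<open>N + 1\<close> of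
  the hybrid system that uses the parameter \<open>p\<close> before the time \<open>k\<close> and \<open>q\<close> from the time \<open>k\<close> on
  (\<open>hybrid_transition\<close>). Two consecutive hybrid systems differ in a single coefficient, and for
  such a pair, with ordered Hamiltonians, the comparative index of the two graphs is the difference
  of the positive indices of the two Dirichlet forms (\<open>comp_index_single_change\<close>). So both sums
  telescope to \<open>g(a) - g(b)\<close>.

  The comparison of a single change evaluates in two ways the nonnegative index of the form
  \<open>F'(v) - F(w)\<close> on pairs of trajectories with equal boundary values. Restricting to the pairs
  \<open>(w, w)\<close> gives the dimension of the space of trajectories, because \<open>F' - F\<close> is nonnegative and
  depends on \<open>z\<^sub>k\<close> only. Splitting off the Dirichlet forms of \<open>F'\<close> and of \<open>-F\<close> leaves pairs of solutions,
  where the form is the one in the definition of the comparative index. Both evaluations use the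
  formula \<open>nonneg_index_split\<close> for the nonnegative index of a form in terms of a subspace and its
  orthogonal complement.

  The statement on the coefficient matrices holds because \<open>S\<^sub>k(a) - S\<^sub>k(\<lambda>)\<close> has the rank of
  \<open>H\<^sub>k(\<lambda>) - H\<^sub>k(a)\<close>, a nonnegative matrix that grows with \<open>\<lambda>\<close>: its rank is nondecreasing and lower
  semicontinuous, hence left-continuous.
\<close>

section \<open>Finite-dimensional subspaces of a real vector space\<close>

text \<open>The spaces of trajectories have a dimension that depends on \<open>N\<close>, so they are treated as
  finite-dimensional subspaces of an infinite-dimensional space of sequences.\<close>

definition fin_dim :: "'v::real_vector set \<Rightarrow> bool" where
  "fin_dim S \<longleftrightarrow> (\<exists>B. finite B \<and> S \<subseteq> span B)"

lemma fin_dim_euclidean: "fin_dim (S :: 'a::euclidean_space set)"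
  unfolding fin_dim_def by (intro exI[of _ Basis]) auto

lemma fin_dim_mono: "fin_dim T \<Longrightarrow> S \<subseteq> T \<Longrightarrow> fin_dim S"
  unfolding fin_dim_def by blast

lemma fin_dim_image:
  assumes "linear f" "fin_dim S"
  shows "fin_dim (f ` S)"
proof -
  obtain B where "finite B" "S \<subseteq> span B" using assms unfolding fin_dim_def by blast
  then show ?thesis unfolding fin_dim_def
    by (intro exI[of _ "f ` B"]) (metis assms(1) finite_imageI image_mono linear_span_image)
qed

lemma fin_dim_independent:
  assumes "fin_dim S" "B \<subseteq> S" "independent B"
  shows "finite B \<and> card B \<le> dim S"
proof -
  obtain T where T: "finite T" "S \<subseteq> span T" using assms(1) unfolding fin_dim_def by blast
  obtain C where C: "C \<subseteq> S" "independent C" "S \<subseteq> span C" "card C = dim S"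
    using real_vector.basis_exists by blast
  have "finite C" using real_vector.independent_span_bound[OF T(1) C(2)] C(1) T(2) by blast
  then show ?thesis
    using real_vector.independent_span_bound[of C B] assms C by auto
qed

lemma fin_dim_basis:
  assumes "fin_dim S" "subspace S"
  obtains B where "finite B" "independent B" "B \<subseteq> S" "span B = S" "card B = dim S"
proof -
  obtain C where C: "C \<subseteq> S" "independent C" "S \<subseteq> span C" "card C = dim S"
    using real_vector.basis_exists by blast
  moreover have "finite C" using fin_dim_independent[OF assms(1) C(1,2)] by simp
  moreover have "span C = S" using C assms(2) by (simp add: span_subspace)
  ultimately show ?thesis using that by blast
qed

lemma dim_mono_fin:
  assumes "fin_dim T" "S \<subseteq> T"
  shows "dim S \<le> dim T"
proof -
  obtain C where C: "C \<subseteq> S" "independent C" "S \<subseteq> span C" "card C = dim S"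
    using real_vector.basis_exists by blast
  then show ?thesis using fin_dim_independent[OF assms(1), of C] assms(2) by auto
qed

lemma dim_image_inj_on:
  assumes f: "linear f" and S: "subspace S" "fin_dim S" and inj: "inj_on f S"
  shows "dim (f ` S) = dim S"
proof -
  obtain B where B: "finite B" "independent B" "B \<subseteq> S" "span B = S" "card B = dim S"
    using fin_dim_basis[OF S(2,1)] by blast
  have "independent (f ` B)"
    using real_vector.linear_independent_injective_image[OF f B(2)] inj B(4) by simp
  moreover have "span (f ` B) = f ` S" using B(4) linear_span_image[OF f, of B] by simp
  moreover have "card (f ` B) = card B" using inj B(3) by (meson card_image inj_on_subset)
  ultimately show ?thesis using B(5)
    by (metis real_vector.dim_span_eq_card_independent)
qed

text \<open>This is the source of all upper bounds for indices: a subspace on which a form is positive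
  meets a subspace on which it is nonpositive only in \<open>0\<close>.\<close>

lemma dim_add_le_of_disjoint:
  assumes V: "fin_dim V" and S: "subspace S" "S \<subseteq> V" and T: "subspace T" "T \<subseteq> V"
    and V': "subspace V" and disj: "S \<inter> T \<subseteq> {0}"
  shows "dim S + dim T \<le> dim V"
proof -
  obtain B where B: "finite B" "independent B" "B \<subseteq> S" "span B = S" "card B = dim S"
    using fin_dim_basis[OF fin_dim_mono[OF V S(2)] S(1)] by blast
  obtain C where C: "finite C" "independent C" "C \<subseteq> T" "span C = T" "card C = dim T"
    using fin_dim_basis[OF fin_dim_mono[OF V T(2)] T(1)] by blast
  have BC: "B \<inter> C = {}"
  proof -
    have "0 \<notin> B" using B(2) real_vector.dependent_zero by blast
    then show ?thesis using B(3) C(3) disj by blast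
  qed
  have "independent (B \<union> C)"
  proof (rule real_vector.independent_if_scalars_zero)
    show "finite (B \<union> C)" using B C by simp
  next
    fix u x assume eq: "(\<Sum>x\<in>B \<union> C. u x *\<^sub>R x) = 0" and x: "x \<in> B \<union> C"
    have s: "(\<Sum>x\<in>B. u x *\<^sub>R x) + (\<Sum>x\<in>C. u x *\<^sub>R x) = 0"
      using eq BC B(1) C(1) by (simp add: sum.union_disjoint)
    have sB: "(\<Sum>x\<in>B. u x *\<^sub>R x) \<in> S"
      using B(3) S(1) by (auto intro!: subspace_sum subspace_scale)
    have sC: "(\<Sum>x\<in>C. u x *\<^sub>R x) \<in> T"
      using C(3) T(1) by (auto intro!: subspace_sum subspace_scale)
    have "(\<Sum>x\<in>B. u x *\<^sub>R x) = - (\<Sum>x\<in>C. u x *\<^sub>R x)" using s by (simp add: eq_neg_iff_add_eq_0)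
    then have "(\<Sum>x\<in>B. u x *\<^sub>R x) \<in> T" using sC T(1) by (simp add: subspace_neg)
    then have zB: "(\<Sum>x\<in>B. u x *\<^sub>R x) = 0" using sB disj by blast
    then have zC: "(\<Sum>x\<in>C. u x *\<^sub>R x) = 0" using s by simp
    show "u x = 0"
      using x zB zC B(1,2) C(1,2) real_vector.independentD[of B B u x]
        real_vector.independentD[of C C u x] by auto
  qed
  then have "card (B \<union> C) \<le> dim V"
    using fin_dim_independent[OF V, of "B \<union> C"] B(3) C(3) S(2) T(2) by blast
  then show ?thesis using BC B C by (simp add: card_Un_disjoint)
qed

lemma subspace_kernel:
  assumes "linear h" "subspace S"
  shows "subspace {x\<in>S. h x = 0}"
  using assms by (auto simp: subspace_def linear_0 linear_add linear_scale)

text \<open>A linear right inverse of \<open>h\<close> maps the image of \<open>h\<close> isomorphically onto a complement of the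
  kernel.\<close>

lemma rank_nullity_fin:
  assumes h: "linear h" and S: "subspace S" "fin_dim S"
  shows "dim S = dim (h ` S) + dim {x\<in>S. h x = 0}"
proof -
  let ?K = "{x\<in>S. h x = 0}"
  have K: "subspace ?K" by (rule subspace_kernel[OF h S(1)])
  have Kf: "fin_dim ?K" by (rule fin_dim_mono[OF S(2)]) auto
  obtain g where g: "range g \<subseteq> S" "linear g" "\<forall>v\<in>h ` S. h (g v) = v"
    using real_vector.linear_exists_right_inverse_on[OF h S(1)] by auto
  let ?G = "g ` (h ` S)"
  have hS: "subspace (h ` S)" using h S(1) by (rule real_vector.linear_subspace_image)
  have hSf: "fin_dim (h ` S)" using h S(2) by (rule fin_dim_image)
  have G: "subspace ?G" by (rule real_vector.linear_subspace_image[OF g(2) hS])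
  have dG: "dim ?G = dim (h ` S)"
    by (rule dim_image_inj_on[OF g(2) hS hSf]) (metis g(3) inj_onI)
  have le: "dim ?G + dim ?K \<le> dim S"
  proof (rule dim_add_le_of_disjoint[OF S(2) G _ K _ S(1)])
    show "?G \<subseteq> S" using g(1) by auto
    show "?K \<subseteq> S" by auto
    show "?G \<inter> ?K \<subseteq> {0}"
    proof
      fix y assume "y \<in> ?G \<inter> ?K"
      then obtain v where v: "v \<in> h ` S" "y = g v" "h y = 0" by blast
      then have "v = 0" using g(3) by auto
      then show "y \<in> {0}" using v(2) g(2) linear_0 by simp
    qed
  qed
  obtain B where B: "finite B" "independent B" "B \<subseteq> ?G" "span B = ?G" "card B = dim ?G"
    using fin_dim_basis[OF fin_dim_image[OF g(2) hSf] G] by blast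
  obtain C where C: "finite C" "independent C" "C \<subseteq> ?K" "span C = ?K" "card C = dim ?K"
    using fin_dim_basis[OF Kf K] by blast
  have "S \<subseteq> span (B \<union> C)"
  proof
    fix x assume x: "x \<in> S"
    have "g (h x) \<in> S" using g(1) by auto
    then have "x - g (h x) \<in> ?K" using x S(1) h g(3) by (auto simp: subspace_diff linear_diff)
    moreover have "g (h x) \<in> ?G" using x by blast
    ultimately have "g (h x) + (x - g (h x)) \<in> span (B \<union> C)"
      unfolding span_Un using B(4) C(4) by blast
    then show "x \<in> span (B \<union> C)" by simp
  qed
  then have "dim S \<le> card (B \<union> C)" using B(1) C(1) by (intro real_vector.dim_le_card) auto
  then have "dim S \<le> dim ?G + dim ?K" using B(5) C(5) card_Un_le[of B C] by simp
  then show ?thesis using le dG by simp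
qed

lemma fin_dim_by_kernel:
  assumes h: "linear h" and S: "subspace S" and im: "fin_dim (h ` S)" and ker: "fin_dim {x\<in>S. h x = 0}"
  shows "fin_dim S"
proof -
  obtain g where g: "range g \<subseteq> S" "linear g" "\<forall>v\<in>h ` S. h (g v) = v"
    using real_vector.linear_exists_right_inverse_on[OF h S] by auto
  obtain B C where B: "finite B" "g ` h ` S \<subseteq> span B" and C: "finite C" "{x\<in>S. h x = 0} \<subseteq> span C"
    using fin_dim_image[OF g(2) im] ker unfolding fin_dim_def by blast
  have "S \<subseteq> span (B \<union> C)"
  proof
    fix x assume x: "x \<in> S"
    have "g (h x) \<in> S" using g(1) by auto
    then have "x - g (h x) \<in> span C" 
      using C(2) x S g(3) linear_diff[OF h] by (auto simp: subspace_diff)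
    moreover have "g (h x) \<in> span B" using B(2) x by blast
    ultimately have "g (h x) + (x - g (h x)) \<in> span (B \<union> C)" unfolding span_Un by blast
    then show "x \<in> span (B \<union> C)" by simp
  qed
  then show ?thesis using B(1) C(1) unfolding fin_dim_def by blast
qed

lemma fin_dim_Times:
  assumes "subspace S" "subspace T" "fin_dim S" "fin_dim T"
  shows "fin_dim (S \<times> T)"
proof (rule fin_dim_by_kernel[OF linear_fst subspace_Times[OF assms(1,2)]])
  show "fin_dim (fst ` (S \<times> T))" using assms(3) by (rule fin_dim_mono) auto
  have l: "linear (\<lambda>u. (0, u))" by (intro linearI) auto
  show "fin_dim {p \<in> S \<times> T. fst p = 0}"
    by (rule fin_dim_mono[OF fin_dim_image[OF l assms(4)]]) auto
qed

section \<open>Inertia of symmetric bilinear forms\<close>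

definition sym_bilinear :: "('v::real_vector \<Rightarrow> 'v \<Rightarrow> real) \<Rightarrow> bool" where
  "sym_bilinear \<Phi> \<longleftrightarrow> (\<forall>x y. \<Phi> x y = \<Phi> y x) \<and> (\<forall>y. linear (\<lambda>x. \<Phi> x y))"

lemma sym_bilinearD:
  assumes "sym_bilinear \<Phi>"
  shows "\<Phi> x y = \<Phi> y x"
    and "\<Phi> (x + z) y = \<Phi> x y + \<Phi> z y" "\<Phi> y (x + z) = \<Phi> y x + \<Phi> y z"
    and "\<Phi> (c *\<^sub>R x) y = c * \<Phi> x y" "\<Phi> y (c *\<^sub>R x) = c * \<Phi> y x"
    and "\<Phi> 0 y = 0" "\<Phi> y 0 = 0"
    and "\<Phi> (x - z) y = \<Phi> x y - \<Phi> z y" "\<Phi> y (x - z) = \<Phi> y x - \<Phi> y z"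
    and "linear (\<Phi> y)" "linear (\<lambda>x. \<Phi> x y)"
proof -
  have s: "\<And>x y. \<Phi> x y = \<Phi> y x" and l: "\<And>y. linear (\<lambda>x. \<Phi> x y)"
    using assms unfolding sym_bilinear_def by auto
  have l2: "linear (\<Phi> y)" for y
  proof -
    have "\<Phi> y = (\<lambda>x. \<Phi> x y)" using s by (intro ext)
    then show ?thesis using l[of y] by simp
  qed
  show "\<Phi> x y = \<Phi> y x" by (rule s)
  show "\<Phi> (x + z) y = \<Phi> x y + \<Phi> z y" using linear_add[OF l] .
  show "\<Phi> y (x + z) = \<Phi> y x + \<Phi> y z" using linear_add[OF l2] .
  show "\<Phi> (c *\<^sub>R x) y = c * \<Phi> x y" using linear_scale[OF l, of c] by simp
  show "\<Phi> y (c *\<^sub>R x) = c * \<Phi> y x" using linear_scale[OF l2, of y c] by simp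
  show "\<Phi> 0 y = 0" using linear_0[OF l] .
  show "\<Phi> y 0 = 0" using linear_0[OF l2] .
  show "\<Phi> (x - z) y = \<Phi> x y - \<Phi> z y" using linear_diff[OF l] .
  show "\<Phi> y (x - z) = \<Phi> y x - \<Phi> y z" using linear_diff[OF l2] .
  show "linear (\<Phi> y)" by (rule l2)
  show "linear (\<lambda>x. \<Phi> x y)" by (rule l)
qed

lemma sym_bilinear_uminus: "sym_bilinear \<Phi> \<Longrightarrow> sym_bilinear (\<lambda>x y. - \<Phi> x y)"
  unfolding sym_bilinear_def by (auto intro: linear_compose_neg)

definition pos_subspace :: "('v::real_vector \<Rightarrow> 'v \<Rightarrow> real) \<Rightarrow> 'v set \<Rightarrow> 'v set \<Rightarrow> bool" where
  "pos_subspace \<Phi> K W \<longleftrightarrow> subspace W \<and> W \<subseteq> K \<and> (\<forall>w\<in>W. w \<noteq> 0 \<longrightarrow> 0 < \<Phi> w w)"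

definition nonneg_subspace :: "('v::real_vector \<Rightarrow> 'v \<Rightarrow> real) \<Rightarrow> 'v set \<Rightarrow> 'v set \<Rightarrow> bool" where
  "nonneg_subspace \<Phi> K W \<longleftrightarrow> subspace W \<and> W \<subseteq> K \<and> (\<forall>w\<in>W. 0 \<le> \<Phi> w w)"

text \<open>Indices are defined as maximal dimensions of subspaces with a sign condition and not by
  counting eigenvalues: there is no inner product on the space of trajectories, and monotonicity
  in the form becomes immediate.\<close>

definition pos_index :: "('v::real_vector \<Rightarrow> 'v \<Rightarrow> real) \<Rightarrow> 'v set \<Rightarrow> nat" where
  "pos_index \<Phi> K = Max (dim ` {W. pos_subspace \<Phi> K W})"

definition nonneg_index :: "('v::real_vector \<Rightarrow> 'v \<Rightarrow> real) \<Rightarrow> 'v set \<Rightarrow> nat" where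
  "nonneg_index \<Phi> K = Max (dim ` {W. nonneg_subspace \<Phi> K W})"

lemma finite_dims:
  assumes "fin_dim K" "\<And>W. P W \<Longrightarrow> W \<subseteq> K"
  shows "finite (dim ` {W. P W})"
  by (rule finite_subset[of _ "{..dim K}"]) (use assms(2) dim_mono_fin[OF assms(1)] in auto)

lemma pos_subspace_dim_le:
  assumes "fin_dim K" "pos_subspace \<Phi> K W"
  shows "dim W \<le> pos_index \<Phi> K"
  unfolding pos_index_def
  by (rule Max_ge[OF finite_dims[OF assms(1)]]) (use assms(2) in \<open>auto simp: pos_subspace_def\<close>)

lemma nonneg_subspace_dim_le:
  assumes "fin_dim K" "nonneg_subspace \<Phi> K W"
  shows "dim W \<le> nonneg_index \<Phi> K"
  unfolding nonneg_index_def
  by (rule Max_ge[OF finite_dims[OF assms(1)]]) (use assms(2) in \<open>auto simp: nonneg_subspace_def\<close>)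

lemma pos_index_attained:
  assumes "fin_dim K" "subspace K"
  obtains W where "pos_subspace \<Phi> K W" "dim W = pos_index \<Phi> K"
proof -
  have "pos_subspace \<Phi> K {0}" using assms by (simp add: pos_subspace_def subspace_0)
  then have "pos_index \<Phi> K \<in> dim ` {W. pos_subspace \<Phi> K W}"
    unfolding pos_index_def
    by (intro Max_in finite_dims[OF assms(1)]) (auto simp: pos_subspace_def)
  then show ?thesis using that by auto
qed

lemma nonneg_index_attained:
  assumes "fin_dim K" "subspace K" "sym_bilinear \<Phi>"
  obtains W where "nonneg_subspace \<Phi> K W" "dim W = nonneg_index \<Phi> K"
proof -
  have "nonneg_subspace \<Phi> K {0}" using assms
    by (simp add: nonneg_subspace_def subspace_0 sym_bilinearD)
  then have "nonneg_index \<Phi> K \<in> dim ` {W. nonneg_subspace \<Phi> K W}"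
    unfolding nonneg_index_def
    by (intro Max_in finite_dims[OF assms(1)]) (auto simp: nonneg_subspace_def)
  then show ?thesis using that by auto
qed

lemma nonneg_index_eq_dim:
  assumes "fin_dim K" "subspace K" "\<And>x. x \<in> K \<Longrightarrow> 0 \<le> \<Phi> x x"
  shows "nonneg_index \<Phi> K = dim K"
  unfolding nonneg_index_def
proof (rule Max_eqI)
  show "finite (dim ` {W. nonneg_subspace \<Phi> K W})"
    by (rule finite_dims[OF assms(1)]) (auto simp: nonneg_subspace_def)
  show "y \<le> dim K" if "y \<in> dim ` {W. nonneg_subspace \<Phi> K W}" for y
    using that assms(1) by (auto simp: nonneg_subspace_def intro: dim_mono_fin)
  show "dim K \<in> dim ` {W. nonneg_subspace \<Phi> K W}"
    using assms by (auto simp: nonneg_subspace_def)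
qed

lemma subspace_orthogonal:
  assumes "sym_bilinear \<Phi>" "subspace P"
  shows "subspace {p\<in>P. \<Phi> e p = 0}" "subspace {p\<in>P. \<forall>b\<in>B. \<Phi> b p = 0}"
  using assms by (auto simp: subspace_def sym_bilinearD)

lemma dim_orthogonal_ge:
  assumes "sym_bilinear \<Phi>" "subspace P" "fin_dim P"
  shows "dim P \<le> dim {p\<in>P. \<Phi> e p = 0} + 1"
proof -
  have "dim (\<Phi> e ` P) \<le> 1"
    using dim_subset_UNIV[of "\<Phi> e ` P"] by simp
  then show ?thesis
    using rank_nullity_fin[OF sym_bilinearD(10)[OF assms(1), of e] assms(2,3)] by simp
qed

lemma dim_span_insert:
  assumes "e \<notin> W" "subspace W" "fin_dim W"
  shows "dim (span (insert e W)) = dim W + 1"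
proof -
  obtain B where B: "finite B" "independent B" "B \<subseteq> W" "span B = W" "card B = dim W"
    using fin_dim_basis assms by metis
  have "independent (insert e B)" using B assms(1) by (intro real_vector.independent_insertI) auto
  moreover have "span (insert e B) = span (insert e W)"
    unfolding real_vector.span_insert[of e] B(4) real_vector.span_eq_iff[THEN iffD2, OF assms(2)] ..
  moreover have "e \<notin> B" using assms(1) B(3) by blast
  ultimately show ?thesis
    using B real_vector.dim_span_eq_card_independent[of "insert e B"] by simp
qed

lemma span_insert_subspace:
  assumes "subspace W" "x \<in> span (insert e W)"
  obtains c w where "w \<in> W" "x = c *\<^sub>R e + w"
proof -
  obtain k where "x - k *\<^sub>R e \<in> span W"
    using assms(2) real_vector.span_breakdown_eq by blast
  then have "x - k *\<^sub>R e \<in> W" using assms(1) by (metis span_eq_iff)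
  then show ?thesis using that[of "x - k *\<^sub>R e" k] by simp
qed

text \<open>This is the equality case of the Cauchy--Schwarz inequality: otherwise the form would be
  unbounded below on the line \<open>w + c e\<close>.\<close>

lemma isotropic_orthogonal:
  assumes \<Phi>: "sym_bilinear \<Phi>" and W: "subspace W" "\<And>w. w \<in> W \<Longrightarrow> 0 \<le> \<Phi> w w"
    and e: "e \<in> W" "\<Phi> e e = 0" and w: "w \<in> W"
  shows "\<Phi> e w = 0"
proof (rule ccontr)
  note bl = sym_bilinearD[OF \<Phi>]
  assume ne: "\<Phi> e w \<noteq> 0"
  \<comment> \<open>chosen such that the form takes the value \<open>-1\<close> at \<open>c e + w\<close>\<close>
  define c where "c = - (\<Phi> w w + 1) / (2 * \<Phi> e w)"
  have "c *\<^sub>R e + w \<in> W" using W(1) e w by (simp add: subspace_add subspace_scale)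
  then have "0 \<le> \<Phi> (c *\<^sub>R e + w) (c *\<^sub>R e + w)" by (rule W(2))
  also have "\<dots> = 2 * c * \<Phi> e w + \<Phi> w w"
    using bl(1)[of w e] e(2) by (simp add: bl(2-5))
  also have "\<dots> = - 1" using ne by (simp add: c_def field_simps)
  finally show False by simp
qed

text \<open>Let \<open>Q\<close> be the orthogonal complement of \<open>e\<close>. A positive \<open>e\<close> can be added to a
  nonnegative subspace of \<open>Q\<close>, and intersecting with \<open>Q\<close> costs at most one dimension. A negative \<open>e\<close> can be
  projected away, which only increases the form. An isotropic \<open>e\<close> is orthogonal to itself, so it
  replaces the dimension that is lost by intersecting with \<open>Q\<close>.\<close>

lemma nonneg_index_split_vector:
  assumes \<Phi>: "sym_bilinear \<Phi>" and P: "subspace P" "fin_dim P" and e: "e \<in> P"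
  shows "nonneg_index \<Phi> P = (if 0 < \<Phi> e e then 1 else 0) + nonneg_index \<Phi> {p\<in>P. \<Phi> e p = 0}"
proof -
  note bl = sym_bilinearD[OF \<Phi>]
  let ?Q = "{p\<in>P. \<Phi> e p = 0}"
  have Q: "subspace ?Q" by (rule subspace_orthogonal[OF \<Phi> P(1)])
  have Qf: "fin_dim ?Q" by (rule fin_dim_mono[OF P(2)]) auto
  obtain W where W: "nonneg_subspace \<Phi> P W" "dim W = nonneg_index \<Phi> P"
    using nonneg_index_attained[OF P(2,1) \<Phi>] .
  have Ws: "subspace W" "W \<subseteq> P" "\<And>w. w \<in> W \<Longrightarrow> 0 \<le> \<Phi> w w"
    using W(1) by (auto simp: nonneg_subspace_def)
  have Wf: "fin_dim W" by (rule fin_dim_mono[OF P(2) Ws(2)])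
  let ?W0 = "{w\<in>W. \<Phi> e w = 0}"
  have W0: "subspace ?W0" by (rule subspace_orthogonal[OF \<Phi> Ws(1)])
  have W0f: "fin_dim ?W0" by (rule fin_dim_mono[OF Wf]) auto
  have W0d: "dim W \<le> dim ?W0 + 1" by (rule dim_orthogonal_ge[OF \<Phi> Ws(1) Wf])
  obtain V where V: "nonneg_subspace \<Phi> ?Q V" "dim V = nonneg_index \<Phi> ?Q"
    using nonneg_index_attained[OF Qf Q \<Phi>] .
  have Vs: "subspace V" "V \<subseteq> ?Q" "\<And>w. w \<in> V \<Longrightarrow> 0 \<le> \<Phi> w w"
    using V(1) by (auto simp: nonneg_subspace_def)
  have Vf: "fin_dim V" by (rule fin_dim_mono[OF Qf Vs(2)])
  have VP: "nonneg_subspace \<Phi> P V" using Vs by (auto simp: nonneg_subspace_def)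
  show ?thesis
  proof (cases "0 < \<Phi> e e")
    case True
    have "nonneg_subspace \<Phi> ?Q ?W0" using W0 Ws by (auto simp: nonneg_subspace_def)
    then have le: "nonneg_index \<Phi> P \<le> 1 + nonneg_index \<Phi> ?Q"
      using nonneg_subspace_dim_le[OF Qf, of \<Phi> ?W0] W0d W(2) by linarith
    have "e \<notin> V" using Vs(2) True by auto
    then have d: "dim (span (insert e V)) = dim V + 1"
      using dim_span_insert[OF _ Vs(1) Vf, of e] by simp
    have "nonneg_subspace \<Phi> P (span (insert e V))"
      unfolding nonneg_subspace_def
    proof (intro conjI ballI)
      show "span (insert e V) \<subseteq> P"
        using e Vs(2) P(1) by (intro span_minimal) auto
    next
      fix x assume x: "x \<in> span (insert e V)"
      obtain c w where w: "w \<in> V" "x = c *\<^sub>R e + w"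
        by (rule span_insert_subspace[OF Vs(1) x])
      have "\<Phi> e w = 0" using w(1) Vs(2) by auto
      then have "\<Phi> x x = c * (c * \<Phi> e e) + \<Phi> w w"
        using w(2) bl(1)[of w e] by (simp add: bl(2-5))
      moreover have "0 \<le> c * (c * \<Phi> e e)"
        using True by (simp add: mult.assoc[symmetric])
      ultimately show "0 \<le> \<Phi> x x" using Vs(3)[OF w(1)] by simp
    qed simp
    then have "nonneg_index \<Phi> ?Q + 1 \<le> nonneg_index \<Phi> P"
      using nonneg_subspace_dim_le[OF P(2), of \<Phi> "span (insert e V)"] d V(2) by linarith
    then show ?thesis using le True by simp
  next
    case False
    have ge: "nonneg_index \<Phi> ?Q \<le> nonneg_index \<Phi> P"
      using nonneg_subspace_dim_le[OF P(2) VP] V(2) by simp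
    have "nonneg_index \<Phi> P \<le> nonneg_index \<Phi> ?Q"
    proof (cases "\<Phi> e e = 0")
      case isotropic: True
      show ?thesis
      proof (cases "e \<in> W")
        case True
        have "\<Phi> e w = 0" if "w \<in> W" for w
          using isotropic_orthogonal[OF \<Phi> Ws(1,3) True isotropic that] .
        then have "nonneg_subspace \<Phi> ?Q W" using Ws by (auto simp: nonneg_subspace_def)
        then show ?thesis using nonneg_subspace_dim_le[OF Qf, of \<Phi> W] W(2) by linarith
      next
        case notin: False
        then have "e \<notin> ?W0" by auto
        then have d: "dim (span (insert e ?W0)) = dim ?W0 + 1"
          using dim_span_insert[OF _ W0 W0f, of e] by simp
        have "nonneg_subspace \<Phi> ?Q (span (insert e ?W0))"
          unfolding nonneg_subspace_def
        proof (intro conjI ballI)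
          have "insert e ?W0 \<subseteq> ?Q" using e Ws(2) isotropic by blast
          then show "span (insert e ?W0) \<subseteq> ?Q" using Q by (rule span_minimal)
        next
          fix x assume x: "x \<in> span (insert e ?W0)"
          obtain c w where w: "w \<in> ?W0" "x = c *\<^sub>R e + w"
            by (rule span_insert_subspace[OF W0 x])
          then have "\<Phi> x x = \<Phi> w w"
            using isotropic bl(1)[of w e] by (simp add: bl(2-5))
          then show "0 \<le> \<Phi> x x" using Ws(3) w(1) by simp
        qed simp
        then show ?thesis
          using nonneg_subspace_dim_le[OF Qf, of \<Phi> "span (insert e ?W0)"] d W0d W(2) by linarith
      qed
    next
      case negative: False
      then have neg: "\<Phi> e e < 0" using False by simp
      \<comment> \<open>the projection onto \<open>?Q\<close> along \<open>e\<close>\<close>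
      define h where "h w = w - (\<Phi> e w / \<Phi> e e) *\<^sub>R e" for w
      have h: "linear h"
        unfolding h_def by (intro linearI) (simp_all add: bl(2-5) add_divide_distrib algebra_simps)
      have hq: "\<Phi> (h w) (h w) = \<Phi> w w - (\<Phi> e w)\<^sup>2 / \<Phi> e e" for w
        using neg bl(1)[of w e] unfolding h_def
        by (simp add: bl(4,5,8,9) field_simps power2_eq_square)
      have ho: "\<Phi> e (h w) = 0" for w
        using neg unfolding h_def by (simp add: bl)
      have inj: "inj_on h W"
        unfolding real_vector.linear_inj_on_iff_eq_0[OF h Ws(1)]
      proof (intro ballI impI)
        fix w assume w: "w \<in> W" "h w = 0"
        then have "\<Phi> w w = (\<Phi> e w)\<^sup>2 / \<Phi> e e" using hq[of w] bl(6) by simp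
        moreover have "(\<Phi> e w)\<^sup>2 / \<Phi> e e \<le> 0" using neg by (simp add: divide_nonneg_neg)
        ultimately have "(\<Phi> e w)\<^sup>2 / \<Phi> e e = 0" using Ws(3)[OF w(1)] by linarith
        then have "\<Phi> e w = 0" using neg by simp
        then show "w = 0" using w(2) by (simp add: h_def)
      qed
      have "nonneg_subspace \<Phi> ?Q (h ` W)"
        unfolding nonneg_subspace_def
      proof (intro conjI)
        show "subspace (h ` W)" by (rule real_vector.linear_subspace_image[OF h Ws(1)])
        have "h w \<in> P" if "w \<in> W" for w
          using that Ws(2) e P(1) unfolding h_def by (auto intro!: subspace_diff subspace_scale)
        then show "h ` W \<subseteq> ?Q" using ho by auto
        show "\<forall>w\<in>h ` W. 0 \<le> \<Phi> w w"
        proof (clarify)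
          fix w assume "w \<in> W"
          moreover have "(\<Phi> e w)\<^sup>2 / \<Phi> e e \<le> 0" using neg by (simp add: divide_nonneg_neg)
          ultimately show "0 \<le> \<Phi> (h w) (h w)" using hq[of w] Ws(3)[of w] by simp
        qed
      qed
      then show ?thesis
        using nonneg_subspace_dim_le[OF Qf, of \<Phi> "h ` W"] dim_image_inj_on[OF h Ws(1) Wf inj] W(2)
        by linarith
    qed
    then show ?thesis using ge False by simp
  qed
qed

lemma nonneg_index_split_orthogonal_set:
  assumes \<Phi>: "sym_bilinear \<Phi>" and P: "subspace P" "fin_dim P"
    and B: "finite B" "B \<subseteq> P" "\<And>b c. b \<in> B \<Longrightarrow> c \<in> B \<Longrightarrow> b \<noteq> c \<Longrightarrow> \<Phi> b c = 0"
  shows "nonneg_index \<Phi> P = card {b\<in>B. 0 < \<Phi> b b} + nonneg_index \<Phi> {p\<in>P. \<forall>b\<in>B. \<Phi> b p = 0}"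
  using B
proof (induction B rule: finite_induct)
  case empty
  then show ?case by simp
next
  case (insert e B)
  let ?Q = "{p\<in>P. \<forall>b\<in>B. \<Phi> b p = 0}"
  have Q: "subspace ?Q" by (rule subspace_orthogonal[OF \<Phi> P(1)])
  have Qf: "fin_dim ?Q" by (rule fin_dim_mono[OF P(2)]) auto
  have eQ: "e \<in> ?Q" using insert by auto
  have "nonneg_index \<Phi> P = card {b\<in>B. 0 < \<Phi> b b} + nonneg_index \<Phi> ?Q"
    using insert by auto
  also have "nonneg_index \<Phi> ?Q
      = (if 0 < \<Phi> e e then 1 else 0) + nonneg_index \<Phi> {p\<in>?Q. \<Phi> e p = 0}"
    by (rule nonneg_index_split_vector[OF \<Phi> Q Qf eQ])
  also have "{p\<in>?Q. \<Phi> e p = 0} = {p\<in>P. \<forall>b\<in>insert e B. \<Phi> b p = 0}" by auto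
  also have "card {b\<in>B. 0 < \<Phi> b b} + ((if 0 < \<Phi> e e then 1 else 0) + k)
      = card {b\<in>insert e B. 0 < \<Phi> b b} + k" for k
  proof (cases "0 < \<Phi> e e")
    case True
    then have "{b\<in>insert e B. 0 < \<Phi> b b} = insert e {b\<in>B. 0 < \<Phi> b b}" by auto
    then show ?thesis using True insert.hyps by simp
  next
    case False
    then have "{b\<in>insert e B. 0 < \<Phi> b b} = {b\<in>B. 0 < \<Phi> b b}" by auto
    then show ?thesis using False by simp
  qed
  finally show ?case .
qed

definition orthogonal_basis :: "('v::real_vector \<Rightarrow> 'v \<Rightarrow> real) \<Rightarrow> 'v set \<Rightarrow> 'v set \<Rightarrow> bool" where
  "orthogonal_basis \<Phi> K B \<longleftrightarrow> finite B \<and> independent B \<and> span B = K \<and>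
     (\<forall>b\<in>B. \<forall>c\<in>B. b \<noteq> c \<longrightarrow> \<Phi> b c = 0)"

lemma form_orthogonal_basis_exists:
  assumes \<Phi>: "sym_bilinear \<Phi>" and "subspace K" "fin_dim K"
  shows "\<exists>B. orthogonal_basis \<Phi> K B"
  using assms(2,3)
proof (induction "dim K" arbitrary: K rule: less_induct)
  case less
  note bl = sym_bilinearD[OF \<Phi>]
  show ?case
  proof (cases "\<forall>x\<in>K. \<Phi> x x = 0")
    case True
    have null: "\<Phi> x y = 0" if "x \<in> K" "y \<in> K" for x y
    proof -
      have "\<Phi> (x + y) (x + y) = 0" using that less.prems True by (simp add: subspace_add)
      then show ?thesis using True that bl(1)[of y x] by (simp add: bl(2,3))
    qed
    obtain B where B: "finite B" "independent B" "B \<subseteq> K" "span B = K" "card B = dim K"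
      by (rule fin_dim_basis[OF less.prems(2,1)])
    have "\<forall>b\<in>B. \<forall>c\<in>B. b \<noteq> c \<longrightarrow> \<Phi> b c = 0"
      using null subsetD[OF B(3)] by simp
    then show ?thesis using B(1,2,4) unfolding orthogonal_basis_def by (intro exI[of _ B]) simp
  next
    case False
    then obtain e where e: "e \<in> K" "\<Phi> e e \<noteq> 0" by blast
    let ?Q = "{p\<in>K. \<Phi> e p = 0}"
    have Q: "subspace ?Q" by (rule subspace_orthogonal[OF \<Phi> less.prems(1)])
    have Qf: "fin_dim ?Q" by (rule fin_dim_mono[OF less.prems(2)]) auto
    have se: "span (insert e ?Q) = K"
    proof
      show "span (insert e ?Q) \<subseteq> K" using e less.prems by (intro span_minimal) auto
      show "K \<subseteq> span (insert e ?Q)"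
      proof
        fix x assume x: "x \<in> K"
        let ?c = "\<Phi> e x / \<Phi> e e"
        have "x - ?c *\<^sub>R e \<in> ?Q"
          using x e less.prems(1) by (auto simp: bl intro!: subspace_diff subspace_scale)
        then have "x - ?c *\<^sub>R e \<in> span ?Q" by (rule span_base)
        then show "x \<in> span (insert e ?Q)" using real_vector.span_breakdown_eq by blast
      qed
    qed
    have "e \<notin> ?Q" using e by auto
    then have "dim (span (insert e ?Q)) = dim ?Q + 1"
      using dim_span_insert[OF _ Q Qf, of e] by simp
    then have "dim ?Q < dim K" using se by simp
    then obtain B where B: "orthogonal_basis \<Phi> ?Q B" using less.hyps Q Qf by blast
    have sB: "finite B" "independent B" "span B = ?Q" "\<forall>b\<in>B. \<forall>c\<in>B. b \<noteq> c \<longrightarrow> \<Phi> b c = 0"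
      using B unfolding orthogonal_basis_def by simp_all
    have BQ: "B \<subseteq> ?Q" using real_vector.span_superset[of B] unfolding sB(3) .
    have "e \<notin> span B" using \<open>e \<notin> ?Q\<close> unfolding sB(3) .
    then have "independent (insert e B)"
      using sB(2) by (rule real_vector.independent_insertI)
    moreover have "span (insert e B) = K"
    proof -
      have "span (insert e B) = span (insert e ?Q)"
        unfolding real_vector.span_insert[of e] sB(3) real_vector.span_eq_iff[THEN iffD2, OF Q] ..
      then show ?thesis using se by simp
    qed
    moreover have "\<Phi> e b = 0 \<and> \<Phi> b e = 0" if "b \<in> B" for b
      using BQ that bl(1)[of b e] by auto
    ultimately have "orthogonal_basis \<Phi> K (insert e B)"
      using sB(1,4) unfolding orthogonal_basis_def by simp
    then show ?thesis by blast
  qed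
qed

lemma form_on_orthogonal_sum:
  assumes \<Phi>: "sym_bilinear \<Phi>" and B: "finite B"
    and orth: "\<And>b c. b \<in> B \<Longrightarrow> c \<in> B \<Longrightarrow> b \<noteq> c \<Longrightarrow> \<Phi> b c = 0"
  shows "\<Phi> (\<Sum>b\<in>B. u b *\<^sub>R b) (\<Sum>b\<in>B. u b *\<^sub>R b) = (\<Sum>b\<in>B. (u b)\<^sup>2 * \<Phi> b b)"
proof -
  note bl = sym_bilinearD[OF \<Phi>]
  have "\<Phi> (\<Sum>b\<in>B. u b *\<^sub>R b) (\<Sum>b\<in>B. u b *\<^sub>R b)
      = (\<Sum>b\<in>B. u b * (\<Sum>c\<in>B. u c * \<Phi> b c))"
    by (subst linear_sum[OF bl(11)], simp add: linear_sum[OF bl(10)] bl(4,5) sum_distrib_left mult_ac)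
  also have "\<dots> = (\<Sum>b\<in>B. u b * (u b * \<Phi> b b))"
  proof (intro sum.cong refl)
    fix b assume b: "b \<in> B"
    have "(\<Sum>c\<in>B. u c * \<Phi> b c) = (\<Sum>c\<in>B. if c = b then u b * \<Phi> b b else 0)"
      by (intro sum.cong) (use orth b in auto)
    then show "u b * (\<Sum>c\<in>B. u c * \<Phi> b c) = u b * (u b * \<Phi> b b)" using b B by simp
  qed
  finally show ?thesis by (simp add: power2_eq_square mult.assoc)
qed



text \<open>Sylvester's law of inertia. The spans of the basis vectors with a given sign are definite, and
  they are of maximal dimension since a competitor meets the span of the other basis vectors
  trivially.\<close>

lemma orthogonal_basis_indices:
  assumes \<Phi>: "sym_bilinear \<Phi>" and B: "orthogonal_basis \<Phi> K B"
  shows "pos_index \<Phi> K = card {b\<in>B. 0 < \<Phi> b b}"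
    and "nonneg_index \<Phi> K = card {b\<in>B. 0 \<le> \<Phi> b b}"
    and "dim K = card B"
proof -
  note bl = sym_bilinearD[OF \<Phi>]
  have fB: "finite B" and iB: "independent B" and sB: "span B = K"
    and oB: "\<And>b c. b \<in> B \<Longrightarrow> c \<in> B \<Longrightarrow> b \<noteq> c \<Longrightarrow> \<Phi> b c = 0"
    using B unfolding orthogonal_basis_def by auto
  have K: "subspace K" using sB by (metis subspace_span)
  have Kf: "fin_dim K" using fB sB unfolding fin_dim_def by blast
  have dims: "dim (span C) = card C" if "C \<subseteq> B" for C
    using that iB real_vector.independent_mono real_vector.dim_span_eq_card_independent by blast
  show dK: "dim K = card B" using dims[of B] sB by simp
  have sub: "span C \<subseteq> K" if "C \<subseteq> B" for C using that sB real_vector.span_mono by blast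
  have val: "\<exists>u. x = (\<Sum>b\<in>C. u b *\<^sub>R b) \<and> \<Phi> x x = (\<Sum>b\<in>C. (u b)\<^sup>2 * \<Phi> b b)"
    if C: "C \<subseteq> B" and x: "x \<in> span C" for C x
  proof -
    have fC: "finite C" using C fB finite_subset by blast
    obtain u where u: "x = (\<Sum>b\<in>C. u b *\<^sub>R b)"
      using x real_vector.span_finite[OF fC] by auto
    have "\<Phi> x x = (\<Sum>b\<in>C. (u b)\<^sup>2 * \<Phi> b b)"
      unfolding u by (rule form_on_orthogonal_sum[OF \<Phi> fC]) (use oB C in blast)
    then show ?thesis using u by blast
  qed
  \<comment> \<open>two subspaces on which the form has incompatible signs meet trivially; this bounds
      the dimension of each by the codimension of the other\<close>
  have bound: "dim W + card C \<le> card B"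
    if W: "subspace W" "W \<subseteq> K" and C: "C \<subseteq> B" and disj: "W \<inter> span C \<subseteq> {0}" for W C
    using dim_add_le_of_disjoint[OF Kf W subspace_span sub[OF C] K disj] dims[OF C] dK by simp
  let ?P = "{b\<in>B. 0 < \<Phi> b b}" and ?NP = "{b\<in>B. \<Phi> b b \<le> 0}"
  let ?NN = "{b\<in>B. 0 \<le> \<Phi> b b}" and ?N = "{b\<in>B. \<Phi> b b < 0}"
  have c1: "card ?P + card ?NP = card B"
  proof -
    have "?P \<union> ?NP = B" "?P \<inter> ?NP = {}" by auto
    then show ?thesis using card_Un_disjoint[of ?P ?NP] fB by simp
  qed
  have c2: "card ?NN + card ?N = card B"
  proof -
    have "?NN \<union> ?N = B" "?NN \<inter> ?N = {}" by auto
    then show ?thesis using card_Un_disjoint[of ?NN ?N] fB by simp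
  qed
  have strict: "0 < s * \<Phi> x x" if C: "C \<subseteq> B" "\<And>b. b \<in> C \<Longrightarrow> 0 < s * \<Phi> b b"
    and x: "x \<in> span C" "x \<noteq> 0" for C x and s :: real
  proof -
    obtain u where u: "x = (\<Sum>b\<in>C. u b *\<^sub>R b)" "\<Phi> x x = (\<Sum>b\<in>C. (u b)\<^sup>2 * \<Phi> b b)"
      using val[OF C(1) x(1)] by blast
    have fC: "finite C" using C(1) fB finite_subset by blast
    obtain b where b: "b \<in> C" "u b \<noteq> 0"
      using u(1) x(2) sum.neutral[of C "\<lambda>b. u b *\<^sub>R b"] by force
    have "s * \<Phi> x x = (\<Sum>b\<in>C. (u b)\<^sup>2 * (s * \<Phi> b b))"
      unfolding u(2) sum_distrib_left by (simp add: mult_ac)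
    also have "\<dots> > 0"
    proof (rule sum_pos2[OF fC b(1)])
      show "0 < (u b)\<^sup>2 * (s * \<Phi> b b)" using b C(2) by simp
      show "0 \<le> (u i)\<^sup>2 * (s * \<Phi> i i)" if "i \<in> C" for i using that C(2)[of i] by simp
    qed
    finally show ?thesis .
  qed
  have weak: "0 \<le> s * \<Phi> x x" if C: "C \<subseteq> B" "\<And>b. b \<in> C \<Longrightarrow> 0 \<le> s * \<Phi> b b"
    and x: "x \<in> span C" for C x and s :: real
  proof -
    obtain u where u: "\<Phi> x x = (\<Sum>b\<in>C. (u b)\<^sup>2 * \<Phi> b b)"
      using val[OF C(1) x(1)] by blast
    have "s * \<Phi> x x = (\<Sum>b\<in>C. (u b)\<^sup>2 * (s * \<Phi> b b))"
      unfolding u sum_distrib_left by (simp add: mult_ac)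
    also have "\<dots> \<ge> 0" by (intro sum_nonneg mult_nonneg_nonneg[OF _ C(2)]) auto
    finally show ?thesis .
  qed
  show "pos_index \<Phi> K = card ?P"
  proof (rule antisym)
    obtain W where W: "pos_subspace \<Phi> K W" "dim W = pos_index \<Phi> K"
      using pos_index_attained[OF Kf K] .
    have "x = 0" if x: "x \<in> W" "x \<in> span ?NP" for x
      using weak[of ?NP "-1" x] x W(1) unfolding pos_subspace_def by force
    then have "W \<inter> span ?NP \<subseteq> {0}" by blast
    then show "pos_index \<Phi> K \<le> card ?P"
      using bound[of W ?NP] W c1 unfolding pos_subspace_def by auto
    have "pos_subspace \<Phi> K (span ?P)"
      using strict[of ?P 1] sub[of ?P] unfolding pos_subspace_def by auto
    then show "card ?P \<le> pos_index \<Phi> K"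
      using pos_subspace_dim_le[OF Kf] dims[of ?P] by fastforce
  qed
  show "nonneg_index \<Phi> K = card ?NN"
  proof (rule antisym)
    obtain W where W: "nonneg_subspace \<Phi> K W" "dim W = nonneg_index \<Phi> K"
      using nonneg_index_attained[OF Kf K \<Phi>] .
    have "x = 0" if x: "x \<in> W" "x \<in> span ?N" for x
      using strict[of ?N "-1" x] x W(1) unfolding nonneg_subspace_def by force
    then have "W \<inter> span ?N \<subseteq> {0}" by blast
    then show "nonneg_index \<Phi> K \<le> card ?NN"
      using bound[of W ?N] W c2 unfolding nonneg_subspace_def by auto
    have "nonneg_subspace \<Phi> K (span ?NN)"
      using weak[of ?NN 1] sub[of ?NN] unfolding nonneg_subspace_def by auto
    then show "card ?NN \<le> nonneg_index \<Phi> K"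
      using nonneg_subspace_dim_le[OF Kf] dims[of ?NN] by fastforce
  qed
qed

text \<open>This identity carries the comparison of forms. It covers degenerate forms, in particular
  Dirichlet forms at eigenvalues. It follows by splitting off the vectors of an orthogonal
  basis of \<open>K\<close> one at a time: the positive ones contribute one each, the others nothing.\<close>

lemma nonneg_index_split:
  assumes \<Phi>: "sym_bilinear \<Phi>" and P: "subspace P" "fin_dim P" and K: "subspace K" "K \<subseteq> P"
  shows "nonneg_index \<Phi> P = pos_index \<Phi> K + nonneg_index \<Phi> {p\<in>P. \<forall>k\<in>K. \<Phi> k p = 0}"
proof -
  obtain B where B: "orthogonal_basis \<Phi> K B"
    using form_orthogonal_basis_exists[OF \<Phi> K(1) fin_dim_mono[OF P(2) K(2)]] by blast
  have fB: "finite B" and sB: "span B = K"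
    and oB: "\<And>b c. b \<in> B \<Longrightarrow> c \<in> B \<Longrightarrow> b \<noteq> c \<Longrightarrow> \<Phi> b c = 0"
    using B unfolding orthogonal_basis_def by auto
  have BK: "B \<subseteq> K" using real_vector.span_superset[of B] unfolding sB .
  have "(\<forall>b\<in>B. \<Phi> b p = 0) \<longleftrightarrow> (\<forall>k\<in>K. \<Phi> k p = 0)" for p
  proof
    assume z: "\<forall>b\<in>B. \<Phi> b p = 0"
    have "K \<subseteq> {k. \<Phi> k p = 0}"
      unfolding sB[symmetric]
      by (rule span_minimal) (use z \<Phi> in \<open>auto simp: subspace_def sym_bilinearD\<close>)
    then show "\<forall>k\<in>K. \<Phi> k p = 0" by blast
  qed (use BK in blast)
  then show ?thesis
    using nonneg_index_split_orthogonal_set[OF \<Phi> P fB _ oB] BK K(2)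
      orthogonal_basis_indices(1)[OF \<Phi> B] by auto
qed

lemma dim_eq_neg_plus_nonneg:
  assumes \<Phi>: "sym_bilinear \<Phi>" and P: "subspace P" "fin_dim P"
  shows "dim P = pos_index (\<lambda>x y. - \<Phi> x y) P + nonneg_index \<Phi> P"
proof -
  obtain B where B: "orthogonal_basis \<Phi> P B"
    using form_orthogonal_basis_exists[OF \<Phi> P] by blast
  have B': "orthogonal_basis (\<lambda>x y. - \<Phi> x y) P B" using B unfolding orthogonal_basis_def by simp
  have "finite B" using B unfolding orthogonal_basis_def by simp
  moreover have "{b\<in>B. - \<Phi> b b > 0} \<union> {b\<in>B. 0 \<le> \<Phi> b b} = B"
    "{b\<in>B. - \<Phi> b b > 0} \<inter> {b\<in>B. 0 \<le> \<Phi> b b} = {}" by auto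
  ultimately have "card B = card {b\<in>B. - \<Phi> b b > 0} + card {b\<in>B. 0 \<le> \<Phi> b b}"
    using card_Un_disjoint[of "{b\<in>B. - \<Phi> b b > 0}" "{b\<in>B. 0 \<le> \<Phi> b b}"] by simp
  then show ?thesis
    using orthogonal_basis_indices[OF \<Phi> B]
      orthogonal_basis_indices(1)[OF sym_bilinear_uminus[OF \<Phi>] B'] by simp
qed

lemma nonneg_index_eq_pos_plus_null:
  assumes \<Phi>: "sym_bilinear \<Phi>" and P: "subspace P" "fin_dim P"
  shows "nonneg_index \<Phi> P = pos_index \<Phi> P + dim {p\<in>P. \<forall>k\<in>P. \<Phi> k p = 0}"
proof -
  have "nonneg_index \<Phi> {p\<in>P. \<forall>k\<in>P. \<Phi> k p = 0} = dim {p\<in>P. \<forall>k\<in>P. \<Phi> k p = 0}"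
    by (rule nonneg_index_eq_dim)
      (use P \<Phi> in \<open>auto intro: fin_dim_mono subspace_orthogonal(2)\<close>)
  then show ?thesis using nonneg_index_split[OF \<Phi> P P(1)] by simp
qed

text \<open>A positive subspace for \<open>\<Phi>\<close> meets the kernel of \<open>h\<close> trivially, and conversely a positive subspace
  of the image can be lifted by a linear right inverse.\<close>

lemma pos_index_image:
  assumes h: "linear h" and P: "subspace P" "fin_dim P"
    and eq: "\<And>x. x \<in> P \<Longrightarrow> \<Phi> x x = \<Psi> (h x) (h x)"
    and 0: "\<Psi> 0 0 = 0"
  shows "pos_index \<Phi> P = pos_index \<Psi> (h ` P)"
proof (rule antisym)
  have hP: "subspace (h ` P)" by (rule real_vector.linear_subspace_image[OF h P(1)])
  have hPf: "fin_dim (h ` P)" by (rule fin_dim_image[OF h P(2)])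
  obtain W where W: "pos_subspace \<Phi> P W" "dim W = pos_index \<Phi> P"
    using pos_index_attained[OF P(2,1)] .
  have Ws: "subspace W" "W \<subseteq> P" "\<And>w. w \<in> W \<Longrightarrow> w \<noteq> 0 \<Longrightarrow> 0 < \<Phi> w w"
    using W(1) unfolding pos_subspace_def by auto
  have "inj_on h W"
    unfolding real_vector.linear_inj_on_iff_eq_0[OF h Ws(1)]
    using Ws(2,3) eq 0 by (metis less_irrefl subsetD)
  then have "dim (h ` W) = dim W" using dim_image_inj_on[OF h Ws(1)] fin_dim_mono[OF P(2) Ws(2)] by blast
  moreover have "pos_subspace \<Psi> (h ` P) (h ` W)"
    unfolding pos_subspace_def
  proof (intro conjI ballI impI)
    show "subspace (h ` W)" by (rule real_vector.linear_subspace_image[OF h Ws(1)])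
    show "h ` W \<subseteq> h ` P" using Ws(2) by blast
    fix y assume y: "y \<in> h ` W" "y \<noteq> 0"
    then obtain w where w: "w \<in> W" "y = h w" by blast
    then have "w \<noteq> 0" using y(2) linear_0[OF h] by auto
    then show "0 < \<Psi> y y" using Ws(3)[OF w(1)] eq[of w] w Ws(2) by auto
  qed
  ultimately show "pos_index \<Phi> P \<le> pos_index \<Psi> (h ` P)"
    using pos_subspace_dim_le[OF hPf] W(2) by metis
next
  have hP: "subspace (h ` P)" by (rule real_vector.linear_subspace_image[OF h P(1)])
  have hPf: "fin_dim (h ` P)" by (rule fin_dim_image[OF h P(2)])
  obtain W where W: "pos_subspace \<Psi> (h ` P) W" "dim W = pos_index \<Psi> (h ` P)"
    using pos_index_attained[OF hPf hP] .
  have Ws: "subspace W" "W \<subseteq> h ` P" "\<And>w. w \<in> W \<Longrightarrow> w \<noteq> 0 \<Longrightarrow> 0 < \<Psi> w w"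
    using W(1) unfolding pos_subspace_def by auto
  obtain g where g: "range g \<subseteq> P" "linear g" "\<forall>v\<in>h ` P. h (g v) = v"
    using real_vector.linear_exists_right_inverse_on[OF h P(1)] by auto
  have hg: "h (g w) = w" if "w \<in> W" for w using that Ws(2) g(3) by blast
  have "inj_on g W" using hg by (metis inj_onI)
  then have "dim (g ` W) = dim W"
    using dim_image_inj_on[OF g(2) Ws(1)] fin_dim_mono[OF hPf Ws(2)] by blast
  moreover have "pos_subspace \<Phi> P (g ` W)"
    unfolding pos_subspace_def
  proof (intro conjI ballI impI)
    show "subspace (g ` W)" by (rule real_vector.linear_subspace_image[OF g(2) Ws(1)])
    show "g ` W \<subseteq> P" using g(1) by blast
    fix y assume y: "y \<in> g ` W" "y \<noteq> 0"
    then obtain w where w: "w \<in> W" "y = g w" by blast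
    then have "w \<noteq> 0" using y(2) linear_0[OF g(2)] by auto
    moreover have "y \<in> P" using w g(1) by blast
    ultimately show "0 < \<Phi> y y" using Ws(3)[OF w(1)] eq[of y] hg[OF w(1)] w by simp
  qed
  ultimately show "pos_index \<Psi> (h ` P) \<le> pos_index \<Phi> P"
    using pos_subspace_dim_le[OF P(2)] W(2) by metis
qed

lemma pos_index_mono:
  assumes "subspace K" "fin_dim K" "\<And>x. x \<in> K \<Longrightarrow> \<Phi> x x \<le> \<Psi> x x"
  shows "pos_index \<Phi> K \<le> pos_index \<Psi> K"
proof -
  obtain W where W: "pos_subspace \<Phi> K W" "dim W = pos_index \<Phi> K"
    using pos_index_attained[OF assms(2,1)] .
  have "pos_subspace \<Psi> K W"
    using W(1) assms(3) unfolding pos_subspace_def by (meson less_le_trans subsetD)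
  then show ?thesis using pos_subspace_dim_le[OF assms(2)] W(2) by metis
qed

text \<open>A positive subspace stays positive under small perturbations. An orthogonal basis makes
  this elementary: the perturbed Gram matrix is still diagonally dominant.\<close>

lemma pos_index_lower_semicontinuous:
  fixes \<Phi> :: "'t \<Rightarrow> 'v::real_vector \<Rightarrow> 'v \<Rightarrow> real"
  assumes K: "subspace K" "fin_dim K"
    and \<Phi>: "\<And>t. sym_bilinear (\<Phi> t)" "sym_bilinear \<Psi>"
    and lim: "\<And>x y. ((\<lambda>t. \<Phi> t x y) \<longlongrightarrow> \<Psi> x y) F"
  shows "eventually (\<lambda>t. pos_index \<Psi> K \<le> pos_index (\<Phi> t) K) F"
proof -
  obtain B0 where B0: "orthogonal_basis \<Psi> K B0"
    using form_orthogonal_basis_exists[OF \<Phi>(2) K] by blast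
  define B where "B = {b\<in>B0. 0 < \<Psi> b b}"
  have fB: "finite B" and iB: "independent B" and sB: "span B \<subseteq> K"
    and oB: "\<And>b c. b \<in> B \<Longrightarrow> c \<in> B \<Longrightarrow> b \<noteq> c \<Longrightarrow> \<Psi> b c = 0"
    using B0 real_vector.independent_mono[of B0 B] real_vector.span_mono[of B B0]
    unfolding orthogonal_basis_def B_def by auto
  have cB: "pos_index \<Psi> K = card B"
    using orthogonal_basis_indices(1)[OF \<Phi>(2) B0] by (simp add: B_def)
  have "eventually (\<lambda>t. (\<Sum>c\<in>B-{b}. \<bar>\<Phi> t b c\<bar>) < \<Phi> t b b) F" if b: "b \<in> B" for b
  proof -
    have l: "((\<lambda>t. \<Phi> t b b - (\<Sum>c\<in>B-{b}. \<bar>\<Phi> t b c\<bar>)) \<longlongrightarrow> \<Psi> b b - (\<Sum>c\<in>B-{b}. \<bar>\<Psi> b c\<bar>)) F"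
      by (intro tendsto_intros lim)
    have "(\<Sum>c\<in>B-{b}. \<bar>\<Psi> b c\<bar>) = 0" using oB b by (intro sum.neutral) auto
    then have "0 < \<Psi> b b - (\<Sum>c\<in>B-{b}. \<bar>\<Psi> b c\<bar>)" using b by (simp add: B_def)
    from order_tendstoD(1)[OF l this] show ?thesis by simp
  qed
  then have "eventually (\<lambda>t. \<forall>b\<in>B. (\<Sum>c\<in>B-{b}. \<bar>\<Phi> t b c\<bar>) < \<Phi> t b b) F"
    using fB by (simp add: eventually_ball_finite)
  then show ?thesis
  proof eventually_elim
    case (elim t)
    note bl = sym_bilinearD[OF \<Phi>(1)[of t]]
    \<comment> \<open>diagonal dominance of the Gram matrix forces positivity\<close>
    have "0 < \<Phi> t x x" if x: "x \<in> span B" "x \<noteq> 0" for x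
    proof -
      obtain u where u: "x = (\<Sum>b\<in>B. u b *\<^sub>R b)"
        using x(1) real_vector.span_finite[OF fB] by auto
      obtain b0 where b0: "b0 \<in> B" "u b0 \<noteq> 0"
        using u x(2) sum.neutral[of B "\<lambda>b. u b *\<^sub>R b"] by force
      define r where "r b = \<Phi> t b b - (\<Sum>c\<in>B-{b}. \<bar>\<Phi> t b c\<bar>)" for b
      have r: "0 < r b" if "b \<in> B" for b using elim that by (simp add: r_def)
      have off: "(\<Sum>b\<in>B. \<Sum>c\<in>B-{b}. (u c)\<^sup>2 * \<bar>\<Phi> t b c\<bar>) = (\<Sum>b\<in>B. \<Sum>c\<in>B-{b}. (u b)\<^sup>2 * \<bar>\<Phi> t b c\<bar>)"
      proof -
        have e: "(\<Sum>c\<in>B-{b}. f c) = (\<Sum>c\<in>B. if b = c then 0 else f c)" if "b \<in> B" for b and f :: "'v \<Rightarrow> real"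
          using fB that by (simp add: sum.remove[of B b] sum.If_cases) (intro sum.cong, auto)
        have "(\<Sum>b\<in>B. \<Sum>c\<in>B-{b}. (u c)\<^sup>2 * \<bar>\<Phi> t b c\<bar>)
            = (\<Sum>b\<in>B. \<Sum>c\<in>B. if b = c then 0 else (u c)\<^sup>2 * \<bar>\<Phi> t b c\<bar>)"
          by (intro sum.cong refl e)
        also have "\<dots> = (\<Sum>c\<in>B. \<Sum>b\<in>B. if b = c then 0 else (u c)\<^sup>2 * \<bar>\<Phi> t b c\<bar>)"
          by (rule sum.swap)
        also have "\<dots> = (\<Sum>c\<in>B. \<Sum>b\<in>B. if c = b then 0 else (u c)\<^sup>2 * \<bar>\<Phi> t c b\<bar>)"
          by (intro sum.cong refl) (auto simp: bl(1))
        also have "\<dots> = (\<Sum>b\<in>B. \<Sum>c\<in>B-{b}. (u b)\<^sup>2 * \<bar>\<Phi> t b c\<bar>)"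
          by (intro sum.cong refl e[symmetric])
        finally show ?thesis .
      qed
      have "\<Phi> t x x = (\<Sum>b\<in>B. \<Sum>c\<in>B. u b * u c * \<Phi> t b c)"
        unfolding u by (subst linear_sum[OF bl(11)])
          (simp add: linear_sum[OF bl(10)] bl(4,5) sum_distrib_left mult_ac)
      also have "\<dots> = (\<Sum>b\<in>B. (u b)\<^sup>2 * \<Phi> t b b + (\<Sum>c\<in>B-{b}. u b * u c * \<Phi> t b c))"
        using fB by (intro sum.cong refl) (simp add: sum.remove power2_eq_square)
      also have "\<dots> \<ge> (\<Sum>b\<in>B. (u b)\<^sup>2 * \<Phi> t b b
          + (\<Sum>c\<in>B-{b}. - ((u b)\<^sup>2 * \<bar>\<Phi> t b c\<bar>) / 2 - ((u c)\<^sup>2 * \<bar>\<Phi> t b c\<bar>) / 2))"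
      proof (intro sum_mono add_left_mono)
        fix b c
        have "\<bar>u b * u c\<bar> \<le> ((u b)\<^sup>2 + (u c)\<^sup>2) / 2"
          using sum_squares_bound[of "\<bar>u b\<bar>" "\<bar>u c\<bar>"] by (simp add: abs_mult)
        then have "\<bar>u b * u c\<bar> * \<bar>\<Phi> t b c\<bar> \<le> ((u b)\<^sup>2 + (u c)\<^sup>2) / 2 * \<bar>\<Phi> t b c\<bar>"
          by (rule mult_right_mono) simp
        moreover have "- (\<bar>u b * u c\<bar> * \<bar>\<Phi> t b c\<bar>) \<le> u b * u c * \<Phi> t b c"
          by (metis abs_mult abs_ge_minus_self minus_le_iff)
        ultimately show "- ((u b)\<^sup>2 * \<bar>\<Phi> t b c\<bar>) / 2 - ((u c)\<^sup>2 * \<bar>\<Phi> t b c\<bar>) / 2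
            \<le> u b * u c * \<Phi> t b c"
          by (simp add: algebra_simps add_divide_distrib)
      qed
      also have "(\<Sum>b\<in>B. (u b)\<^sup>2 * \<Phi> t b b
          + (\<Sum>c\<in>B-{b}. - ((u b)\<^sup>2 * \<bar>\<Phi> t b c\<bar>) / 2 - ((u c)\<^sup>2 * \<bar>\<Phi> t b c\<bar>) / 2))
          = (\<Sum>b\<in>B. (u b)\<^sup>2 * \<Phi> t b b) - (\<Sum>b\<in>B. \<Sum>c\<in>B-{b}. (u b)\<^sup>2 * \<bar>\<Phi> t b c\<bar>) / 2
            - (\<Sum>b\<in>B. \<Sum>c\<in>B-{b}. (u c)\<^sup>2 * \<bar>\<Phi> t b c\<bar>) / 2"
        by (simp add: sum.distrib sum_subtractf sum_negf sum_divide_distrib)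
      also have "\<dots> = (\<Sum>b\<in>B. (u b)\<^sup>2 * r b)"
        unfolding off r_def by (simp add: algebra_simps sum_subtractf sum_distrib_left)
      finally have "(\<Sum>b\<in>B. (u b)\<^sup>2 * r b) \<le> \<Phi> t x x" .
      moreover have "0 < (\<Sum>b\<in>B. (u b)\<^sup>2 * r b)"
      proof (rule sum_pos2[OF fB b0(1)])
        show "0 < (u b0)\<^sup>2 * r b0" using b0 r by simp
        show "0 \<le> (u i)\<^sup>2 * r i" if "i \<in> B" for i using that r[of i] by simp
      qed
      ultimately show ?thesis by simp
    qed
    then have "pos_subspace (\<Phi> t) K (span B)"
      unfolding pos_subspace_def using sB by auto
    then show "pos_index \<Psi> K \<le> pos_index (\<Phi> t) K"
      using pos_subspace_dim_le[OF K(2)] iB cB real_vector.dim_span_eq_card_independent by metis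
  qed
qed

section \<open>Symmetric matrices and the Moore--Penrose inverse\<close>

lemma symmetric_matrix_iff:
  "transpose M = M \<longleftrightarrow> (\<forall>x y. x \<bullet> (M *v y) = (M *v x) \<bullet> (y::real^'n))"
proof
  assume "transpose M = M"
  then show "\<forall>x y. x \<bullet> (M *v y) = (M *v x) \<bullet> y"
    by (metis dot_lmul_matrix transpose_matrix_vector)
next
  assume h: "\<forall>x y. x \<bullet> (M *v y) = (M *v x) \<bullet> y"
  have "transpose M *v x = M *v x" for x
  proof (rule vector_eq_ldot[THEN iffD1], rule allI)
    fix y
    show "y \<bullet> (transpose M *v x) = y \<bullet> (M *v x)"
      using h by (metis dot_lmul_matrix inner_commute transpose_matrix_vector)
  qed
  then show "transpose M = M" by (simp add: matrix_eq)
qed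

lemma sym_bilinear_matrix:
  fixes M :: "real^'n^'n"
  assumes "transpose M = M"
  shows "sym_bilinear (\<lambda>x y. x \<bullet> (M *v y))"
  unfolding sym_bilinear_def
proof (intro conjI allI)
  fix x y :: "real^'n"
  show "x \<bullet> (M *v y) = y \<bullet> (M *v x)"
    using assms unfolding symmetric_matrix_iff by (metis inner_commute)
  show "linear (\<lambda>x. x \<bullet> (M *v y))"
    by (intro linearI) (simp_all add: inner_add_left)
qed

text \<open>A maximum of the Rayleigh quotient on the unit sphere of \<open>V\<close> is an eigenvector: with \<open>c\<close> the
  maximal value, \<open>c I - M\<close> is nonnegative on \<open>V\<close> and the maximizer is isotropic for it.\<close>

lemma symmetric_eigenvector_exists:
  fixes M :: "real^'n^'n"
  assumes M: "transpose M = M" and V: "subspace V" "V \<noteq> {0}"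
    and inv: "\<And>v. v \<in> V \<Longrightarrow> M *v v \<in> V"
  shows "\<exists>v\<in>V. v \<noteq> 0 \<and> (\<exists>c. M *v v = c *s v)"
proof -
  let ?S = "sphere 0 1 \<inter> V"
  obtain w where w: "w \<in> V" "w \<noteq> 0" using V subspace_0 by blast
  have ne: "(1 / norm w) *\<^sub>R w \<in> ?S" using w V(1) by (simp add: subspace_scale)
  have "compact ?S" using V(1) by (intro compact_Int_closed) (auto simp: closed_subspace)
  moreover have "continuous_on ?S (\<lambda>v. v \<bullet> (M *v v))"
    by (intro continuous_intros linear_continuous_on linear_conv_bounded_linear[THEN iffD1]) simp
  ultimately obtain v where v: "v \<in> ?S" "\<And>x. x \<in> ?S \<Longrightarrow> x \<bullet> (M *v x) \<le> v \<bullet> (M *v v)"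
    using continuous_attains_sup[of ?S "\<lambda>v. v \<bullet> (M *v v)"] ne by blast
  define c where "c = v \<bullet> (M *v v)"
  define \<Phi> where "\<Phi> x y = x \<bullet> ((c *\<^sub>R mat 1 - M) *v y)" for x y :: "real^'n"
  have \<Phi>: "sym_bilinear \<Phi>"
    unfolding \<Phi>_def
    by (rule sym_bilinear_matrix) (use M in \<open>auto simp: transpose_def mat_def vec_eq_iff\<close>)
  have val: "\<Phi> x y = c * (x \<bullet> y) - x \<bullet> (M *v y)" for x y
    unfolding \<Phi>_def
    by (simp add: matrix_vector_mult_diff_rdistrib inner_diff_right scaleR_matrix_vector_assoc[symmetric])
  have nn: "0 \<le> \<Phi> x x" if x: "x \<in> V" for x
  proof (cases "x = 0")
    case False
    let ?y = "(1 / norm x) *\<^sub>R x"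
    have "?y \<in> ?S" using x False V(1) by (simp add: subspace_scale)
    then have "?y \<bullet> (M *v ?y) \<le> c" using v(2) c_def by blast
    then have "(x \<bullet> (M *v x)) / (norm x)\<^sup>2 \<le> c"
      by (simp add: matrix_vector_mult_scaleR power2_eq_square)
    then have "x \<bullet> (M *v x) \<le> c * (norm x)\<^sup>2" using False by (simp add: pos_divide_le_eq)
    then show ?thesis by (simp add: val power2_norm_eq_inner)
  qed (simp add: sym_bilinearD[OF \<Phi>])
  have vV: "v \<in> V" and v1: "v \<bullet> v = 1" using v(1) by (auto simp: norm_eq_1)
  have "\<Phi> v v = 0" by (simp add: val v1 c_def)
  then have z: "\<Phi> v y = 0" if "y \<in> V" for y
    using isotropic_orthogonal[OF \<Phi> V(1) nn vV _ that] by simp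
  have "M *v v - c *\<^sub>R v \<in> V" using inv vV V(1) by (simp add: subspace_diff subspace_scale)
  from z[OF this] have "(M *v v - c *\<^sub>R v) \<bullet> (M *v v - c *\<^sub>R v) = 0"
    unfolding val M[unfolded symmetric_matrix_iff, rule_format]
    unfolding inner_diff_left[of "M *v v"] by simp
  then have "M *v v = c *s v" by (simp add: scalar_mult_eq_scaleR)
  moreover have "v \<noteq> 0" using v1 by auto
  ultimately show ?thesis using vV by blast
qed

lemma symmetric_eigenbasis:
  fixes M :: "real^'n^'n"
  assumes M: "transpose M = M" and "subspace V" "\<And>v. v \<in> V \<Longrightarrow> M *v v \<in> V"
  shows "\<exists>B. finite B \<and> independent B \<and> span B = V \<and> pairwise orthogonal B \<and>
           (\<forall>b\<in>B. \<exists>c. M *v b = c *s b)"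
  using assms(2,3)
proof (induction "dim V" arbitrary: V rule: less_induct)
  case less
  show ?case
  proof (cases "V = {0}")
    case True
    then show ?thesis by (intro exI[of _ "{}"]) (simp add: real_vector.independent_empty)
  next
    case False
    obtain v c where v: "v \<in> V" "v \<noteq> 0" "M *v v = c *s v"
      using symmetric_eigenvector_exists[OF M less.prems(1) False less.prems(2)] by blast
    let ?Q = "{x\<in>V. v \<bullet> x = 0}"
    have Q: "subspace ?Q"
      using less.prems(1) by (auto simp: subspace_def inner_add_right)
    have inv: "M *v x \<in> ?Q" if "x \<in> ?Q" for x
      using that v(3) less.prems(2) M unfolding symmetric_matrix_iff
      by (auto simp: scalar_mult_eq_scaleR)
    have se: "span (insert v ?Q) = V"
    proof
      have "insert v ?Q \<subseteq> V" using v(1) by blast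
      then show "span (insert v ?Q) \<subseteq> V" using less.prems(1) by (rule span_minimal)
      show "V \<subseteq> span (insert v ?Q)"
      proof
        fix x assume x: "x \<in> V"
        let ?c = "(v \<bullet> x) / (v \<bullet> v)"
        have "x - ?c *\<^sub>R v \<in> ?Q"
          using x v less.prems(1) by (auto simp: inner_diff_right intro!: subspace_diff subspace_scale)
        then have "x - ?c *\<^sub>R v \<in> span ?Q" by (rule span_base)
        then show "x \<in> span (insert v ?Q)" using real_vector.span_breakdown_eq by blast
      qed
    qed
    have vQ: "v \<notin> ?Q" using v by auto
    then have "dim (span (insert v ?Q)) = dim ?Q + 1"
      using dim_span_insert[OF _ Q fin_dim_euclidean, of v] by simp
    then have "dim ?Q < dim V" using se by simp
    from less.hyps[OF this Q inv] obtain B where B: "finite B" "independent B" "span B = ?Q"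
      "pairwise orthogonal B" "\<forall>b\<in>B. \<exists>c. M *v b = c *s b" by blast
    have BQ: "B \<subseteq> ?Q" using real_vector.span_superset[of B] unfolding B(3) .
    have "v \<notin> span B" using vQ unfolding B(3) .
    then have "independent (insert v B)" using B(2) by (rule real_vector.independent_insertI)
    moreover have "span (insert v B) = V"
      using se
      unfolding real_vector.span_insert[of v] B(3) real_vector.span_eq_iff[THEN iffD2, OF Q] .
    moreover have "pairwise orthogonal (insert v B)"
      using B(4) BQ by (auto simp: pairwise_insert orthogonal_def inner_commute)
    ultimately show ?thesis using B(1,5) v(3) by (intro exI[of _ "insert v B"]) auto
  qed
qed

text \<open>In an orthogonal eigenbasis both sides count the basis vectors with negative eigenvalue.\<close>

lemma neg_ind_eq_pos_index:
  fixes M :: "real^'n^'n"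
  assumes M: "transpose M = M"
  shows "neg_ind M = pos_index (\<lambda>x y. - (x \<bullet> (M *v y))) UNIV"
proof -
  obtain B where B: "finite B" "independent B" "span B = (UNIV :: (real^'n) set)"
      "pairwise orthogonal B" "\<forall>b\<in>B. \<exists>c. M *v b = c *s b"
    using symmetric_eigenbasis[OF M subspace_UNIV] by auto
  obtain ev where ev: "\<And>b. b \<in> B \<Longrightarrow> M *v b = ev b *s b" using B(5) by metis
  have nz: "b \<noteq> 0" if "b \<in> B" for b using B(2) that real_vector.dependent_zero by blast
  have orth: "b \<bullet> c = 0" if "b \<in> B" "c \<in> B" "b \<noteq> c" for b c
    using B(4) that unfolding pairwise_def orthogonal_def by blast
  let ?\<Phi> = "\<lambda>x y. - (x \<bullet> (M *v y))"
  have \<Phi>: "sym_bilinear ?\<Phi>" by (rule sym_bilinear_uminus[OF sym_bilinear_matrix[OF M]])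
  have val: "?\<Phi> b c = - (ev c * (b \<bullet> c))" if "c \<in> B" for b c
    using ev[OF that] by (simp add: scalar_mult_eq_scaleR)
  have ob: "orthogonal_basis ?\<Phi> UNIV B"
    unfolding orthogonal_basis_def using B orth val by auto
  have eig: "{v. M *v v = c *s v} = span {b\<in>B. ev b = c}" for c
  proof
    show "span {b\<in>B. ev b = c} \<subseteq> {v. M *v v = c *s v}"
      by (rule span_minimal)
        (use ev in \<open>auto simp: subspace_def matrix_vector_right_distrib scalar_mult_eq_scaleR
          matrix_vector_mult_scaleR scaleR_add_right\<close>)
    show "{v. M *v v = c *s v} \<subseteq> span {b\<in>B. ev b = c}"
    proof clarify
      fix v assume v: "M *v v = c *s v"
      obtain u where u: "v = (\<Sum>b\<in>B. u b *\<^sub>R b)"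
        using real_vector.span_finite[OF B(1)] B(3) by auto
      have "u b = 0" if b: "b \<in> B" "ev b \<noteq> c" for b
      proof -
        have "b \<bullet> v = (\<Sum>x\<in>B. u x * (b \<bullet> x))" unfolding u by (simp add: inner_sum_right)
        also have "\<dots> = (\<Sum>x\<in>B. if x = b then u b * (b \<bullet> b) else 0)"
          by (intro sum.cong) (use orth b in auto)
        finally have bv: "b \<bullet> v = u b * (b \<bullet> b)" using b B(1) by simp
        have "b \<bullet> (M *v v) = (M *v b) \<bullet> v" using M unfolding symmetric_matrix_iff by blast
        then have "c * (b \<bullet> v) = ev b * (b \<bullet> v)"
          using v ev[OF b(1)] by (simp add: scalar_mult_eq_scaleR)
        then show ?thesis using b bv nz by simp
      qed
      then have "v = (\<Sum>b\<in>{b\<in>B. ev b = c}. u b *\<^sub>R b)"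
        unfolding u using B(1) by (intro sum.mono_neutral_right) auto
      also have "\<dots> \<in> span {b\<in>B. ev b = c}"
        by (intro real_vector.span_sum real_vector.span_scale real_vector.span_base)
      finally show "v \<in> span {b\<in>B. ev b = c}" .
    qed
  qed
  have dimE: "dim {v. M *v v = c *s v} = card {b\<in>B. ev b = c}" for c
    unfolding eig using B(2) real_vector.independent_mono[of B "{b\<in>B. ev b = c}"]
      real_vector.dim_span_eq_card_independent by blast
  have spec: "{c. c < 0 \<and> (\<exists>v. v \<noteq> 0 \<and> M *v v = c *s v)} = ev ` {b\<in>B. ev b < 0}"
  proof
    show "ev ` {b\<in>B. ev b < 0} \<subseteq> {c. c < 0 \<and> (\<exists>v. v \<noteq> 0 \<and> M *v v = c *s v)}"
      using ev nz by blast
    show "{c. c < 0 \<and> (\<exists>v. v \<noteq> 0 \<and> M *v v = c *s v)} \<subseteq> ev ` {b\<in>B. ev b < 0}"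
    proof clarify
      fix c v assume c: "c < 0" "v \<noteq> 0" "M *v v = c *s v"
      have "v \<in> span {b\<in>B. ev b = c}" using c(3) eig by blast
      then have "{b\<in>B. ev b = c} \<noteq> {}" using c(2) by (metis real_vector.span_empty singletonD)
      then show "c \<in> ev ` {b\<in>B. ev b < 0}" using c(1) by blast
    qed
  qed
  have "neg_ind M = (\<Sum>c\<in>ev ` {b\<in>B. ev b < 0}. card {b\<in>B. ev b = c})"
    unfolding neg_ind_def spec dimE ..
  also have "\<dots> = (\<Sum>c\<in>ev ` {b\<in>B. ev b < 0}. \<Sum>b\<in>{b\<in>{b\<in>B. ev b < 0}. ev b = c}. 1)"
  proof (intro sum.cong refl)
    fix c assume "c \<in> ev ` {b\<in>B. ev b < 0}"
    then have "{b\<in>{b\<in>B. ev b < 0}. ev b = c} = {b\<in>B. ev b = c}" by auto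
    then show "card {b\<in>B. ev b = c} = (\<Sum>b\<in>{b\<in>{b\<in>B. ev b < 0}. ev b = c}. 1)" by simp
  qed
  also have "\<dots> = (\<Sum>b\<in>{b\<in>B. ev b < 0}. 1)"
    by (rule sum.image_gen[symmetric]) (use B(1) in simp)
  also have "\<dots> = card {b\<in>B. 0 < ?\<Phi> b b}"
  proof -
    have "ev b < 0 \<longleftrightarrow> 0 < ?\<Phi> b b" if "b \<in> B" for b
      unfolding val[OF that] using nz[OF that] inner_ge_zero[of b] by (auto simp: mult_less_0_iff simp del: inner_ge_zero)
    then have "{b\<in>B. ev b < 0} = {b\<in>B. 0 < ?\<Phi> b b}" by blast
    then show ?thesis by simp
  qed
  finally show ?thesis using orthogonal_basis_indices(1)[OF \<Phi> ob] by simp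
qed

lemma orthogonal_projection_matrix:
  assumes "subspace (S :: (real^'n) set)"
  shows "\<exists>P. (\<forall>x. P *v x \<in> S) \<and> (\<forall>x\<in>S. P *v x = x) \<and> transpose P = P"
proof -
  obtain B where B: "B \<subseteq> S" "pairwise orthogonal B" "\<And>x. x \<in> B \<Longrightarrow> norm x = 1"
      "independent B" "span B = S"
    using orthonormal_basis_subspace[OF assms] by metis
  have fB: "finite B" using B(4) independent_imp_finite by blast
  have on: "b \<bullet> c = (if b = c then 1 else 0)" if "b \<in> B" "c \<in> B" for b c
    using B(2,3) that unfolding pairwise_def orthogonal_def by (auto simp: norm_eq_1)
  define p where "p x = (\<Sum>b\<in>B. (b \<bullet> x) *\<^sub>R b)" for x
  have lp: "linear p"
    unfolding p_def
    by (intro linearI) (simp_all add: inner_add_right scaleR_left_distrib sum.distrib scaleR_sum_right)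
  have pS: "p x \<in> S" for x
    unfolding p_def using B(1) assms by (intro subspace_sum subspace_scale) auto
  have idem: "p x = x" if x: "x \<in> S" for x
  proof -
    obtain u where u: "x = (\<Sum>b\<in>B. u b *\<^sub>R b)"
      using x real_vector.span_finite[OF fB] B(5) by auto
    have "b \<bullet> x = u b" if b: "b \<in> B" for b
    proof -
      have "b \<bullet> x = (\<Sum>c\<in>B. if c = b then u b else 0)"
        unfolding u inner_sum_right by (intro sum.cong) (use on b in auto)
      then show ?thesis using b fB by simp
    qed
    then show ?thesis unfolding p_def by (simp add: u[symmetric])
  qed
  have mp: "matrix p *v x = p x" for x using matrix_works[of p] lp by simp
  have "transpose (matrix p) = matrix p"
    unfolding symmetric_matrix_iff mp p_def
    by (simp add: inner_sum_left inner_sum_right inner_commute mult_ac)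
  then show ?thesis using pS idem mp by (intro exI[of _ "matrix p"]) simp
qed

text \<open>The inverse is composed of the orthogonal projection onto the range of \<open>A\<close> and the inverse of
  the bijection that \<open>A\<close> induces from the orthogonal complement of its kernel to its range.\<close>

lemma moore_penrose_exists:
  fixes A :: "real^'q^'p"
  shows "\<exists>G. is_moore_penrose A G"
proof -
  let ?R = "range ((*v) A)" and ?V = "{x. \<forall>y. A *v y = 0 \<longrightarrow> x \<bullet> y = 0}"
  have R: "subspace ?R" by (rule real_vector.linear_subspace_image) auto
  have V: "subspace ?V" by (auto simp: subspace_def inner_add_left)
  obtain P where P: "\<And>x. P *v x \<in> ?R" "\<And>x. x \<in> ?R \<Longrightarrow> P *v x = x" "transpose P = P"
    using orthogonal_projection_matrix[OF R] by blast
  obtain Q where Q: "\<And>x. Q *v x \<in> ?V" "\<And>x. x \<in> ?V \<Longrightarrow> Q *v x = x" "transpose Q = Q"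
    using orthogonal_projection_matrix[OF V] by blast
  have AQ: "A *v (Q *v x) = A *v x" for x
  proof -
    \<comment> \<open>\<open>x - Q x\<close> is orthogonal to the row space, hence in the kernel\<close>
    have o: "(x - Q *v x) \<bullet> v = 0" if "v \<in> ?V" for v
      using Q(2)[OF that] Q(3) unfolding symmetric_matrix_iff inner_diff_left by (metis diff_self)
    have "transpose A *v z \<in> ?V" for z
      by (auto simp: transpose_matrix_vector dot_lmul_matrix)
    then have "(x - Q *v x) \<bullet> (transpose A *v z) = 0" for z using o by blast
    then have "z \<bullet> (A *v (x - Q *v x)) = 0" for z
      by (metis dot_lmul_matrix inner_commute transpose_matrix_vector)
    then have "A *v (x - Q *v x) = 0" by (metis inner_eq_zero_iff)
    then show ?thesis by (simp add: matrix_vector_mult_diff_distrib)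
  qed
  have inj: "inj_on ((*v) A) ?V"
    unfolding real_vector.linear_inj_on_iff_eq_0[OF matrix_vector_mul_linear V] by auto
  obtain g where g: "range g \<subseteq> ?V" "linear g" "\<And>v. v \<in> ?V \<Longrightarrow> g (A *v v) = v"
    using real_vector.linear_exists_left_inverse_on[OF matrix_vector_mul_linear V inj] by blast
  define G where "G = matrix g ** P"
  have G: "G *v y = g (P *v y)" for y
    using matrix_works[of g] g(2) by (simp add: G_def matrix_vector_mul_assoc[symmetric])
  have GA: "G ** A = Q"
  proof -
    have "(G ** A) *v x = Q *v x" for x
      using g(3)[OF Q(1)[of x]] P(2)[of "A *v x"]
      by (simp add: matrix_vector_mul_assoc[symmetric] G AQ)
    then show ?thesis by (simp add: matrix_eq)
  qed
  have AG: "A ** G = P"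
  proof -
    have "(A ** G) *v y = P *v y" for y
    proof -
      obtain x where x: "P *v y = A *v x" using P(1)[of y] by auto
      then have "P *v y = A *v (Q *v x)" by (simp add: AQ)
      then show ?thesis
        using g(3)[OF Q(1)[of x]] by (simp add: matrix_vector_mul_assoc[symmetric] G)
    qed
    then show ?thesis by (simp add: matrix_eq)
  qed
  have "A ** G ** A = A"
    unfolding AG matrix_eq using P(2) by (simp add: matrix_vector_mul_assoc[symmetric])
  moreover have "G ** A ** G = G"
    unfolding GA matrix_eq
    by (auto simp: matrix_vector_mul_assoc[symmetric] G simp del: mem_Collect_eq intro!: Q(2)[OF range_subsetD[OF g(1)]])
  ultimately have "is_moore_penrose A G"
    unfolding is_moore_penrose_def using AG GA P(3) Q(3) by simp
  then show ?thesis ..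
qed

lemma moore_penrose_unique:
  assumes G: "is_moore_penrose A G" and H: "is_moore_penrose A H"
  shows "G = H"
proof -
  have t: "transpose (A ** G) = A ** G" "transpose (G ** A) = G ** A"
    "transpose (A ** H) = A ** H" "transpose (H ** A) = H ** A"
    and e: "A ** G ** A = A" "G ** A ** G = G" "A ** H ** A = A" "H ** A ** H = H"
    using G H unfolding is_moore_penrose_def by auto
  have "A ** G = transpose (A ** H ** (A ** G))"
    using t(1) e(3) by (simp add: matrix_mul_assoc)
  also have "\<dots> = A ** G ** (A ** H)"
    by (simp only: matrix_transpose_mul[of "A ** H"] t)
  also have "\<dots> = A ** H" using e(1) by (simp add: matrix_mul_assoc)
  finally have AG: "A ** G = A ** H" .
  have "G ** A = transpose (G ** A ** (H ** A))"
    using t(2) e(3) by (metis matrix_mul_assoc)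
  also have "\<dots> = H ** A ** (G ** A)"
    by (simp only: matrix_transpose_mul[of "G ** A"] t)
  also have "\<dots> = H ** A" using e(1) by (metis matrix_mul_assoc)
  finally have GA: "G ** A = H ** A" .
  have "G = G ** A ** G" using e by simp
  also have "\<dots> = H ** (A ** G)" by (simp add: GA matrix_mul_assoc)
  also have "\<dots> = H" by (simp add: AG matrix_mul_assoc e)
  finally show ?thesis .
qed

lemma moore_penrose_correct: "is_moore_penrose A (moore_penrose A)"
proof -
  obtain G where "is_moore_penrose A G" using moore_penrose_exists by blast
  then show ?thesis
    unfolding moore_penrose_def by (rule theI) (metis moore_penrose_unique \<open>is_moore_penrose A G\<close>)
qed

lemma rank_plus_nullity: "rank A + dim {x. A *v x = 0} = CARD('q)" for A :: "real^'q^'p"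
  using rank_nullity_fin[OF matrix_vector_mul_linear subspace_UNIV fin_dim_euclidean, of A]
  by (simp add: rank_dim_range)

text \<open>The rank becomes an index, so that the semicontinuity and monotonicity of indices apply to it.\<close>

lemma rank_nonneg_matrix:
  fixes P :: "real^'n^'n"
  assumes P: "transpose P = P" "\<And>x. 0 \<le> x \<bullet> (P *v x)"
  shows "rank P = pos_index (\<lambda>x y. x \<bullet> (P *v y)) UNIV"
proof -
  let ?\<Phi> = "\<lambda>x y. x \<bullet> (P *v y)"
  have "{p \<in> UNIV. \<forall>k\<in>UNIV. k \<bullet> (P *v p) = 0} = {x. P *v x = 0}"
    by auto (metis inner_eq_zero_iff)
  moreover have "nonneg_index ?\<Phi> UNIV = CARD('n)"
    using nonneg_index_eq_dim[OF fin_dim_euclidean subspace_UNIV, of ?\<Phi>] P(2) by simp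
  ultimately show ?thesis
    using nonneg_index_eq_pos_plus_null[OF sym_bilinear_matrix[OF P(1)] subspace_UNIV fin_dim_euclidean]
      rank_plus_nullity[of P] by simp
qed

section \<open>The comparative index as an inertia\<close>

definition upper_vec :: "real^('p::finite + 'r::finite) \<Rightarrow> real^'p" where
  "upper_vec y = (\<chi> i. y $ Inl i)"

definition lower_vec :: "real^('p::finite + 'r::finite) \<Rightarrow> real^'r" where
  "lower_vec y = (\<chi> i. y $ Inr i)"

lemma vstack_upper_lower [simp]: "vstack (upper_vec y) (lower_vec y) = y"
  by (simp add: vstack_def upper_vec_def lower_vec_def vec_eq_iff split: sum.split)

lemma upper_lower_vstack [simp]: "upper_vec (vstack x u) = x" "lower_vec (vstack x u) = u"
  by (simp_all add: vstack_def upper_vec_def lower_vec_def vec_eq_iff)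

lemma inner_vstack: "vstack x u \<bullet> vstack x' u' = x \<bullet> x' + u \<bullet> u'"
  by (simp add: inner_vec_def sum_UNIV_sum vstack_def)

lemma vstack_linear:
  "vstack (x + x') (u + u') = vstack x u + vstack x' u'"
  "vstack (c *\<^sub>R x) (c *\<^sub>R u) = c *\<^sub>R vstack x u"
  "vstack 0 0 = 0"
  by (simp_all add: vstack_def vec_eq_iff split: sum.split)

lemma vstack_eq_0_iff: "vstack x u = 0 \<longleftrightarrow> x = 0 \<and> u = 0"
  by (metis vstack_linear(3) vstack_eq_iff)

lemma linear_upper_vec: "linear upper_vec" and linear_lower_vec: "linear lower_vec"
  by (intro linearI; simp add: upper_vec_def lower_vec_def vec_eq_iff)+

lemma upper_mult_vec: "upper Y *v c = upper_vec (Y *v c)"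
  by (simp add: upper_def upper_vec_def matrix_vector_mult_def vec_eq_iff)

lemma stack_mult_vec: "stack X U *v c = vstack (X *v c) (U *v c)"
  by (simp add: stack_def vstack_def matrix_vector_mult_def vec_eq_iff split: sum.split)

lemma block_mat_of_blocks: "block_mat (upper_left S) (upper_right S) (lower_left S) (lower_right S) = S"
  by (simp add: block_mat_def upper_left_def upper_right_def lower_left_def lower_right_def
      vec_eq_iff split: sum.split)

lemma neg_mat_mult_vec: "(- mat 1) *v x = - (x :: real^'n)"
  using matrix_vector_mult_diff_rdistrib[of 0 "mat 1" x] by simp

lemma block_mat_mult_vec:
  "block_mat P Q R T *v c
    = vstack (P *v upper_vec c + Q *v lower_vec c) (R *v upper_vec c + T *v lower_vec c)"
  using block_mat_mult_vstack[of P Q R T "upper_vec c" "lower_vec c"] by simp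

lemma graph_mat_mult_vec:
  "graph_mat S *v c = vstack (vstack (upper_vec c) (upper_vec (S *v c)))
                             (vstack (- lower_vec c) (lower_vec (S *v c)))"
  using block_mat_mult_vec[of "upper_left S" "upper_right S" "lower_left S" "lower_right S" c]
  by (simp add: graph_mat_def stack_mult_vec neg_mat_mult_vec block_mat_mult_vec block_mat_of_blocks)

lemma sympl_J_mult_vec: "sympl_J *v vstack x u = vstack u (- x)"
  by (simp add: sympl_J_def block_mat_mult_vstack neg_mat_mult_vec)

text \<open>The symplectic form of \<open>Y d\<close> and \<open>Y' c\<close>; for the graphs of transition matrices it becomes a
  difference of two actions.\<close>

lemma wronskian_form:
  "c \<bullet> (transpose (wronskian Y Y') *v d)
    = lower_vec (Y' *v c) \<bullet> upper_vec (Y *v d) - upper_vec (Y' *v c) \<bullet> lower_vec (Y *v d)"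
proof -
  have "c \<bullet> (transpose (wronskian Y Y') *v d) = (wronskian Y Y' *v c) \<bullet> d"
    by (metis dot_lmul_matrix inner_commute transpose_matrix_vector)
  also have "\<dots> = (transpose Y *v (sympl_J *v (Y' *v c))) \<bullet> d"
    by (simp add: wronskian_def matrix_vector_mul_assoc matrix_mul_assoc)
  also have "\<dots> = (sympl_J *v (Y' *v c)) \<bullet> (Y *v d)"
    by (metis dot_lmul_matrix transpose_matrix_vector)
  also have "\<dots> = (sympl_J *v vstack (upper_vec (Y' *v c)) (lower_vec (Y' *v c)))
      \<bullet> vstack (upper_vec (Y *v d)) (lower_vec (Y *v d))" by simp
  finally show ?thesis unfolding sympl_J_mult_vec inner_vstack by simp
qed

text \<open>The comparative index without generalized inverses. The kernel of \<open>M\<close> consists of the \<open>c\<close> that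
  belong to some pair in \<open>\<K>\<close>, and \<open>X\<^sup>\<dagger> X' c\<close> is a particular choice of the partner \<open>d\<close>. Pairs \<open>(d, 0)\<close>
  are orthogonal to \<open>\<K>\<close>, so the choice is immaterial for the index. The symmetry of \<open>D\<close> comes
  from that of \<open>\<Omega>\<close>.\<close>

lemma comp_index_on_pairs:
  fixes Y Y' :: "real^'m^('m::finite + 'm)"
  defines "\<K> \<equiv> {(d, c). upper Y *v d = upper Y' *v c}"
  assumes \<Omega>: "sym_bilinear \<Omega>"
    and val: "\<And>p q. p \<in> \<K> \<Longrightarrow> q \<in> \<K> \<Longrightarrow>
      \<Omega> p q = snd p \<bullet> (transpose (wronskian Y Y') *v fst q)"
  shows "comp_index Y Y' + dim \<K>
    = CARD('m) + dim {d. upper Y *v d = 0} + pos_index (\<lambda>p q. - \<Omega> p q) \<K>"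
proof -
  note bl = sym_bilinearD[OF \<Omega>]
  define X X' G M T D where "X = upper Y" and "X' = upper Y'" and "G = moore_penrose X"
    and "M = (mat 1 - X ** G) ** X'" and "T = mat 1 - moore_penrose M ** M"
    and "D = T ** transpose (wronskian Y Y') ** G ** X' ** T"
  have ci: "comp_index Y Y' = rank M + neg_ind D"
    unfolding comp_index_def Let_def X_def X'_def G_def M_def T_def D_def ..
  have G: "X ** G ** X = X" using moore_penrose_correct[of X] unfolding is_moore_penrose_def G_def by blast
  have "M ** moore_penrose M ** M = M" "transpose (moore_penrose M ** M) = moore_penrose M ** M"
    using moore_penrose_correct[of M] unfolding is_moore_penrose_def by blast+
  then have MT: "M *v (T *v x) = 0" and Tsym: "transpose T = T" for x
    unfolding T_def
    by (simp_all add: matrix_vector_mult_diff_rdistrib matrix_vector_mult_diff_distrib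
        matrix_vector_mul_assoc matrix_mul_assoc) (simp add: transpose_def vec_eq_iff mat_def; metis)
  have TM: "T *v x = x" if "M *v x = 0" for x
    using that unfolding T_def
    by (simp add: matrix_vector_mult_diff_rdistrib matrix_vector_mul_assoc[symmetric])
  have Mv: "M *v c = X' *v c - X *v (G *v (X' *v c))" for c
    unfolding M_def by (simp add: matrix_vector_mult_diff_rdistrib matrix_vector_mul_assoc[symmetric])
  have part: "(G *v (X' *v c), c) \<in> \<K>" if "M *v c = 0" for c
    using that unfolding Mv \<K>_def X_def X'_def by auto
  have kerM: "M *v c = 0 \<longleftrightarrow> (\<exists>d. (d, c) \<in> \<K>)" for c
  proof
    assume "M *v c = 0"
    then show "\<exists>d. (d, c) \<in> \<K>" using part by blast
  next
    assume "\<exists>d. (d, c) \<in> \<K>"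
    then obtain d where "(d, c) \<in> \<K>" by blast
    then have d: "X' *v c = X *v d" unfolding \<K>_def X_def X'_def by simp
    have "X *v (G *v (X *v d)) = X *v d" using G by (simp add: matrix_vector_mul_assoc matrix_mul_assoc)
    then show "M *v c = 0" unfolding Mv d by simp
  qed
  define g where "g c = (G *v (X' *v c), c)" for c
  have g: "linear g" unfolding g_def
    by (intro linearI) (simp_all add: matrix_vector_right_distrib matrix_vector_mult_scaleR)
  have \<K>: "subspace \<K>"
    unfolding \<K>_def by (auto simp: subspace_def zero_prod_def matrix_vector_right_distrib matrix_vector_mult_scaleR)
  have sndK: "snd ` \<K> = {c. M *v c = 0}" using kerM by force
  have kersnd: "{p \<in> \<K>. snd p = 0} = (\<lambda>d. (d, 0)) ` {d. X *v d = 0}"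
    unfolding \<K>_def X_def by force
  have X0: "subspace {d. X *v d = 0}"
    by (auto simp: subspace_def matrix_vector_right_distrib matrix_vector_mult_scaleR)
  have "dim \<K> = dim {c. M *v c = 0} + dim {p \<in> \<K>. snd p = 0}"
    using rank_nullity_fin[OF linear_snd \<K> fin_dim_euclidean] unfolding sndK .
  also have "dim {p \<in> \<K>. snd p = 0} = dim {d. X *v d = 0}"
    unfolding kersnd
    by (rule dim_image_inj_on[OF _ X0 fin_dim_euclidean]) (auto intro!: linearI inj_onI)
  finally have dimK: "dim \<K> = dim {c. M *v c = 0} + dim {d. X *v d = 0}" .
  have Dval: "x \<bullet> (D *v y) = \<Omega> (g (T *v x)) (g (T *v y))" for x y
  proof -
    have "x \<bullet> (D *v y) = (T *v x) \<bullet> (transpose (wronskian Y Y') *v (G *v (X' *v (T *v y))))"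
      unfolding D_def using Tsym unfolding symmetric_matrix_iff
      by (simp add: matrix_vector_mul_assoc[symmetric])
    then show ?thesis
      using val[OF part[OF MT[of x]] part[OF MT[of y]]] unfolding g_def by simp
  qed
  have Dsym: "transpose D = D"
    unfolding symmetric_matrix_iff using Dval bl(1) by (metis inner_commute)
  have "neg_ind D = pos_index (\<lambda>x y. - (x \<bullet> (D *v y))) UNIV"
    by (rule neg_ind_eq_pos_index[OF Dsym])
  also have "\<dots> = pos_index (\<lambda>p q. - \<Omega> p q) ((\<lambda>x. g (T *v x)) ` UNIV)"
    by (rule pos_index_image)
      (auto simp: Dval bl fin_dim_euclidean intro!: linear_compose[OF _ g, unfolded o_def])
  also have "(\<lambda>x. g (T *v x)) ` UNIV = (\<lambda>p. g (snd p)) ` \<K>"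
  proof -
    have "range ((*v) T) = {c. M *v c = 0}" using MT TM by (auto simp: image_iff) metis
    then show ?thesis using sndK by (metis image_image)
  qed
  also have "pos_index (\<lambda>p q. - \<Omega> p q) ((\<lambda>p. g (snd p)) ` \<K>) = pos_index (\<lambda>p q. - \<Omega> p q) \<K>"
  proof (rule pos_index_image[symmetric])
    fix p assume p: "p \<in> \<K>"
    then have gp: "g (snd p) \<in> \<K>" using part kerM unfolding g_def by (metis prod.collapse)
    define e where "e = p - g (snd p)"
    have e: "e \<in> \<K>" "snd e = 0" unfolding e_def using p gp \<K> by (auto simp: subspace_diff g_def)
    have z: "\<Omega> e q = 0" if "q \<in> \<K>" for q using val[OF e(1) that] e(2) by simp
    have "p = g (snd p) + e" unfolding e_def by simp
    then have "\<Omega> p p = \<Omega> (g (snd p) + e) (g (snd p) + e)" by simp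
    also have "\<dots> = \<Omega> (g (snd p)) (g (snd p))"
      using z[OF gp] z[OF e(1)] bl(1)[of "g (snd p)" e] by (simp add: bl(2,3))
    finally show "- \<Omega> p p = - \<Omega> (g (snd p)) (g (snd p))" by simp
  qed (auto simp: bl fin_dim_euclidean \<K> intro!: linear_compose[OF linear_snd g, unfolded o_def])
  finally have "neg_ind D = pos_index (\<lambda>p q. - \<Omega> p q) \<K>" .
  then show ?thesis
    using ci dimK rank_plus_nullity[of M] unfolding X_def[symmetric] by simp
qed

section \<open>The action form on sequences\<close>

instantiation "fun" :: (type, real_vector) real_vector
begin

definition scaleR_fun :: "real \<Rightarrow> ('a \<Rightarrow> 'b) \<Rightarrow> 'a \<Rightarrow> 'b" where
  "scaleR_fun c f = (\<lambda>x. c *\<^sub>R f x)"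

instance
  by standard (simp_all add: scaleR_fun_def fun_eq_iff scaleR_add_right scaleR_add_left)

end

lemma scaleR_fun_apply [simp]: "(c *\<^sub>R f) x = c *\<^sub>R f x"
  by (simp add: scaleR_fun_def)

lemma fin_dim_supported:
  "subspace {f :: nat \<Rightarrow> 'b::euclidean_space. \<forall>k\<ge>m. f k = 0} \<and>
   fin_dim {f :: nat \<Rightarrow> 'b. \<forall>k\<ge>m. f k = 0}"
proof (induction m)
  case 0
  have "{f :: nat \<Rightarrow> 'b. \<forall>k\<ge>0. f k = 0} = {0}" by (auto simp: fun_eq_iff)
  moreover have "fin_dim {0 :: nat \<Rightarrow> 'b}"
    unfolding fin_dim_def by (rule exI[of _ "{}"]) simp
  ultimately show ?case using real_vector.subspace_single_0 by simp
next
  case (Suc m)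
  let ?S = "{f :: nat \<Rightarrow> 'b. \<forall>k\<ge>Suc m. f k = 0}"
  have S: "subspace ?S" by (auto simp: subspace_def)
  have "{f \<in> ?S. f m = 0} = {f. \<forall>k\<ge>m. f k = 0}"
    by (auto simp: Suc_le_eq) (metis le_neq_implies_less)
  then have "fin_dim {f \<in> ?S. f m = 0}" using Suc by simp
  moreover have "linear (\<lambda>f :: nat \<Rightarrow> 'b. f m)" by (rule linearI) auto
  ultimately have "fin_dim ?S"
    using fin_dim_by_kernel[of "\<lambda>f. f m" ?S] S fin_dim_euclidean by blast
  then show ?case using S by blast
qed

type_synonym 'n trajectory = "(nat \<Rightarrow> real^'n) \<times> (nat \<Rightarrow> real^'n)"

text \<open>The values outside the relevant range are set to \<open>0\<close>: there are states \<open>x\<^sub>0, \<dots>, x\<^bsub>N+1\<^esub>\<close> but only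
  momenta \<open>u\<^sub>0, \<dots>, u\<^sub>N\<close>, because \<open>u\<^bsub>N+1\<^esub>\<close> does not enter the action.\<close>

definition trajectories :: "nat \<Rightarrow> 'n::finite trajectory set" where
  "trajectories N = {w. (\<forall>k\<ge>N + 2. fst w k = 0) \<and> (\<forall>k\<ge>N + 1. snd w k = 0)}"

definition boundary :: "nat \<Rightarrow> 'n::finite trajectory \<Rightarrow> real^('n + 'n)" where
  "boundary N w = vstack (fst w 0) (fst w (N + 1))"

definition dirichlet :: "nat \<Rightarrow> 'n::finite trajectory set" where
  "dirichlet N = {w \<in> trajectories N. boundary N w = 0}"

text \<open>The pair \<open>(x\<^bsub>k+1\<^esub>, u\<^sub>k)\<close> is the argument of the \<open>k\<close>th Hamiltonian.\<close>

definition mixed :: "'n::finite trajectory \<Rightarrow> nat \<Rightarrow> real^('n + 'n)" where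
  "mixed w k = vstack (fst w (Suc k)) (snd w k)"

text \<open>The polarization of twice the discrete action.\<close>

definition action ::
  "(nat \<Rightarrow> real^('n::finite + 'n)^('n + 'n)) \<Rightarrow> nat \<Rightarrow> 'n trajectory \<Rightarrow> 'n trajectory \<Rightarrow> real" where
  "action H N w v = (\<Sum>k\<le>N. snd w k \<bullet> (fst v (Suc k) - fst v k) + snd v k \<bullet> (fst w (Suc k) - fst w k)
     - mixed w k \<bullet> (H k *v mixed v k))"

lemma trajectories_subspace: "subspace (trajectories N)"
  and trajectories_fin_dim: "fin_dim (trajectories N)"
proof -
  have eq: "trajectories N = {f. \<forall>k\<ge>N + 2. f k = 0} \<times> {f. \<forall>k\<ge>N + 1. f k = 0}"
    unfolding trajectories_def by auto
  show "subspace (trajectories N)" "fin_dim (trajectories N)"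
    unfolding eq using fin_dim_supported by (blast intro: subspace_Times fin_dim_Times)+
qed

lemma linear_boundary: "linear (boundary N)"
  unfolding boundary_def by (intro linearI) (simp_all add: vstack_linear[symmetric])

lemma linear_mixed: "linear (\<lambda>w. mixed w k)"
  unfolding mixed_def by (intro linearI) (simp_all add: vstack_linear[symmetric])

lemma dirichlet_subspace: "subspace (dirichlet N)"
  unfolding dirichlet_def by (rule subspace_kernel[OF linear_boundary trajectories_subspace])

lemma dirichlet_fin_dim: "fin_dim (dirichlet N)"
  using trajectories_fin_dim by (rule fin_dim_mono) (auto simp: dirichlet_def)

lemma dim_trajectories:
  "dim (trajectories N :: 'n::finite trajectory set) = CARD('n + 'n) + dim (dirichlet N :: 'n trajectory set)"
proof -
  have "boundary N ` trajectories N = (UNIV :: (real^('n + 'n)) set)"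
  proof (intro equalityI subsetI)
    fix q :: "real^('n + 'n)"
    let ?w = "(\<lambda>k. if k = 0 then upper_vec q else if k = N + 1 then lower_vec q else 0, \<lambda>k. 0)"
    have "?w \<in> trajectories N" "q = boundary N ?w"
      by (auto simp: trajectories_def boundary_def)
    then show "q \<in> boundary N ` trajectories N" by (intro image_eqI)
  qed simp
  then have "dim (boundary N ` trajectories N :: (real^('n + 'n)) set) = CARD('n + 'n)" by simp
  moreover have "dim (trajectories N :: 'n trajectory set)
      = dim (boundary N ` trajectories N :: (real^('n + 'n)) set) + dim (dirichlet N :: 'n trajectory set)"
    unfolding dirichlet_def
    by (rule rank_nullity_fin[OF linear_boundary trajectories_subspace trajectories_fin_dim])
  ultimately show ?thesis by simp
qed

lemma action_sym_bilinear:
  fixes H :: "nat \<Rightarrow> real^('n::finite + 'n)^('n + 'n)"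
  assumes "\<And>k. k \<le> N \<Longrightarrow> transpose (H k) = H k"
  shows "sym_bilinear (action H N)"
  unfolding sym_bilinear_def
proof (intro conjI allI)
  fix w v :: "'n trajectory"
  have "mixed w k \<bullet> (H k *v mixed v k) = mixed v k \<bullet> (H k *v mixed w k)" if "k \<le> N" for k
    using assms[OF that] unfolding symmetric_matrix_iff by (metis inner_commute)
  then show "action H N w v = action H N v w"
    unfolding action_def by (intro sum.cong refl) simp
  show "linear (\<lambda>w. action H N w v)"
    unfolding action_def
    by (intro linear_compose_sum ballI linearI)
      (simp_all add: linear_add[OF linear_mixed] linear_scale[OF linear_mixed]
        inner_add_left inner_add_right algebra_simps)
qed

lemma action_diff:
  assumes "\<And>j. j \<le> N \<Longrightarrow> j \<noteq> k \<Longrightarrow> H j = H' j" and "k \<le> N"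
  shows "action H' N w v - action H N w v = mixed w k \<bullet> ((H k - H' k) *v mixed v k)"
proof -
  have "action H' N w v - action H N w v
      = (\<Sum>j\<le>N. mixed w j \<bullet> ((H j - H' j) *v mixed v j))"
    unfolding action_def sum_subtractf[symmetric]
    by (intro sum.cong refl) (simp add: matrix_vector_mult_diff_rdistrib inner_diff_right)
  also have "\<dots> = (\<Sum>j\<le>N. if j = k then mixed w k \<bullet> ((H k - H' k) *v mixed v k) else 0)"
    by (intro sum.cong refl) (use assms(1) in auto)
  also have "\<dots> = mixed w k \<bullet> ((H k - H' k) *v mixed v k)" using assms(2) by simp
  finally show ?thesis .
qed

section \<open>Discrete Hamiltonian systems\<close>

locale hamiltonian_system =
  fixes N :: nat
    and A B C :: "nat \<Rightarrow> real^'n::finite^'n"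
    and Z :: "nat \<Rightarrow> real^('n + 'n)^('n + 'n)"
  assumes det_nz: "\<And>k. k \<le> N \<Longrightarrow> det (mat 1 - A k) \<noteq> 0"
    and ham_sym: "\<And>k. k \<le> N \<Longrightarrow>
      transpose (hamiltonian (A k) (B k) (C k)) = hamiltonian (A k) (B k) (C k)"
    and fund: "fundamental_solution N (\<lambda>k. coeff_mat (A k) (B k) (C k)) 0 Z"
begin

abbreviation "H k \<equiv> hamiltonian (A k) (B k) (C k)"

abbreviation "F \<equiv> action H N"

lemma F_bilinear: "sym_bilinear F"
  by (rule action_sym_bilinear[OF ham_sym])

lemma step_iff:
  assumes "k \<le> N"
  shows "hamiltonian_step (A k) (B k) (C k) x u x' u'
     \<longleftrightarrow> vstack x' u' = coeff_mat (A k) (B k) (C k) *v vstack x u"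
  by (rule hamiltonian_step_iff_coeff_mat[OF det_nz[OF assms]])

text \<open>The amounts by which a trajectory violates the two equations of the system at time \<open>k\<close>.\<close>

definition residual_x :: "'n trajectory \<Rightarrow> nat \<Rightarrow> real^'n" where
  "residual_x w k = fst w (Suc k) - fst w k - (A k *v fst w (Suc k) + B k *v snd w k)"

definition residual_u :: "'n trajectory \<Rightarrow> nat \<Rightarrow> real^'n" where
  "residual_u w k = snd w k - snd w (Suc k) + (C k *v fst w (Suc k) - transpose (A k) *v snd w k)"

lemma step_iff_residuals:
  "hamiltonian_step (A k) (B k) (C k) (fst w k) (snd w k) (fst w (Suc k)) (snd w (Suc k))
    \<longleftrightarrow> residual_x w k = 0 \<and> residual_u w k = 0"
  unfolding hamiltonian_step_def residual_x_def residual_u_def by (auto simp: algebra_simps)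

text \<open>Summation by parts exhibits the action as the weak form of the system; the boundary terms are
  those of the symplectic form. The terms with \<open>u\<^bsub>N+1\<^esub>\<close> cancel, so the
  formula can be applied to a solution together with its momentum at time \<open>N + 1\<close>.\<close>

lemma action_by_parts:
  "F w v = (\<Sum>k\<le>N. snd v k \<bullet> residual_x w k + fst v (Suc k) \<bullet> residual_u w k)
     + snd w (Suc N) \<bullet> fst v (Suc N) - snd w 0 \<bullet> fst v 0"
proof -
  have "F w v = F v w" by (rule sym_bilinearD(1)[OF F_bilinear])
  also have "\<dots> = (\<Sum>k\<le>N. snd v k \<bullet> residual_x w k + fst v (Suc k) \<bullet> residual_u w k
      + (snd w (Suc k) \<bullet> fst v (Suc k) - snd w k \<bullet> fst v k))"
    unfolding action_def
  proof (intro sum.cong refl)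
    fix k
    have m: "mixed v k \<bullet> (H k *v mixed w k)
        = fst v (Suc k) \<bullet> (transpose (A k) *v snd w k - C k *v fst w (Suc k))
          + snd v k \<bullet> (A k *v fst w (Suc k) + B k *v snd w k)"
      using matrix_vector_mult_diff_rdistrib[of 0 "C k" "fst w (Suc k)"]
      unfolding hamiltonian_def mixed_def block_mat_mult_vstack inner_vstack by simp
    show "snd v k \<bullet> (fst w (Suc k) - fst w k) + snd w k \<bullet> (fst v (Suc k) - fst v k)
        - mixed v k \<bullet> (H k *v mixed w k)
      = snd v k \<bullet> residual_x w k + fst v (Suc k) \<bullet> residual_u w k
        + (snd w (Suc k) \<bullet> fst v (Suc k) - snd w k \<bullet> fst v k)"
      unfolding m residual_x_def residual_u_def
      by (simp add: inner_diff_right inner_add_right inner_commute algebra_simps)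
  qed
  also have "\<dots> = (\<Sum>k\<le>N. snd v k \<bullet> residual_x w k + fst v (Suc k) \<bullet> residual_u w k)
      + (\<Sum>k\<le>N. snd w (Suc k) \<bullet> fst v (Suc k) - snd w k \<bullet> fst v k)"
    by (rule sum.distrib)
  also have "(\<Sum>k\<le>N. snd w (Suc k) \<bullet> fst v (Suc k) - snd w k \<bullet> fst v k)
      = snd w (Suc N) \<bullet> fst v (Suc N) - snd w 0 \<bullet> fst v 0"
    by (induction N) simp_all
  finally show ?thesis by simp
qed

lemma action_test_u:
  assumes "k \<le> N"
  shows "F w (0, \<lambda>i. if i = k then b else 0) = b \<bullet> residual_x w k"
proof -
  have "(\<Sum>i\<le>N. (if i = k then b else 0) \<bullet> residual_x w i)
      = (\<Sum>i\<le>N. if i = k then b \<bullet> residual_x w k else 0)"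
    by (intro sum.cong refl) auto
  then show ?thesis using assms by (simp add: action_by_parts)
qed

lemma action_test_x:
  assumes "w \<in> trajectories N" "k \<le> N"
  shows "F w (\<lambda>i. if i = Suc k then a else 0, 0) = a \<bullet> residual_u w k"
proof -
  have "(\<Sum>i\<le>N. (if i = k then a else 0) \<bullet> residual_u w i)
      = (\<Sum>i\<le>N. if i = k then a \<bullet> residual_u w k else 0)"
    by (intro sum.cong refl) auto
  then show ?thesis using assms by (simp add: action_by_parts trajectories_def)
qed

lemma action_test_x0:
  assumes "w \<in> trajectories N"
  shows "F w (\<lambda>i. if i = 0 then a else 0, 0) = - (snd w 0 \<bullet> a)"
  using assms by (simp add: action_by_parts trajectories_def)

text \<open>The last momentum is cut off in order to obtain an element of \<open>trajectories N\<close>.\<close>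

definition solution :: "real^('n + 'n) \<Rightarrow> 'n trajectory" where
  "solution c = (\<lambda>k. if k \<le> N + 1 then upper_vec (Z k *v c) else 0,
                 \<lambda>k. if k \<le> N then lower_vec (Z k *v c) else 0)"

lemma Z_0: "Z 0 = mat 1" and Z_Suc: "k \<le> N \<Longrightarrow> Z (Suc k) = coeff_mat (A k) (B k) (C k) ** Z k"
  using fund unfolding fundamental_solution_def by auto

lemma solution_trajectory: "solution c \<in> trajectories N"
  by (auto simp: solution_def trajectories_def)

lemma linear_solution: "linear solution"
  unfolding solution_def
  by (intro linearI)
    (auto simp: fun_eq_iff matrix_vector_right_distrib matrix_vector_mult_scaleR
      linear_add[OF linear_upper_vec] linear_add[OF linear_lower_vec]
      linear_scale[OF linear_upper_vec] linear_scale[OF linear_lower_vec])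

lemma boundary_solution: "boundary N (solution c) = upper (graph_mat (Z (N + 1))) *v c"
  by (simp add: boundary_def solution_def upper_mult_vec graph_mat_mult_vec Z_0)

lemma solution_inj: "inj solution"
proof (rule injI)
  fix c d assume "solution c = solution d"
  then have "fst (solution c) 0 = fst (solution d) 0" "snd (solution c) 0 = snd (solution d) 0"
    by simp_all
  then show "c = d" by (simp add: solution_def Z_0) (metis vstack_upper_lower)
qed

text \<open>A solution pairs only with the boundary values of \<open>v\<close>: the lower half of the graph matrix is the
  gradient of the action with respect to \<open>(x\<^sub>0, x\<^bsub>N+1\<^esub>)\<close>.\<close>

lemma action_solution:
  "F (solution c) v = lower_vec (graph_mat (Z (N + 1)) *v c) \<bullet> boundary N v"
proof -
  let ?y = "(\<lambda>k. upper_vec (Z k *v c), \<lambda>k. lower_vec (Z k *v c))"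
  have "F (solution c) v = F ?y v"
    unfolding action_def by (intro sum.cong refl) (simp add: solution_def mixed_def)
  also have "residual_x ?y k = 0 \<and> residual_u ?y k = 0" if "k \<le> N" for k
  proof -
    have "Z (Suc k) *v c = coeff_mat (A k) (B k) (C k) *v (Z k *v c)"
      using Z_Suc[OF that] by (simp add: matrix_vector_mul_assoc)
    then show ?thesis
      unfolding step_iff_residuals[symmetric] using step_iff[OF that] by simp
  qed
  then have "F ?y v = snd ?y (Suc N) \<bullet> fst v (Suc N) - snd ?y 0 \<bullet> fst v 0"
    unfolding action_by_parts by simp
  finally show ?thesis
    by (simp add: graph_mat_mult_vec boundary_def inner_vstack Z_0)
qed

lemma solution_critical: "v \<in> dirichlet N \<Longrightarrow> F (solution c) v = 0"
  by (simp add: action_solution dirichlet_def)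

text \<open>Testing with one coordinate at a time gives the equations of the system, except the last
  momentum equation, which would require a variation of \<open>x\<^bsub>N+1\<^esub>\<close>; there it defines the momentum at
  time \<open>N + 1\<close>.\<close>

lemma critical_is_solution:
  assumes w: "w \<in> trajectories N" and crit: "\<And>v. v \<in> dirichlet N \<Longrightarrow> F v w = 0"
  shows "w \<in> range solution"
proof -
  have crit': "F w v = 0" if "v \<in> dirichlet N" for v
    unfolding sym_bilinearD(1)[OF F_bilinear, of w] by (rule crit[OF that])
  have rx: "residual_x w k = 0" if "k \<le> N" for k
  proof -
    have "(0, \<lambda>i. if i = k then residual_x w k else 0) \<in> dirichlet N"
      using that by (auto simp: dirichlet_def trajectories_def boundary_def vstack_linear)
    from crit'[OF this] show ?thesis unfolding action_test_u[OF that] by simp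
  qed
  have ru: "residual_u w k = 0" if "k < N" for k
  proof -
    have "(\<lambda>i. if i = Suc k then residual_u w k else 0, 0) \<in> dirichlet N"
      using that by (auto simp: dirichlet_def trajectories_def boundary_def vstack_linear)
    from crit'[OF this] show ?thesis using action_test_x[OF w] that by simp
  qed
  define c where "c = vstack (fst w 0) (snd w 0)"
  have y: "vstack (fst w k) (snd w k) = Z k *v c" if "k \<le> N" for k
    using that
  proof (induction k)
    case 0
    then show ?case by (simp add: Z_0 c_def)
  next
    case (Suc k)
    then have "hamiltonian_step (A k) (B k) (C k) (fst w k) (snd w k) (fst w (Suc k)) (snd w (Suc k))"
      unfolding step_iff_residuals using rx ru by simp
    then show ?case
      using Suc step_iff[of k] Z_Suc[of k] by (simp add: matrix_vector_mul_assoc)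
  qed
  define u where "u = snd w N + (C N *v fst w (Suc N) - transpose (A N) *v snd w N)"
  have "hamiltonian_step (A N) (B N) (C N) (fst w N) (snd w N) (fst w (Suc N)) u"
    using rx[of N] unfolding hamiltonian_step_def u_def residual_x_def by (simp add: algebra_simps)
  then have "vstack (fst w (Suc N)) u = Z (Suc N) *v c"
    using step_iff[of N] y[of N] Z_Suc[of N] by (simp add: matrix_vector_mul_assoc)
  from arg_cong[OF this, of upper_vec]
  have last: "fst w (Suc N) = upper_vec (Z (Suc N) *v c)" by simp
  have "w = solution c"
  proof (rule prod_eqI)
    show "fst w = fst (solution c)"
    proof
      fix k
      consider "k \<le> N" | "k = Suc N" | "k \<ge> N + 2" by linarith
      then show "fst w k = fst (solution c) k"
      proof cases
        case 1
        then show ?thesis using arg_cong[OF y[OF 1], of upper_vec] 1 by (simp add: solution_def)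
      next
        case 2
        then show ?thesis using last by (simp add: solution_def)
      next
        case 3
        then show ?thesis using w by (simp add: solution_def trajectories_def)
      qed
    qed
    show "snd w = snd (solution c)"
    proof
      fix k
      show "snd w k = snd (solution c) k"
      proof (cases "k \<le> N")
        case True
        then show ?thesis using arg_cong[OF y[OF True], of lower_vec] True by (simp add: solution_def)
      next
        case False
        then show ?thesis using w by (simp add: solution_def trajectories_def)
      qed
    qed
  qed
  then show ?thesis by blast
qed

lemma critical_set:
  "{w \<in> trajectories N. \<forall>v\<in>dirichlet N. F v w = 0} = range solution"
proof (intro equalityI subsetI)
  fix w assume "w \<in> {w \<in> trajectories N. \<forall>v\<in>dirichlet N. F v w = 0}"
  then show "w \<in> range solution" by (intro critical_is_solution) simp_all
next
  fix w assume "w \<in> range solution"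
  then obtain c where w: "w = solution c" by blast
  have "F v w = 0" if "v \<in> dirichlet N" for v
    unfolding w sym_bilinearD(1)[OF F_bilinear, of v] by (rule solution_critical[OF that])
  then show "w \<in> {w \<in> trajectories N. \<forall>v\<in>dirichlet N. F v w = 0}"
    using solution_trajectory w by simp
qed

lemma dirichlet_kernel:
  "{w \<in> dirichlet N. \<forall>v\<in>dirichlet N. F v w = 0}
    = solution ` {d. upper (graph_mat (Z (N + 1))) *v d = 0}"
proof -
  have "{w \<in> dirichlet N. \<forall>v\<in>dirichlet N. F v w = 0} = {w \<in> range solution. boundary N w = 0}"
    unfolding critical_set[symmetric] by (auto simp: dirichlet_def)
  then show ?thesis unfolding boundary_solution[symmetric] by (auto simp: image_iff)
qed

lemma dirichlet_nullity:
  "dim {w \<in> dirichlet N. \<forall>v\<in>dirichlet N. F v w = 0}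
    = dim {d. upper (graph_mat (Z (N + 1))) *v d = 0}"
  unfolding dirichlet_kernel
  by (rule dim_image_inj_on[OF linear_solution _ fin_dim_euclidean inj_on_subset[OF solution_inj]])
    (auto simp: subspace_def matrix_vector_right_distrib matrix_vector_mult_scaleR)

text \<open>The tests leave out \<open>x\<^bsub>k+1\<^esub>\<close> and \<open>u\<^sub>k\<close>, hence only the equations of the \<open>k\<close>th step. The variation
  of \<open>x\<^sub>0\<close> gives \<open>u\<^sub>0 = 0\<close>, and zero initial values propagate forward up to time \<open>k\<close>. The variation of \<open>x\<^bsub>N+1\<^esub>\<close> acts
  as the momentum equation with \<open>u\<^bsub>N+1\<^esub> = 0\<close>, and zero final values propagate backward down to time \<open>k + 1\<close>, where
  invertibility of \<open>I - A\<^sup>T\<close> is used. This is where it matters that only one coefficient is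
  changed.\<close>

lemma cut_nondegenerate:
  assumes w: "w \<in> dirichlet N" and k: "k \<le> N"
    and orth: "\<And>v. v \<in> trajectories N \<Longrightarrow> mixed v k = 0 \<Longrightarrow> F w v = 0"
  shows "w = 0"
proof -
  have wt: "w \<in> trajectories N" and wb: "fst w 0 = 0" "fst w (Suc N) = 0"
    using w by (auto simp: dirichlet_def boundary_def vstack_eq_0_iff)
  have rx: "residual_x w j = 0" if "j \<le> N" "j \<noteq> k" for j
  proof -
    have "F w (0, \<lambda>i. if i = j then residual_x w j else 0) = 0"
      using that by (intro orth) (auto simp: trajectories_def mixed_def vstack_linear)
    then show ?thesis unfolding action_test_u[OF that(1)] by simp
  qed
  have ru: "residual_u w j = 0" if "j \<le> N" "j \<noteq> k" for j
  proof -
    have "F w (\<lambda>i. if i = Suc j then residual_u w j else 0, 0) = 0"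
      using that by (intro orth) (auto simp: trajectories_def mixed_def vstack_linear)
    then show ?thesis unfolding action_test_x[OF wt that(1)] by simp
  qed
  have "F w (\<lambda>i. if i = 0 then snd w 0 else 0, 0) = 0"
    by (intro orth) (auto simp: trajectories_def mixed_def vstack_linear)
  then have u0: "snd w 0 = 0" unfolding action_test_x0[OF wt] by simp
  have step: "hamiltonian_step (A j) (B j) (C j) (fst w j) (snd w j) (fst w (Suc j)) (snd w (Suc j))"
    if "j \<le> N" "j \<noteq> k" for j
    unfolding step_iff_residuals using rx ru that by blast
  have fwd: "fst w j = 0 \<and> snd w j = 0" if "j \<le> k" for j
    using that
  proof (induction j)
    case 0
    then show ?case using wb u0 by simp
  next
    case (Suc j)
    then have "vstack (fst w (Suc j)) (snd w (Suc j)) = 0"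
      using step[of j] step_iff[of j] k by (simp add: vstack_linear)
    then show ?case by (simp add: vstack_eq_0_iff)
  qed
  have bwd: "fst w j = 0 \<and> snd w j = 0" if "Suc k \<le> j" "j \<le> Suc N" for j
    using that(2,1)
  proof (induction j rule: inc_induct)
    case base
    then show ?case using wb wt by (simp add: trajectories_def)
  next
    case (step j)
    then have z: "fst w (Suc j) = 0" "snd w (Suc j) = 0" by auto
    have st: "hamiltonian_step (A j) (B j) (C j) (fst w j) (snd w j) 0 0"
      using \<open>\<And>j. j \<le> N \<Longrightarrow> j \<noteq> k \<Longrightarrow> hamiltonian_step (A j) (B j) (C j) (fst w j) (snd w j) (fst w (Suc j)) (snd w (Suc j))\<close>[of j]
        step z by simp
    have t: "transpose (mat 1 - A j) = mat 1 - transpose (A j)"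
      by (auto simp: transpose_def vec_eq_iff mat_def)
    have "snd w j = transpose (A j) *v snd w j"
      using st unfolding hamiltonian_step_def by (simp del: transpose_matrix_vector)
    then have "transpose (mat 1 - A j) *v snd w j = 0"
      unfolding t matrix_vector_mult_diff_rdistrib by (simp del: transpose_matrix_vector)
    moreover have "det (transpose (mat 1 - A j)) \<noteq> 0" using det_nz[of j] step by simp
    ultimately have u: "snd w j = 0"
      using matrix_left_invertible_ker[of "transpose (mat 1 - A j)"] invertible_left_inverse
        invertible_det_nz by blast
    then have "fst w j = 0" using st unfolding hamiltonian_step_def by simp
    then show ?case using u by simp
  qed
  have "fst w j = 0 \<and> snd w j = 0" for j
  proof -
    consider "j \<le> k" | "Suc k \<le> j" "j \<le> Suc N" | "j \<ge> N + 2" by linarith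
    then show ?thesis
    proof cases
      case 3
      then show ?thesis using wt by (simp add: trajectories_def)
    qed (use fwd bwd in auto)
  qed
  then show ?thesis by (intro prod_eqI) (auto simp: fun_eq_iff)
qed

end

section \<open>Changing one coefficient\<close>

lemma sym_bilinear_difference:
  assumes \<Phi>: "sym_bilinear \<Phi>" and \<Psi>: "sym_bilinear \<Psi>" and f: "linear f" and g: "linear g"
  shows "sym_bilinear (\<lambda>p q. \<Psi> (g p) (g q) - \<Phi> (f p) (f q))"
  unfolding sym_bilinear_def
proof (intro conjI allI)
  fix p q
  show "\<Psi> (g p) (g q) - \<Phi> (f p) (f q) = \<Psi> (g q) (g p) - \<Phi> (f q) (f p)"
    using sym_bilinearD(1)[OF \<Phi>, of "f p" "f q"] sym_bilinearD(1)[OF \<Psi>, of "g p" "g q"] by simp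
  show "linear (\<lambda>p. \<Psi> (g p) (g q) - \<Phi> (f p) (f q))"
    by (intro linearI) (simp_all add: linear_add[OF f] linear_add[OF g] linear_scale[OF f]
        linear_scale[OF g] sym_bilinearD[OF \<Phi>] sym_bilinearD[OF \<Psi>] algebra_simps)
qed

lemma pos_index_eq_0:
  assumes "fin_dim K" "subspace K" "\<And>x. x \<in> K \<Longrightarrow> \<Phi> x x \<le> 0"
  shows "pos_index \<Phi> K = 0"
proof -
  obtain W where W: "pos_subspace \<Phi> K W" "dim W = pos_index \<Phi> K"
    using pos_index_attained[OF assms(1,2)] .
  have "W \<subseteq> {0}" using W(1) assms(3) unfolding pos_subspace_def by force
  then have "dim W \<le> card ({} :: 'a set)"
    by (intro real_vector.dim_le_card) auto
  then show ?thesis using W(2) by simp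
qed

text \<open>Write \<open>p\<close> for positive indices of Dirichlet forms, \<open>m = 2n\<close>, \<open>V\<close> for the Dirichlet space and \<open>\<K>\<close> for
  the pairs \<open>(d, c)\<close> with \<open>X d = X' c\<close>, and \<open>ind \<K>\<close> for the negative index of the form on
  these pairs. The two evaluations of the nonnegative index of \<open>F'(v) - F(w)\<close>
  on pairs with equal boundary values give
  \<open>m + dim V = p(F') + p(-F) + dim \<K> - ind \<K>\<close>. Inserting
  \<open>dim V = p(F) + p(-F) + dim ker X\<close> and \<open>\<mu> + dim \<K> = m + dim ker X + ind \<K>\<close> yields the claim.\<close>

lemma comp_index_single_change:
  fixes A B C A' B' C' :: "nat \<Rightarrow> real^'n::finite^'n"
  assumes sys: "hamiltonian_system N A B C Z" and sys': "hamiltonian_system N A' B' C' Z'"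
    and k: "k \<le> N"
    and agree: "\<And>j. j \<le> N \<Longrightarrow> j \<noteq> k \<Longrightarrow>
      hamiltonian (A j) (B j) (C j) = hamiltonian (A' j) (B' j) (C' j)"
    and le: "\<And>v. v \<bullet> (hamiltonian (A' k) (B' k) (C' k) *v v) \<le> v \<bullet> (hamiltonian (A k) (B k) (C k) *v v)"
  shows "comp_index (graph_mat (Z (N + 1))) (graph_mat (Z' (N + 1)))
      + pos_index (action (\<lambda>k. hamiltonian (A k) (B k) (C k)) N) (dirichlet N)
    = pos_index (action (\<lambda>k. hamiltonian (A' k) (B' k) (C' k)) N) (dirichlet N)"
proof -
  interpret s: hamiltonian_system N A B C Z by (rule sys)
  interpret s': hamiltonian_system N A' B' C' Z' by (rule sys')
  let ?F = "s.F" and ?F' = "s'.F"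
  note bl = sym_bilinearD[OF s.F_bilinear] and bl' = sym_bilinearD[OF s'.F_bilinear]
  let ?T = "trajectories N :: 'n trajectory set" and ?V = "dirichlet N :: 'n trajectory set"
  have T: "subspace ?T" "fin_dim ?T" by (rule trajectories_subspace trajectories_fin_dim)+
  have V: "subspace ?V" "fin_dim ?V" by (rule dirichlet_subspace dirichlet_fin_dim)+
  have dT: "dim ?T = CARD('n + 'n) + dim ?V" by (rule dim_trajectories)
  have VT: "?V \<subseteq> ?T" by (auto simp: dirichlet_def)
  have Vb: "boundary N v = 0" if "v \<in> ?V" for v using that by (simp add: dirichlet_def)
  define \<Phi> where "\<Phi> p q = ?F' (snd p) (snd q) - ?F (fst p) (fst q)"
    for p q :: "'n trajectory \<times> 'n trajectory"
  have \<Phi>: "sym_bilinear \<Phi>"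
    unfolding \<Phi>_def
    by (rule sym_bilinear_difference[OF s.F_bilinear s'.F_bilinear linear_fst linear_snd])
  define P where "P = {p \<in> ?T \<times> ?T. boundary N (snd p) - boundary N (fst p) = 0}"
  have Ps: "subspace P"
    unfolding P_def
    by (rule subspace_kernel[OF _ subspace_Times[OF T(1) T(1)]])
      (intro linear_compose_sub linear_compose[OF linear_snd linear_boundary, unfolded o_def]
        linear_compose[OF linear_fst linear_boundary, unfolded o_def])
  have Pf: "fin_dim P"
    by (rule fin_dim_mono[OF fin_dim_Times[OF T(1) T(1) T(2) T(2)]]) (auto simp: P_def)
  have memP: "(w, v) \<in> P \<longleftrightarrow> w \<in> ?T \<and> v \<in> ?T \<and> boundary N w = boundary N v" for w v
    unfolding P_def by auto
  define dg where "dg w = (w, w)" for w :: "'n trajectory"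
  have dg: "linear dg" unfolding dg_def by (intro linearI) auto

  \<comment> \<open>First evaluation. On the pairs \<open>(w, w)\<close> with \<open>z\<^sub>k = 0\<close> the form vanishes, and their orthogonal
      complement is the diagonal, on which the form is nonnegative.\<close>
  define K where "K = dg ` {w \<in> ?T. mixed w k = 0}"
  have K: "subspace K"
    unfolding K_def
    by (rule real_vector.linear_subspace_image[OF dg subspace_kernel[OF linear_mixed T(1)]])
  have KP: "K \<subseteq> P" unfolding K_def dg_def by (auto simp: memP)
  have diff: "?F' w v - ?F w v = mixed w k \<bullet> ((s.H k - s'.H k) *v mixed v k)" for w v
    by (rule action_diff[OF agree k])
  have diff0: "?F w v = ?F' w v" if "mixed w k = 0" for w v
    using diff[of w v] that by simp
  have null: "\<Phi> q (w, w) = 0" if q: "q \<in> K" for q w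
  proof -
    obtain e where e: "q = (e, e)" "mixed e k = 0" using q unfolding K_def dg_def by blast
    show ?thesis unfolding \<Phi>_def e(1) fst_conv snd_conv diff0[OF e(2)] by simp
  qed
  have "\<Phi> q q \<le> 0" if q: "q \<in> K" for q
  proof -
    obtain e where "q = (e, e)" using q unfolding K_def dg_def by blast
    then show ?thesis using null[OF q, of e] by simp
  qed
  then have pK: "pos_index \<Phi> K = 0"
    by (rule pos_index_eq_0[OF fin_dim_mono[OF Pf KP] K])
  have Korth: "{p \<in> P. \<forall>q\<in>K. \<Phi> q p = 0} = dg ` ?T"
  proof (intro equalityI subsetI)
    fix p assume "p \<in> {p \<in> P. \<forall>q\<in>K. \<Phi> q p = 0}"
    then obtain w v where p: "p = (w, v)" "(w, v) \<in> P" and o: "\<And>q. q \<in> K \<Longrightarrow> \<Phi> q (w, v) = 0"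
      by (cases p) auto
    have "v - w \<in> ?V"
      using p(2) T(1) linear_diff[OF linear_boundary[of N], of v w]
      by (auto simp: memP dirichlet_def subspace_diff)
    moreover have "?F' (v - w) e = 0" if e: "e \<in> ?T" "mixed e k = 0" for e
    proof -
      have "dg e \<in> K" using e unfolding K_def by blast
      from o[OF this] have "?F' e v = ?F e w" unfolding \<Phi>_def dg_def by simp
      also have "\<dots> = ?F' e w" by (rule diff0[OF e(2)])
      finally show ?thesis unfolding bl'(8) using bl'(1)[of e v] bl'(1)[of e w] by simp
    qed
    ultimately have "v - w = 0" using s'.cut_nondegenerate[OF _ k] by blast
    then show "p \<in> dg ` ?T" using p by (auto simp: memP dg_def)
  next
    fix p assume "p \<in> dg ` ?T"
    then obtain w where p: "p = (w, w)" "w \<in> ?T" unfolding dg_def by blast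
    have "\<Phi> q p = 0" if "q \<in> K" for q
      unfolding p(1) by (rule null[OF that])
    then show "p \<in> {p \<in> P. \<forall>q\<in>K. \<Phi> q p = 0}" using p by (simp add: memP)
  qed
  have "nonneg_index \<Phi> (dg ` ?T) = dim (dg ` ?T)"
  proof (rule nonneg_index_eq_dim)
    show "fin_dim (dg ` ?T)" by (rule fin_dim_image[OF dg T(2)])
    show "subspace (dg ` ?T)" by (rule real_vector.linear_subspace_image[OF dg T(1)])
    fix p assume "p \<in> dg ` ?T"
    then obtain w where p: "p = (w, w)" unfolding dg_def by blast
    show "0 \<le> \<Phi> p p"
      unfolding p \<Phi>_def fst_conv snd_conv diff
      using le[of "mixed w k"] by (simp add: matrix_vector_mult_diff_rdistrib inner_diff_right)
  qed
  also have "dim (dg ` ?T) = dim ?T"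
    by (rule dim_image_inj_on[OF dg T]) (auto simp: dg_def intro: inj_onI)
  finally have nnP: "nonneg_index \<Phi> P = CARD('n + 'n) + dim ?V"
    using nonneg_index_split[OF \<Phi> Ps Pf K KP] pK Korth dT by simp

  \<comment> \<open>Second evaluation. Orthogonality to the Dirichlet variations of either component makes that
      component critical.\<close>
  define P2 where "P2 = {p \<in> P. \<forall>q\<in>{0} \<times> ?V. \<Phi> q p = 0}"
  define P3 where "P3 = {p \<in> P2. \<forall>q\<in>?V \<times> {0}. \<Phi> q p = 0}"
  have K2: "subspace ({0 :: 'n trajectory} \<times> ?V)" "subspace (?V \<times> {0 :: 'n trajectory})"
    by (intro subspace_Times V real_vector.subspace_single_0)+
  have fin0: "fin_dim {0 :: 'n trajectory}"
    by (rule fin_dim_mono[OF V(2)]) (use V(1) subspace_0 in blast)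
  have K2f: "fin_dim ({0 :: 'n trajectory} \<times> ?V)" "fin_dim (?V \<times> {0 :: 'n trajectory})"
    by (intro fin_dim_Times V real_vector.subspace_single_0 fin0)+
  have zT: "0 \<in> ?T" using T(1) subspace_0 by blast
  have bz: "boundary N 0 = (0 :: real^('n + 'n))" by (rule linear_0[OF linear_boundary])
  have K2P: "{0} \<times> ?V \<subseteq> P"
    using VT zT Vb bz by (auto simp: memP)
  have P2s: "subspace P2" unfolding P2_def by (rule subspace_orthogonal(2)[OF \<Phi> Ps])
  have P2f: "fin_dim P2" by (rule fin_dim_mono[OF Pf]) (auto simp: P2_def)
  have P2eq: "p \<in> P2 \<longleftrightarrow> p \<in> P \<and> (\<forall>v\<in>?V. ?F' v (snd p) = 0)" for p
    unfolding P2_def by (auto simp: \<Phi>_def bl)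
  have P3eq: "p \<in> P3 \<longleftrightarrow> p \<in> P \<and> (\<forall>v\<in>?V. ?F' v (snd p) = 0) \<and> (\<forall>v\<in>?V. ?F v (fst p) = 0)" for p
    unfolding P3_def P2eq[symmetric] by (auto simp: \<Phi>_def bl' P2eq)
  have K3P: "?V \<times> {0} \<subseteq> P2"
    using VT zT Vb bz by (auto simp: memP P2eq bl')
  have P3s: "subspace P3" unfolding P3_def by (rule subspace_orthogonal(2)[OF \<Phi> P2s])
  have P3f: "fin_dim P3" by (rule fin_dim_mono[OF P2f]) (auto simp: P3_def)
  have "pos_index \<Phi> ({0} \<times> ?V) = pos_index ?F' (snd ` ({0 :: 'n trajectory} \<times> ?V))"
    by (rule pos_index_image[OF linear_snd K2(1) K2f(1)]) (auto simp: \<Phi>_def bl bl')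
  then have p2: "pos_index \<Phi> ({0} \<times> ?V) = pos_index ?F' ?V" by simp
  have "pos_index \<Phi> (?V \<times> {0}) = pos_index (\<lambda>x y. - ?F x y) (fst ` (?V \<times> {0 :: 'n trajectory}))"
    by (rule pos_index_image[OF linear_fst K2(2) K2f(2)]) (auto simp: \<Phi>_def bl bl')
  then have p3: "pos_index \<Phi> (?V \<times> {0}) = pos_index (\<lambda>x y. - ?F x y) ?V" by simp
  have split: "nonneg_index \<Phi> P = pos_index ?F' ?V + (pos_index (\<lambda>x y. - ?F x y) ?V + nonneg_index \<Phi> P3)"
    using nonneg_index_split[OF \<Phi> Ps Pf K2(1) K2P] nonneg_index_split[OF \<Phi> P2s P2f K2(2) K3P] p2 p3
    unfolding P2_def[symmetric] P3_def[symmetric] by simp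

  \<comment> \<open>\<open>P3\<close> is parametrized by the initial values \<open>(d, c)\<close> of pairs of solutions, and there the form
      takes the shape required by \<open>comp_index_on_pairs\<close>.\<close>
  define Y Y' where "Y = graph_mat (Z (N + 1))" and "Y' = graph_mat (Z' (N + 1))"
  define h where "h p = (s.solution (fst p), s'.solution (snd p))"
    for p :: "(real^('n + 'n)) \<times> (real^('n + 'n))"
  have h: "linear h"
    unfolding h_def
    by (intro linearI) (simp_all add: linear_add[OF s.linear_solution] linear_add[OF s'.linear_solution]
        linear_scale[OF s.linear_solution] linear_scale[OF s'.linear_solution])
  let ?K = "{(d, c). upper Y *v d = upper Y' *v c}"
  have Ks: "subspace ?K"
    by (auto simp: subspace_def zero_prod_def matrix_vector_right_distrib matrix_vector_mult_scaleR)
  have P3K: "P3 = h ` ?K"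
  proof (intro equalityI subsetI)
    fix p assume p: "p \<in> P3"
    then have "fst p \<in> range s.solution" "snd p \<in> range s'.solution"
      unfolding s.critical_set[symmetric] s'.critical_set[symmetric]
      unfolding P3eq by (cases p; auto simp: memP)+
    then obtain d c where dc: "p = h (d, c)" unfolding h_def by (cases p) auto
    have "p \<in> P" using p P3eq by blast
    then have "(d, c) \<in> ?K"
      unfolding dc h_def using s.boundary_solution[of d] s'.boundary_solution[of c]
      by (simp add: memP Y_def Y'_def)
    then show "p \<in> h ` ?K" using dc by blast
  next
    fix p assume "p \<in> h ` ?K"
    then obtain d c where p: "p = (s.solution d, s'.solution c)" "upper Y *v d = upper Y' *v c"
      unfolding h_def by auto
    have "?F v (s.solution d) = 0" "?F' v (s'.solution c) = 0" if "v \<in> ?V" for v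
      using s.solution_critical[OF that, of d] s'.solution_critical[OF that, of c]
        bl(1)[of v "s.solution d"] bl'(1)[of v "s'.solution c"] by simp_all
    then show "p \<in> P3"
      unfolding P3eq p(1) using p(2)
      by (simp add: memP s.solution_trajectory s'.solution_trajectory s.boundary_solution
          s'.boundary_solution Y_def Y'_def)
  qed
  define \<Omega> where "\<Omega> p q = \<Phi> (h p) (h q)" for p q
  have \<Omega>: "sym_bilinear \<Omega>"
    unfolding \<Omega>_def \<Phi>_def h_def fst_conv snd_conv
    by (rule sym_bilinear_difference[OF s.F_bilinear s'.F_bilinear])
      (intro linear_compose[OF linear_fst s.linear_solution, unfolded o_def]
        linear_compose[OF linear_snd s'.linear_solution, unfolded o_def])+
  have ci: "comp_index Y Y' + dim ?K
      = CARD('n + 'n) + dim {d. upper Y *v d = 0} + pos_index (\<lambda>p q. - \<Omega> p q) ?K"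
  proof (rule comp_index_on_pairs[OF \<Omega>])
    fix p q assume pq: "p \<in> ?K" "q \<in> ?K"
    obtain d c d' c' where eq: "p = (d, c)" "q = (d', c')" by (cases p; cases q)
    have e: "upper Y *v d = upper Y' *v c" "upper Y *v d' = upper Y' *v c'" using pq eq by auto
    have "\<Omega> p q = ?F' (s'.solution c) (s'.solution c') - ?F (s.solution d') (s.solution d)"
      unfolding \<Omega>_def \<Phi>_def h_def eq by (simp add: bl(1)[of "s.solution d"])
    also have "\<dots> = lower_vec (Y' *v c) \<bullet> (upper Y' *v c') - lower_vec (Y *v d') \<bullet> (upper Y *v d)"
      unfolding s.action_solution s'.action_solution s.boundary_solution s'.boundary_solution
        Y_def Y'_def ..
    also have "\<dots> = lower_vec (Y' *v c) \<bullet> upper_vec (Y *v d') - upper_vec (Y' *v c) \<bullet> lower_vec (Y *v d')"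
      using e unfolding upper_mult_vec by (simp add: inner_commute)
    finally show "\<Omega> p q = snd p \<bullet> (transpose (wronskian Y Y') *v fst q)"
      unfolding wronskian_form eq by simp
  qed
  have hinj: "inj_on h ?K"
    unfolding h_def using s.solution_inj s'.solution_inj
    by (auto intro!: inj_onI dest: injD)
  have "dim P3 = dim ?K" unfolding P3K by (rule dim_image_inj_on[OF h Ks fin_dim_euclidean hinj])
  moreover have "pos_index (\<lambda>p q. - \<Phi> p q) P3 = pos_index (\<lambda>p q. - \<Omega> p q) ?K"
    unfolding P3K
    by (rule pos_index_image[OF h Ks fin_dim_euclidean, symmetric])
      (auto simp: \<Omega>_def sym_bilinearD(6)[OF \<Phi>])
  ultimately have nn3: "dim ?K = pos_index (\<lambda>p q. - \<Omega> p q) ?K + nonneg_index \<Phi> P3"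
    using dim_eq_neg_plus_nonneg[OF \<Phi> P3s P3f] by simp
  have dV: "dim ?V = pos_index (\<lambda>x y. - ?F x y) ?V + (pos_index ?F ?V + dim {d. upper Y *v d = 0})"
    using dim_eq_neg_plus_nonneg[OF s.F_bilinear V] nonneg_index_eq_pos_plus_null[OF s.F_bilinear V]
      s.dirichlet_nullity unfolding Y_def by simp
  show ?thesis
    using nnP split ci nn3 dV unfolding Y_def[symmetric] Y'_def[symmetric] by linarith
qed

section \<open>Monotone dependence on the spectral parameter\<close>

lemma antimono_nat_left_limit:
  fixes g :: "real \<Rightarrow> nat"
  assumes g: "antimono g"
  shows "\<exists>m. eventually (\<lambda>s. g s = m) (at_left t)"
proof -
  let ?m = "LEAST m. m \<in> g ` {..<t}"
  have "g (t - 1) \<in> g ` {..<t}" by auto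
  then have "?m \<in> g ` {..<t}" by (rule LeastI)
  then obtain s0 where s0: "s0 < t" "g s0 = ?m" by auto
  have "g s = ?m" if "s0 < s" "s < t" for s
    using that s0 antimonoD[OF g, of s0 s] Least_le[of "\<lambda>m. m \<in> g ` {..<t}" "g s"] by force
  then have "eventually (\<lambda>s. g s = ?m) (at_left t)"
    using s0(1) by (intro eventually_at_leftI[of s0]) auto
  then show ?thesis by blast
qed

text \<open>Induction on the value at the left end point. The jumps are located one by one: the infimum \<open>c\<close>
  of the points where \<open>g\<close> is below \<open>g a\<close> is attained by right-continuity, \<open>g\<close> is constant on \<open>[a, c)\<close>, and so
  \<open>c\<close> carries the jump \<open>g a - g c\<close>.\<close>

lemma sum_of_jumps:
  fixes g gl :: "real \<Rightarrow> nat" and a b :: real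
  assumes g: "antimono g"
    and right: "\<And>t. eventually (\<lambda>s. g s = g t) (at_right t)"
    and left: "\<And>t. eventually (\<lambda>s. g s = gl t) (at_left t)"
    and "a \<le> b"
  shows "finite {t. a < t \<and> t \<le> b \<and> 1 \<le> int (gl t) - int (g t)} \<and>
    (\<Sum>t\<in>{t. a < t \<and> t \<le> b \<and> 1 \<le> int (gl t) - int (g t)}. int (gl t) - int (g t))
      = int (g a) - int (g b)"
  using \<open>a \<le> b\<close>
proof (induction "g a" arbitrary: a rule: less_induct)
  case less
  let ?J = "\<lambda>a. {t. a < t \<and> t \<le> b \<and> 1 \<le> int (gl t) - int (g t)}"
  have gl: "gl t = m" if "s < t" "\<And>r. s < r \<Longrightarrow> r < t \<Longrightarrow> g r = m" for s t m
  proof -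
    have "eventually (\<lambda>r. g r = m) (at_left t)"
      using that by (intro eventually_at_leftI[of s]) auto
    then have "eventually (\<lambda>r. gl t = m) (at_left t)" using left[of t] by eventually_elim simp
    then show ?thesis by (simp add: eventually_const_iff)
  qed
  show ?case
  proof (cases "g a = g b")
    case True
    then have const: "g t = g a" if "a \<le> t" "t \<le> b" for t
      using antimonoD[OF g that(1)] antimonoD[OF g that(2)] by simp
    have empty: "?J a = {}"
    proof (rule equals0I)
      fix t assume t: "t \<in> ?J a"
      have "gl t = g a"
      proof (rule gl[of a])
        show "g r = g a" if "a < r" "r < t" for r using const[of r] that t by simp
      qed (use t in simp)
      then show False using t const[of t] by simp
    qed
    show ?thesis unfolding empty using True by simp
  next
    case False
    then have ba: "g b < g a" using antimonoD[OF g less.prems] by simp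
    define S where "S = {t. a \<le> t \<and> g t < g a}"
    define c where "c = Inf S"
    have bS: "b \<in> S" using ba less.prems by (simp add: S_def)
    have bdd: "bdd_below S" unfolding S_def by (intro bdd_belowI[of _ a]) auto
    have cb: "c \<le> b" unfolding c_def by (rule cInf_lower[OF bS bdd])
    have ac: "a \<le> c" unfolding c_def by (rule cInf_greatest) (use bS in \<open>auto simp: S_def\<close>)
    have before: "g s = g a" if "a \<le> s" "s < c" for s
      using that antimonoD[OF g, of a s] cInf_lower[OF _ bdd, of s] unfolding c_def S_def by force
    have gc: "g c < g a"
    proof (rule ccontr)
      assume "\<not> g c < g a"
      then have eq: "g c = g a" using antimonoD[OF g ac] by simp
      obtain d where d: "c < d" "\<And>s. c < s \<Longrightarrow> s < d \<Longrightarrow> g s = g c"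
        using right[of c] unfolding eventually_at_right_field by blast
      have "d \<le> c" unfolding c_def
      proof (rule cInf_greatest)
        show "S \<noteq> {}" using bS by blast
        fix t assume t: "t \<in> S"
        then have "c \<le> t" unfolding c_def by (rule cInf_lower[OF _ bdd])
        then show "d \<le> t" using t d(2)[of t] eq unfolding S_def by (cases "t = c") force+
      qed
      then show False using d(1) by simp
    qed
    then have "a < c" using ac by (cases "a = c") auto
    have glc: "gl c = g a"
      by (rule gl[OF \<open>a < c\<close> before]) simp_all
    have J: "?J a = insert c (?J c)"
    proof (intro equalityI subsetI)
      fix t assume t: "t \<in> ?J a"
      show "t \<in> insert c (?J c)"
      proof (cases "t < c")
        case True
        have "gl t = g a"
        proof (rule gl[of a])
          show "g r = g a" if "a < r" "r < t" for r using before[of r] that True by simp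
        qed (use t in simp)
        then show ?thesis using t before[of t] True by simp
      qed (use t in auto)
    next
      fix t assume "t \<in> insert c (?J c)"
      then show "t \<in> ?J a" using \<open>a < c\<close> cb gc glc by auto
    qed
    have IH: "finite (?J c) \<and> (\<Sum>t\<in>?J c. int (gl t) - int (g t)) = int (g c) - int (g b)"
      by (rule less.hyps[OF gc cb])
    then show ?thesis unfolding J using glc by simp
  qed
qed

text \<open>The fundamental theorem of calculus tolerates the finitely many exceptional points in \<open>[s, t]\<close>
  since the function is continuous there.\<close>

lemma piecewise_C1_nonneg_derivative_mono:
  fixes H :: "real \<Rightarrow> real^'m^'m"
  assumes H: "piecewise_C1 H"
    and deriv: "\<And>s D. (H has_vector_derivative D) (at s) \<Longrightarrow> nonneg_definite D"
    and st: "s \<le> t"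
  shows "v \<bullet> (H s *v v) \<le> v \<bullet> (H t *v v)"
proof -
  obtain E where cont: "continuous_on UNIV H" and E: "\<And>c d. finite (E \<inter> {c..d})"
    and C1: "H C1_differentiable_on (- E)"
    using H unfolding piecewise_C1_def by blast
  obtain D where D: "\<And>x. x \<notin> E \<Longrightarrow> (H has_vector_derivative D x) (at x)"
    using C1 unfolding C1_differentiable_on_def by auto
  define q where "q M = v \<bullet> (M *v v)" for M :: "real^'m^'m"
  have "linear q"
    unfolding q_def
    by (intro linearI)
      (simp_all add: matrix_vector_mult_add_rdistrib inner_add_right scaleR_matrix_vector_assoc[symmetric])
  then have q: "bounded_linear q" by (simp add: linear_conv_bounded_linear)
  have "((\<lambda>x. q (D x)) has_integral (q (H t) - q (H s))) {s..t}"
  proof (rule fundamental_theorem_of_calculus_strong[OF E[of s t] st])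
    show "((\<lambda>x. q (H x)) has_vector_derivative q (D x)) (at x)" if "x \<in> {s..t} - E \<inter> {s..t}" for x
      using that by (intro bounded_linear.has_vector_derivative[OF q] D) auto
    show "continuous_on {s..t} (\<lambda>x. q (H x))"
      by (intro bounded_linear.continuous_on[OF q] continuous_on_subset[OF cont]) auto
  qed
  moreover have "0 \<le> q (if x \<in> E then 0 else D x)" for x
    using deriv[OF D[of x]] unfolding q_def nonneg_definite_def by simp
  moreover have "((\<lambda>x. q (D x)) has_integral I) {s..t}
      \<longleftrightarrow> ((\<lambda>x. q (if x \<in> E then 0 else D x)) has_integral I) {s..t}" for I
    by (rule has_integral_spike_eq[OF negligible_finite[OF E[of s t]]]) auto
  ultimately have "0 \<le> q (H t) - q (H s)" using has_integral_nonneg by blast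
  then show ?thesis by (simp add: q_def)
qed

lemma tendsto_matrix_form:
  fixes M :: "'t \<Rightarrow> real^'n^'m"
  assumes "(M \<longlongrightarrow> M0) F"
  shows "((\<lambda>t. x \<bullet> (M t *v y)) \<longlongrightarrow> x \<bullet> (M0 *v y)) F"
  unfolding inner_vec_def matrix_vector_mult_def
  by (simp, intro tendsto_sum tendsto_mult tendsto_const tendsto_vec_nth assms)

text \<open>Lower semicontinuity bounds the rank from below near \<open>s\<close>, monotonicity bounds it from above
  on the left of \<open>s\<close>. The zero at \<open>a\<close> makes \<open>P t\<close> nonnegative for \<open>t \<ge> a\<close>.\<close>

lemma eventually_rank_eq_at_left:
  fixes P :: "real \<Rightarrow> real^'n^'n"
  assumes sym: "\<And>t. transpose (P t) = P t" and cont: "continuous_on UNIV P"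
    and mono: "\<And>v s t. s \<le> t \<Longrightarrow> v \<bullet> (P s *v v) \<le> v \<bullet> (P t *v v)"
    and zero: "P a = 0" and "a < s"
  shows "eventually (\<lambda>t. rank (P t) = rank (P s)) (at_left s)"
proof -
  let ?\<Phi> = "\<lambda>t x y. x \<bullet> (P t *v y)"
  have rank: "rank (P t) = pos_index (?\<Phi> t) UNIV" if "a \<le> t" for t
    by (rule rank_nonneg_matrix[OF sym]) (use mono[OF that] zero in simp)
  have "(P \<longlongrightarrow> P s) (at s)" using cont by (simp add: continuous_on_def)
  then have "(P \<longlongrightarrow> P s) (at_left s)" by (rule tendsto_within_subset) simp
  then have "eventually (\<lambda>t. pos_index (?\<Phi> s) UNIV \<le> pos_index (?\<Phi> t) UNIV) (at_left s)"
    by (intro pos_index_lower_semicontinuous tendsto_matrix_form sym_bilinear_matrix sym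
        subspace_UNIV fin_dim_euclidean)
  moreover have "eventually (\<lambda>t. t \<in> {a<..<s}) (at_left s)"
    using \<open>a < s\<close> by (intro eventually_at_leftI[of a]) auto
  ultimately show ?thesis
  proof eventually_elim
    case (elim t)
    have "pos_index (?\<Phi> t) UNIV \<le> pos_index (?\<Phi> s) UNIV"
      by (rule pos_index_mono[OF subspace_UNIV fin_dim_euclidean]) (use mono elim in auto)
    then show ?case using elim rank[of t] rank[of s] \<open>a < s\<close> by simp
  qed
qed

section \<open>Coefficient matrices and hybrid systems\<close>

lemma rank_eqI:
  fixes A A' :: "real^'n^'m"
  assumes h: "linear h" and "h ` {x. A *v x = 0} = {x. A' *v x = 0}" and "inj_on h {x. A *v x = 0}"
  shows "rank A = rank A'"
proof -
  have "subspace {x. A *v x = 0}"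
    by (auto simp: subspace_def matrix_vector_right_distrib matrix_vector_mult_scaleR)
  then have "dim {x. A' *v x = 0} = dim {x. A *v x = 0}"
    using dim_image_inj_on[OF h _ fin_dim_euclidean assms(3)] assms(2) by simp
  then show ?thesis using rank_plus_nullity[of A] rank_plus_nullity[of A'] by simp
qed

lemma hamiltonian_mult_vec:
  "hamiltonian A B C *v vstack x u = vstack (transpose A *v u - C *v x) (A *v x + B *v u)"
  using matrix_vector_mult_diff_rdistrib[of 0 C x]
  unfolding hamiltonian_def block_mat_mult_vstack by simp

text \<open>Two systems have a step in common exactly when their Hamiltonians agree on its mixed vector: the
  map from \<open>(x\<^sub>k, u\<^sub>k)\<close> to \<open>(x\<^bsub>k+1\<^esub>, u\<^sub>k)\<close> identifies the two kernels.\<close>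

lemma rank_coeff_mat_diff:
  fixes A B C A' B' C' :: "real^'n::finite^'n"
  assumes d: "det (mat 1 - A) \<noteq> 0" and d': "det (mat 1 - A') \<noteq> 0"
  shows "rank (coeff_mat A B C - coeff_mat A' B' C') = rank (hamiltonian A' B' C' - hamiltonian A B C)"
proof -
  let ?S = "coeff_mat A B C" and ?S' = "coeff_mat A' B' C'"
  let ?H = "hamiltonian A B C" and ?H' = "hamiltonian A' B' C'"
  define h where "h y = vstack (upper_vec (?S *v y)) (lower_vec y)" for y
  have h: "linear h"
    unfolding h_def
    by (intro linearI) (simp_all add: vstack_linear[symmetric] matrix_vector_right_distrib
        matrix_vector_mult_scaleR linear_add[OF linear_upper_vec] linear_add[OF linear_lower_vec]
        linear_scale[OF linear_upper_vec] linear_scale[OF linear_lower_vec])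
  have step: "hamiltonian_step A B C (upper_vec y) (lower_vec y) x' u' \<longleftrightarrow> vstack x' u' = ?S *v y"
    and step': "hamiltonian_step A' B' C' (upper_vec y) (lower_vec y) x' u' \<longleftrightarrow> vstack x' u' = ?S' *v y"
    for x' u' y
    using hamiltonian_step_iff_coeff_mat[OF d, of B C] hamiltonian_step_iff_coeff_mat[OF d', of B' C'] by simp_all
  have kerS: "(?S - ?S') *v y = 0 \<longleftrightarrow> ?S *v y = ?S' *v y" for y
    by (simp add: matrix_vector_mult_diff_rdistrib)
  have kerH: "(?H' - ?H) *v vstack x u = 0 \<longleftrightarrow>
      transpose A' *v u - C' *v x = transpose A *v u - C *v x \<and> A' *v x + B' *v u = A *v x + B *v u" for x u
    by (simp add: matrix_vector_mult_diff_rdistrib hamiltonian_mult_vec vstack_eq_iff)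
  have S_step: "hamiltonian_step A B C (upper_vec y) (lower_vec y) (upper_vec (?S *v y)) (lower_vec (?S *v y))" for y
    by (simp add: step)
  show ?thesis
  proof (rule rank_eqI[OF h])
    show "h ` {y. (?S - ?S') *v y = 0} = {z. (?H' - ?H) *v z = 0}"
    proof (intro equalityI subsetI)
      fix z assume "z \<in> h ` {y. (?S - ?S') *v y = 0}"
      then obtain y where y: "z = h y" "?S *v y = ?S' *v y" using kerS by auto
      have "hamiltonian_step A' B' C' (upper_vec y) (lower_vec y) (upper_vec (?S *v y)) (lower_vec (?S *v y))"
        using y(2) by (simp add: step')
      with S_step[of y] have "(?H' - ?H) *v h y = 0"
        unfolding h_def kerH hamiltonian_step_def by (auto simp: algebra_simps)
      then show "z \<in> {z. (?H' - ?H) *v z = 0}" using y(1) by simp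
    next
      fix z assume "z \<in> {z. (?H' - ?H) *v z = 0}"
      then have z: "(?H' - ?H) *v vstack (upper_vec z) (lower_vec z) = 0" by simp
      define x u where "x = upper_vec z" and "u = lower_vec z"
      define y where "y = vstack (x - (A *v x + B *v u)) u"
      define u' where "u' = u + (C *v x - transpose A *v u)"
      have "hamiltonian_step A B C (upper_vec y) (lower_vec y) x u'"
        unfolding hamiltonian_step_def y_def u'_def by simp
      moreover have "hamiltonian_step A' B' C' (upper_vec y) (lower_vec y) x u'"
        using z unfolding kerH hamiltonian_step_def y_def u'_def x_def[symmetric] u_def[symmetric]
        by (auto simp: algebra_simps)
      ultimately have "?S *v y = vstack x u'" "?S' *v y = vstack x u'" using step step' by simp_all
      then have "(?S - ?S') *v y = 0" "h y = z" unfolding kerS h_def y_def x_def u_def by simp_all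
      then show "z \<in> h ` {y. (?S - ?S') *v y = 0}" by blast
    qed
    have "inj h"
      unfolding linear_injective_0[OF h]
    proof (intro allI impI)
      fix y assume "h y = 0"
      then have "upper_vec (?S *v y) = 0" "lower_vec y = 0" unfolding h_def by (simp_all add: vstack_eq_0_iff)
      then have "upper_vec y = 0" using S_step[of y] unfolding hamiltonian_step_def by simp
      then show "y = 0" using \<open>lower_vec y = 0\<close> by (metis vstack_upper_lower vstack_linear(3))
    qed
    then show "inj_on h {y. (?S - ?S') *v y = 0}" by (rule inj_on_subset) simp
  qed
qed

text \<open>A solution with zero boundary values is determined by its initial momentum.\<close>

lemma rank_principal_X:
  fixes W :: "real^('n::finite + 'n)^('n + 'n)"
  shows "rank (principal_X W) + dim {d. upper (graph_mat W) *v d = 0} = CARD('n)"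
proof -
  have X: "principal_X W *v c = upper_vec (W *v vstack 0 c)" for c
    unfolding principal_X_def upper_mult_vec
    by (simp add: matrix_vector_mul_assoc[symmetric] stack_mult_vec)
  have l: "linear (\<lambda>c. vstack 0 c :: real^('n + 'n))"
    by (intro linearI) (simp_all add: vstack_linear[symmetric])
  have "upper (graph_mat W) *v d = 0 \<longleftrightarrow> upper_vec d = 0 \<and> upper_vec (W *v d) = 0" for d
    by (simp add: upper_mult_vec graph_mat_mult_vec vstack_eq_0_iff)
  moreover have "d = vstack 0 (lower_vec d)" if "upper_vec d = 0" for d :: "real^('n + 'n)"
    using vstack_upper_lower[of d] that by simp
  ultimately have "{d. upper (graph_mat W) *v d = 0} = vstack 0 ` {c. principal_X W *v c = 0}"
    unfolding X by (auto simp: image_iff) metis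
  moreover have "dim (vstack 0 ` {c. principal_X W *v c = 0} :: (real^('n + 'n)) set)
      = dim {c. principal_X W *v c = 0}"
    by (rule dim_image_inj_on[OF l _ fin_dim_euclidean])
      (auto simp: subspace_def matrix_vector_right_distrib matrix_vector_mult_scaleR vstack_eq_iff
        intro: inj_onI)
  ultimately show ?thesis using rank_plus_nullity[of "principal_X W"] by simp
qed

text \<open>The hybrid solution agrees with \<open>Z\<close> up to time \<open>k\<close>. From then on it satisfies the same recursion as \<open>Z'\<close>,
  hence differs from it by the constant right factor \<open>Z'(k)\<^sup>-\<^sup>1 Z(k)\<close>, which can be read off at \<open>N + 1\<close>, where \<open>Z'\<close>
  is the identity. Invertibility of \<open>Z'\<close> propagates backward from there.\<close>

lemma hybrid_transition:
  fixes Z Z' Z'' :: "nat \<Rightarrow> real^('n::finite + 'n)^('n + 'n)"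
  assumes Z: "fundamental_solution N S 0 Z" and Z': "fundamental_solution N S' (N + 1) Z'"
    and Z'': "fundamental_solution N S'' 0 Z''"
    and before: "\<And>j. j < k \<Longrightarrow> S'' j = S j" and after: "\<And>j. k \<le> j \<Longrightarrow> j \<le> N \<Longrightarrow> S'' j = S' j"
    and k: "k \<le> N + 1"
  shows "matrix_inv (Z' k) ** Z k = Z'' (N + 1)"
proof -
  have inv: "invertible (Z' j)" if "j \<le> N + 1" for j
    using that
  proof (induction j rule: inc_induct)
    case base
    have "Z' (N + 1) = mat 1" using Z' unfolding fundamental_solution_def by simp
    then show ?case unfolding invertible_def by (metis matrix_mul_lid)
  next
    case (step j)
    then have "Z' (Suc j) = S' j ** Z' j" using Z' unfolding fundamental_solution_def by auto
    then obtain L where "L ** (S' j ** Z' j) = mat 1"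
      using step.IH unfolding invertible_def by auto
    then have "(L ** S' j) ** Z' j = mat 1" by (simp add: matrix_mul_assoc)
    then show ?case unfolding invertible_left_inverse by blast
  qed
  have eqk: "Z'' j = Z j" if "j \<le> k" for j
    using that
  proof (induction j)
    case 0
    then show ?case using Z Z'' unfolding fundamental_solution_def by simp
  next
    case (Suc j)
    then show ?case using Z Z'' before[of j] k unfolding fundamental_solution_def by auto
  qed
  have "Z'' j = Z' j ** (matrix_inv (Z' k) ** Z k)" if "k \<le> j" "j \<le> N + 1" for j
    using that
  proof (induction j rule: dec_induct)
    case base
    have "Z' k ** matrix_inv (Z' k) = mat 1"
      using inv[OF k] unfolding invertible_def matrix_inv_def
      by (metis (mono_tags, lifting) someI_ex)
    then show ?case using eqk[of k] by (simp add: matrix_mul_assoc)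
  next
    case (step j)
    then show ?case
      using Z' Z'' after[of j] unfolding fundamental_solution_def by (simp add: matrix_mul_assoc)
  qed
  from this[OF k order_refl] show ?thesis using Z' unfolding fundamental_solution_def by simp
qed

section \<open>Counting finite eigenvalues\<close>

lemma rank_left_eventually:
  assumes "eventually (\<lambda>t. rank (M t) = m) (at_left s)"
  shows "has_rank_left M s" "rank_left M s = m"
proof -
  have lim: "((\<lambda>t. rank (M t)) \<longlongrightarrow> m) (at_left s)"
    using assms by (rule tendsto_eventually)
  then show "has_rank_left M s" unfolding has_rank_left_def by blast
  show "rank_left M s = m"
    unfolding rank_left_def using lim by (intro tendsto_Lim) simp_all
qed

lemma action_mono:
  assumes "\<And>k v. k \<le> N \<Longrightarrow> v \<bullet> (H k *v v) \<le> v \<bullet> (H' k *v v)"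
  shows "action H' N w w \<le> action H N w w"
  unfolding action_def by (intro sum_mono diff_left_mono) (use assms in simp)

lemma tendsto_action:
  assumes "\<And>k. k \<le> N \<Longrightarrow> ((\<lambda>t. H t k) \<longlongrightarrow> H0 k) F"
  shows "((\<lambda>t. action (H t) N w v) \<longlongrightarrow> action H0 N w v) F"
  unfolding action_def
  by (intro tendsto_sum tendsto_diff tendsto_const tendsto_matrix_form) (use assms in simp)

theorem corollary4p12:
  fixes A B C :: "nat \<Rightarrow> real \<Rightarrow> real^'n::finite^'n"
    and S Z0 ZN1 :: "nat \<Rightarrow> real \<Rightarrow> real^('n + 'n)^('n + 'n)"
    and X :: "real \<Rightarrow> real^'n^'n"
    and \<sigma> :: "real set"
    and N :: nat
    and a b :: real
  assumes det_nz: "\<And>k s. k \<le> N \<Longrightarrow> det (mat 1 - A k s) \<noteq> 0"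
    and ham_sym: "\<And>k s. k \<le> N \<Longrightarrow>
      transpose (hamiltonian (A k s) (B k s) (C k s)) = hamiltonian (A k s) (B k s) (C k s)"
    and ham_C1: "\<And>k. k \<le> N \<Longrightarrow> piecewise_C1 (\<lambda>t. hamiltonian (A k t) (B k t) (C k t))"
    and ham_mono: "\<And>k s D. k \<le> N \<Longrightarrow>
      ((\<lambda>t. hamiltonian (A k t) (B k t) (C k t)) has_vector_derivative D) (at s) \<Longrightarrow>
      nonneg_definite D"
    and S_def: "S = (\<lambda>k t. coeff_mat (A k t) (B k t) (C k t))"
    and Z0: "\<And>s. fundamental_solution N (\<lambda>k. S k s) 0 (\<lambda>k. Z0 k s)"
    and ZN1: "\<And>s. fundamental_solution N (\<lambda>k. S k s) (N + 1) (\<lambda>k. ZN1 k s)"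
    and X_def: "X = (\<lambda>t. principal_X (Z0 (N + 1) t))"
    and \<sigma>_def: "\<sigma> = finite_eigenvalues X"
    and ab: "a < b"
  shows "(\<forall>s\<in>{a<..b}. \<forall>k\<le>N.
            has_rank_left (\<lambda>t. S k a - S k t) s \<and>
            int (rank_left (\<lambda>t. S k a - S k t) s) - int (rank (S k a - S k s)) = 0)
       \<and> (\<forall>s\<in>{a<..b}. has_rank_left X s)
       \<and> finite {\<nu>\<in>\<sigma>. a < \<nu> \<and> \<nu> \<le> b}
       \<and> L_d_star (\<lambda>k. Z0 k a) (\<lambda>k. ZN1 k b) N = L_d (\<lambda>k. ZN1 k a) (\<lambda>k. Z0 k b) N
       \<and> int (L_d (\<lambda>k. ZN1 k a) (\<lambda>k. Z0 k b) N)
           = (\<Sum>\<nu>\<in>{\<nu>\<in>\<sigma>. a < \<nu> \<and> \<nu> \<le> b}. finite_eigenvalue_mult X \<nu>)"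
proof -
  define H where "H k t = hamiltonian (A k t) (B k t) (C k t)" for k t
  \<comment> \<open>\<open>\<tau>\<close> assigns to each time its own spectral parameter; the hybrid systems need this generality\<close>
  define P where "P \<tau> = pos_index (action (\<lambda>k. H k (\<tau> k)) N) (dirichlet N)" for \<tau> :: "nat \<Rightarrow> real"
  define Q where "Q t = nonneg_index (action (\<lambda>k. H k t) N) (dirichlet N)" for t
  define W where "W \<tau> k = rec_nat (mat 1) (\<lambda>k V. S k (\<tau> k) ** V) k" for \<tau> :: "nat \<Rightarrow> real" and k
  let ?V = "dirichlet N :: 'n trajectory set"
  have V: "subspace ?V" "fin_dim ?V" by (rule dirichlet_subspace dirichlet_fin_dim)+
  have H_sym: "transpose (H k t) = H k t" if "k \<le> N" for k t
    unfolding H_def by (rule ham_sym[OF that])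
  have H_mono: "v \<bullet> (H k s *v v) \<le> v \<bullet> (H k t *v v)" if "k \<le> N" "s \<le> t" for k s t v
    unfolding H_def
    by (rule piecewise_C1_nonneg_derivative_mono[OF ham_C1[OF that(1)] ham_mono[OF that(1)] that(2)])
  have H_cont: "continuous_on UNIV (H k)" if "k \<le> N" for k
    using ham_C1[OF that] unfolding H_def piecewise_C1_def by blast
  have H_lim: "(H k \<longlongrightarrow> H k t) (at t within T)" if "k \<le> N" for k t T
  proof -
    have "(H k \<longlongrightarrow> H k t) (at t)" using H_cont[OF that] by (simp add: continuous_on_def)
    then show ?thesis by (rule tendsto_within_subset) simp
  qed
  have bil: "sym_bilinear (action (\<lambda>k. H k (\<tau> k)) N)" for \<tau>
    by (rule action_sym_bilinear) (rule H_sym)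
  have sys: "hamiltonian_system N (\<lambda>k. A k (\<tau> k)) (\<lambda>k. B k (\<tau> k)) (\<lambda>k. C k (\<tau> k)) V"
    if "fundamental_solution N (\<lambda>k. S k (\<tau> k)) 0 V" for \<tau> V
    using that by unfold_locales (simp_all add: det_nz ham_sym S_def)
  have W: "fundamental_solution N (\<lambda>k. S k (\<tau> k)) 0 (W \<tau>)" for \<tau>
    unfolding fundamental_solution_def W_def by simp

  have rank_S: "eventually (\<lambda>t. rank (S k a - S k t) = rank (S k a - S k s)) (at_left s)"
    if s: "a < s" and k: "k \<le> N" for s k
  proof -
    have "rank (S k a - S k t) = rank (H k t - H k a)" for t
      unfolding S_def H_def by (rule rank_coeff_mat_diff[OF det_nz[OF k] det_nz[OF k]])
    moreover have "eventually (\<lambda>t. rank (H k t - H k a) = rank (H k s - H k a)) (at_left s)"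
    proof (rule eventually_rank_eq_at_left[OF _ _ _ _ s])
      show "transpose (H k t - H k a) = H k t - H k a" for t
        using H_sym[OF k, of t] H_sym[OF k, of a] by (simp add: transpose_def vec_eq_iff)
      show "continuous_on UNIV (\<lambda>t. H k t - H k a)"
        by (intro continuous_intros H_cont[OF k])
      show "v \<bullet> ((H k r - H k a) *v v) \<le> v \<bullet> ((H k t - H k a) *v v)" if "r \<le> t" for v r t
        using H_mono[OF k that] by (simp add: matrix_vector_mult_diff_rdistrib inner_diff_right)
    qed simp
    ultimately show ?thesis by simp
  qed

  define g where "g t = P (\<lambda>_. t)" for t
  have anti: "action (\<lambda>k. H k t) N w w \<le> action (\<lambda>k. H k s) N w w" if "s \<le> t" for s t w
    by (rule action_mono) (rule H_mono[OF _ that])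
  have lim: "((\<lambda>r. action (\<lambda>k. H k r) N w v) \<longlongrightarrow> action (\<lambda>k. H k t) N w v) (at t within T)" for w v t T
    by (rule tendsto_action) (rule H_lim)
  have g_anti: "antimono g"
    unfolding g_def P_def by (intro antimonoI pos_index_mono[OF V] anti)
  have Q_dim: "dim ?V = pos_index (\<lambda>x y. - action (\<lambda>k. H k t) N x y) ?V + Q t" for t
    unfolding Q_def by (rule dim_eq_neg_plus_nonneg[OF bil V])
  have g_right: "eventually (\<lambda>r. g r = g t) (at_right t)" for t
  proof -
    have "eventually (\<lambda>r. g t \<le> g r) (at_right t)"
      unfolding g_def P_def by (rule pos_index_lower_semicontinuous[OF V bil bil lim])
    moreover have "eventually (\<lambda>r. t < r) (at_right t)" by (rule eventually_at_right_less)
    ultimately show ?thesis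
    proof eventually_elim
      case (elim r)
      then show ?case using antimonoD[OF g_anti, of t r] by simp
    qed
  qed
  \<comment> \<open>the nonnegative index is the codimension of the negative index, which is lower semicontinuous\<close>
  have Q_left: "eventually (\<lambda>r. Q r = Q t) (at_left t)" for t
  proof -
    let ?n = "\<lambda>t. pos_index (\<lambda>x y. - action (\<lambda>k. H k t) N x y) ?V"
    have "eventually (\<lambda>r. ?n t \<le> ?n r) (at_left t)"
      by (rule pos_index_lower_semicontinuous[OF V sym_bilinear_uminus[OF bil]
            sym_bilinear_uminus[OF bil] tendsto_minus[OF lim]])
    moreover have "eventually (\<lambda>r. r < t) (at_left t)" by (simp add: eventually_at_filter)
    ultimately show ?thesis
    proof eventually_elim
      case (elim r)
      have "?n r \<le> ?n t"
        by (rule pos_index_mono[OF V]) (use anti[of r t] elim(2) in simp)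
      then show ?case using elim(1) Q_dim[of r] Q_dim[of t] by simp
    qed
  qed
  have rank_X: "rank (X t) + Q t = CARD('n) + g t" for t
  proof -
    interpret hamiltonian_system N "\<lambda>k. A k t" "\<lambda>k. B k t" "\<lambda>k. C k t" "\<lambda>k. Z0 k t"
      using sys[of "\<lambda>_. t"] Z0 by simp
    have "Q t = g t + dim {d. upper (graph_mat (Z0 (N + 1) t)) *v d = 0}"
      using nonneg_index_eq_pos_plus_null[OF F_bilinear V] dirichlet_nullity
      unfolding Q_def g_def P_def H_def by simp
    then show ?thesis using rank_principal_X[of "Z0 (N + 1) t"] unfolding X_def by simp
  qed
  obtain gl where gl: "\<And>t. eventually (\<lambda>r. g r = gl t) (at_left t)"
    using antimono_nat_left_limit[OF g_anti] by metis
  define m where "m t = CARD('n) + gl t - Q t" for t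
  have X_left: "eventually (\<lambda>r. rank (X r) = m t \<and> m t + Q t = CARD('n) + gl t) (at_left t)" for t
    using gl[of t] Q_left[of t]
  proof eventually_elim
    case (elim r)
    then show ?case using rank_X[of r] by (simp add: m_def)
  qed
  have mt: "m t + Q t = CARD('n) + gl t" for t
    using eventually_happens'[OF trivial_limit_at_left_real X_left[of t]] by blast
  have "eventually (\<lambda>r. rank (X r) = m t) (at_left t)" for t
    using X_left[of t] by eventually_elim simp
  note X_rank = rank_left_eventually[OF this]
  have mult: "finite_eigenvalue_mult X t = int (gl t) - int (g t)" for t
    using mt[of t] rank_X[of t] unfolding finite_eigenvalue_mult_def X_rank by linarith
  have jumps: "finite {t. a < t \<and> t \<le> b \<and> 1 \<le> int (gl t) - int (g t)} \<and>
    (\<Sum>t\<in>{t. a < t \<and> t \<le> b \<and> 1 \<le> int (gl t) - int (g t)}. int (gl t) - int (g t))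
      = int (g a) - int (g b)"
    by (rule sum_of_jumps[OF g_anti g_right gl]) (use ab in simp)
  have \<sigma>: "{\<nu>\<in>\<sigma>. a < \<nu> \<and> \<nu> \<le> b} = {t. a < t \<and> t \<le> b \<and> 1 \<le> int (gl t) - int (g t)}"
    unfolding \<sigma>_def finite_eigenvalues_def mult by auto

  have step: "int (comp_index (graph_mat (W \<tau> (N + 1))) (graph_mat (W \<tau>' (N + 1)))) = int (P \<tau>') - int (P \<tau>)"
    if k: "k \<le> N" and eq: "\<And>j. j \<noteq> k \<Longrightarrow> \<tau> j = \<tau>' j" and le: "\<tau>' k \<le> \<tau> k" for k \<tau> \<tau>'
  proof -
    have "comp_index (graph_mat (W \<tau> (N + 1))) (graph_mat (W \<tau>' (N + 1))) + P \<tau> = P \<tau>'"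
      unfolding P_def H_def
      by (rule comp_index_single_change[OF sys[OF W] sys[OF W] k])
        (use eq H_mono[OF k le] in \<open>simp_all add: H_def\<close>)
    then show ?thesis by linarith
  qed
  define hyb where "hyb p q k j = (if j < k then p else q)" for p q :: real and k j :: nat
  have hybrid: "matrix_inv (ZN1 k q) ** Z0 k p = W (hyb p q k) (N + 1)" if "k \<le> N + 1" for p q k
    by (rule hybrid_transition[OF Z0 ZN1 W _ _ that]) (simp_all add: hyb_def)
  have P_ends: "P (hyb p q 0) = g q" "P (hyb p q (Suc N)) = g p" for p q
  proof -
    show "P (hyb p q 0) = g q" by (simp add: g_def hyb_def[abs_def])
    have "action (\<lambda>k. H k (hyb p q (Suc N) k)) N = action (\<lambda>k. H k p) N"
      by (intro ext) (simp add: action_def hyb_def)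
    then show "P (hyb p q (Suc N)) = g p" by (simp add: g_def P_def)
  qed
  have Ld: "int (L_d (\<lambda>k. ZN1 k a) (\<lambda>k. Z0 k b) N) = int (g a) - int (g b)"
  proof -
    have "int (L_d (\<lambda>k. ZN1 k a) (\<lambda>k. Z0 k b) N)
        = (\<Sum>k\<le>N. int (P (hyb b a k)) - int (P (hyb b a (Suc k))))"
      unfolding L_d_def of_nat_sum atLeast0AtMost
    proof (intro sum.cong refl)
      fix k assume "k \<in> {..N}"
      then have k: "k \<le> N" by simp
      then have "matrix_inv (ZN1 (k + 1) a) ** Z0 (k + 1) b = W (hyb b a (Suc k)) (N + 1)"
        "matrix_inv (ZN1 k a) ** Z0 k b = W (hyb b a k) (N + 1)"
        using hybrid[of "k + 1"] hybrid[of k] by simp_all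
      then show "int (comp_index (graph_mat (matrix_inv (ZN1 (k + 1) a) ** Z0 (k + 1) b))
          (graph_mat (matrix_inv (ZN1 k a) ** Z0 k b))) = int (P (hyb b a k)) - int (P (hyb b a (Suc k)))"
        by (simp only:, intro step[OF k]) (use ab in \<open>auto simp: hyb_def\<close>)
    qed
    also have "\<dots> = int (P (hyb b a 0)) - int (P (hyb b a (Suc N)))" by (rule sum_telescope)
    finally show ?thesis unfolding P_ends .
  qed
  have Ld_star: "int (L_d_star (\<lambda>k. Z0 k a) (\<lambda>k. ZN1 k b) N) = int (g a) - int (g b)"
  proof -
    have "int (L_d_star (\<lambda>k. Z0 k a) (\<lambda>k. ZN1 k b) N)
        = (\<Sum>k\<le>N. int (P (hyb a b (Suc k))) - int (P (hyb a b k)))"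
      unfolding L_d_star_def of_nat_sum atLeast0AtMost
    proof (intro sum.cong refl)
      fix k assume "k \<in> {..N}"
      then have k: "k \<le> N" by simp
      then have "matrix_inv (ZN1 (k + 1) b) ** Z0 (k + 1) a = W (hyb a b (Suc k)) (N + 1)"
        "matrix_inv (ZN1 k b) ** Z0 k a = W (hyb a b k) (N + 1)"
        using hybrid[of "k + 1"] hybrid[of k] by simp_all
      then show "int (comp_index (graph_mat (matrix_inv (ZN1 k b) ** Z0 k a))
          (graph_mat (matrix_inv (ZN1 (k + 1) b) ** Z0 (k + 1) a)))
          = int (P (hyb a b (Suc k))) - int (P (hyb a b k))"
        by (simp only:, intro step[OF k]) (use ab in \<open>auto simp: hyb_def\<close>)
    qed
    also have "\<dots> = - (\<Sum>k\<le>N. int (P (hyb a b k)) - int (P (hyb a b (Suc k))))"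
      by (simp add: sum_negf[symmetric])
    also have "\<dots> = - (int (P (hyb a b 0)) - int (P (hyb a b (Suc N))))" by (rule arg_cong[OF sum_telescope])
    finally show ?thesis unfolding P_ends by simp
  qed
  show ?thesis
  proof (intro conjI ballI allI impI)
    fix s k assume s: "s \<in> {a<..b}" and k: "k \<le> N"
    show "has_rank_left (\<lambda>t. S k a - S k t) s"
      "int (rank_left (\<lambda>t. S k a - S k t) s) - int (rank (S k a - S k s)) = 0"
      using rank_left_eventually[OF rank_S[OF _ k, of s]] s by simp_all
  next
    show "has_rank_left X s" for s by (rule X_rank)
    show "finite {\<nu>\<in>\<sigma>. a < \<nu> \<and> \<nu> \<le> b}" unfolding \<sigma> using jumps by blast
    show "L_d_star (\<lambda>k. Z0 k a) (\<lambda>k. ZN1 k b) N = L_d (\<lambda>k. ZN1 k a) (\<lambda>k. Z0 k b) N"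
      using Ld Ld_star by linarith
    show "int (L_d (\<lambda>k. ZN1 k a) (\<lambda>k. Z0 k b) N)
        = (\<Sum>\<nu>\<in>{\<nu>\<in>\<sigma>. a < \<nu> \<and> \<nu> \<le> b}. finite_eigenvalue_mult X \<nu>)"
      unfolding \<sigma> mult using jumps Ld by simp
  qed
qed

end
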